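(* Let $(\mathsf C,\mathsf O,\mathsf P,(-)^{\times},(-)^{\square},\beta,\phi)$ satisfy conditions [A]–[D], and let $(\mathsf F,(-)^\flat,\gamma^\times,\gamma^\square)$ satisfy conditions [E1]–[E3] (all described in the context). Let $\mathscr C=((-)^!,\mu^!_\times,\mu^!_\square)$ be a perfect pseudofunctorial cover. Then there is a unique family of flat-base-change isomorphisms $\gamma^!$, i.e. for every cartesian square $\mathfrak s$ with $f:X\to Y$ in $\mathsf Q$, $u:Z\to Y$ in $\mathsf F$ and projections $f':W\to Z$, $u':W\to X$, an isomorphism $\gamma^!_{\mathfrak s}:u'^{\flat}f^!\to f'^!u^{\flat}$, such that: (i) $\gamma^!$ is vertically transitive (for vertical composites of squares along $\mathsf Q$-maps) and horizontally transitive (for horizontal composites of squares along $\mathsf F$-maps); (ii) if $f\in\mathsf P$, then $\mu^!_\times\circ\gamma^!_{\mathfrak s}=\gamma^\times_{\mathfrak s}\circ\mu^!_\times$ as maps $u'^\flat f^!\to f'^\times u^\flat$; and if $f\in\mathsf O$, then $\mu^!_\square\circ\gamma^!_{\mathfrak s}=\gamma^\square_{\mathfrak s}\circ\mu^!_\square$ as maps $u'^\flat f^!\to f'^\square u^\flat$. In particular, if $\mathscr C'=((-)^{\#},\mu^{\#}_\times,\mu^{\#}_\square)$ is another perfect cover with $\gamma^{\#}$ the corresponding family of flat-base-change isomorphisms, then for each cartesian square $\mathfrak s$ with $f:X\to Y$ in $\mathsf Q$, $u:Z\to Y$ in $\mathsf F$ and projections $f':W\to Z$, $u':W\to X$, the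 maps $u'^\flat f^{\#}\to u'^\flat f^!\xrightarrow{\gamma^!_{\mathfrak s}}f'^!u^\flat$ and $u'^\flat f^{\#}\xrightarrow{\gamma^{\#}_{\mathfrak s}}f'^{\#}u^\flat\to f'^!u^\flat$ agree, where the unlabeled maps are induced by the unique isomorphism of covers $\mathscr C'\to\mathscr C$.
   Context: **Pseudofunctors.** "Pseudofunctor" means contravariant normalized pseudofunctor: $(-)^{\#}$ on a category $\mathsf C$ assigns to each object $X$ a category $X^{\#}$, to each $f:X\to Y$ a functor $f^{\#}:Y^{\#}\to X^{\#}$, and to each pair $X\xrightarrow{f}Y\xrightarrow{g}Z$ an isomorphism $C^{\#}_{f,g}:f^{\#}g^{\#}\to(gf)^{\#}$, associative for triple compositions, with $(1_Z)^{\#}=\mathbf 1_{Z^{\#}}$ and $C^{\#}_{1_X,f},C^{\#}_{f,1_Y}$ identities. A morphism of pseudofunctors $(-)^{\#}\to(-)^{!}$ consists of functors $S_X:X^{\#}\to X^{!}$ and natural transformations $S_Xf^{\#}\to f^{!}S_Y$ such that for each pair $f,g$ the composites $S_Xf^{\#}g^{\#}\to f^!S_Yg^{\#}\to f^!g^!S_Z\to(gf)^!S_Z$ and $S_Xf^{\#}g^{\#}\to S_X(gf)^{\#}\to(gf)^!S_Z$ agree, and for $f=1_X$ the map $S_X\to S_X$ is the identity. Morphisms compose in the obvious way. **Input data.** [A] $\mathsf C$ is a category with subcategories $\mathsf O,\mathsf P$, each stable under base change by maps of $\mathsf C$: for $f:X\to Y$ in $\mathsf P$ (resp. $\mathsf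 O$) and $g:Z\to Y$ in $\mathsf C$ the fibered product of $f$ with $g$ exists and the projection to $Z$ is in $\mathsf P$ (resp. $\mathsf O$). All isomorphisms of $\mathsf C$ (hence all objects) lie in both $\mathsf O$ and $\mathsf P$. If $X\xrightarrow{f}Y\xrightarrow{g}Z$ are in $\mathsf C$ with $gf\in\mathsf P$ and $g\in\mathsf O$ or $g\in\mathsf P$, then $f\in\mathsf P$. [B] There are pseudofunctors $(-)^{\times}$ on $\mathsf P$ and $(-)^{\square}$ on $\mathsf O$ with $X^{\times}=X^{\square}=:\mathcal D_X$ for every object $X$. [C] For every cartesian square $\mathfrak s$ with $f:X\to Y$ in $\mathsf P$, $i:V\to Y$ in $\mathsf O$ and projections $f':U\to V$, $i':U\to X$, there is a given isomorphism $\beta_{\mathfrak s}=\beta_{f,i}:i'^{\square}f^{\times}\to f'^{\times}i^{\square}$, such that: (i) (horizontal transitivity) if a cartesian square $\mathfrak s_1$ with $j:V_1\to V$ in $\mathsf O$, $j':U_1\to U$, $f'':U_1\to V_1$ is appended and $\mathfrak c$ is the composite square, then $\beta_{\mathfrak c}\circ C^{\square}_{j',i'}(f^\times)=f''^{\times}(C^{\square}_{j,i})\circ\beta_{\mathfrak s_1}(i^{\square})\circ j'^{\square}(\beta_{\mathfrak s})$; (ii) (vertical transitivity) if a cartesian square $\mathfrak s_1$ with $g:X_1\to X$ in $\mathsf P$, $g':U_1\to U$, $i'':U_1\to X_1$ is appended and $\mathfrak c$ is the composite square, then $\beta_{\mathfrak c}\circ i''^{\square}(C^{\times}_{g,f})=C^{\times}_{g',f'}(i^{\square})\circ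 g'^{\times}(\beta_{\mathfrak s})\circ\beta_{\mathfrak s_1}(f^{\times})$. [D] For any $X\xrightarrow{f}Y\xrightarrow{g}X$ in $\mathsf C$ with $gf=1_X$ and $g\in\mathsf O$ (so $f\in\mathsf P$) there is a given isomorphism $\phi_{f,g}:f^{\times}g^{\square}\to\mathbf 1_{\mathcal D_X}$ such that: (i) for $h:X'\to X$ in $\mathsf C$, let $f':X'\to Y'$, $g':Y'\to X'$, $h':Y'\to Y$ be obtained by base change along $h$ (so $g'f'=1_{X'}$ and both squares, the left one with sides $f',h,h',f$ and the right one with sides $g',h',h,g$, are cartesian). (a) If $h\in\mathsf P$, then $\phi_{f',g'}(h^\times)$ equals $f'^{\times}g'^{\square}h^{\times}\to f'^{\times}h'^{\times}g^{\square}\to h^{\times}f^{\times}g^{\square}\to h^{\times}$, where the maps are induced by $\beta$ of the right square, pseudofunctoriality of $(-)^\times$, and $\phi_{f,g}$. (b) If $h\in\mathsf O$, then $\phi_{f',g'}(h^\square)$ equals $f'^{\times}g'^{\square}h^{\square}\to f'^{\times}h'^{\square}g^{\square}\to h^{\square}f^{\times}g^{\square}\to h^{\square}$, where the maps are induced by pseudofunctoriality of $(-)^\square$, the inverse of $\beta:h^\square f^\times\to f'^\times h'^\square$ of the (transposed) left square, and $\phi_{f,g}$; (ii) given $f:X\to Y$, $h:Y\to Z$, $i:X\to W$ in $\mathsf P$ and $g:Y\to X$, $j:Z\to W$, $k:W\to X$ in $\mathsf O$ with $gf=1_X=ki$ and with the square $ig=jh$ cartesian, the composite $f^{\times}h^{\times}j^{\square}k^{\square}\to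 f^{\times}g^{\square}i^{\times}k^{\square}\to\mathbf 1_{\mathcal D_X}$ (induced by the inverse of $\beta:g^\square i^\times\to h^\times j^\square$, then $\phi_{f,g},\phi_{i,k}$) equals $f^{\times}h^{\times}j^{\square}k^{\square}\to(hf)^{\times}(kj)^{\square}\xrightarrow{\phi_{hf,kj}}\mathbf 1_{\mathcal D_X}$. **Flat data.** [E1] $\mathsf F$ is a subcategory of $\mathsf C$ stable under base change by maps in $\mathsf O$ or $\mathsf P$ and containing all isomorphisms of $\mathsf C$. [E2] $(-)^\flat$ is a pseudofunctor on $\mathsf F$ with $X^\flat=\mathcal D_X$ for all $X$. [E3] For each cartesian square $\mathfrak s$ with $f:X\to Y$, $u:Z\to Y$ in $\mathsf F$, $f':W\to Z$, $u':W\to X$: (i) if $f\in\mathsf P$ there is a given isomorphism $\gamma^\times_{\mathfrak s}=\gamma^\times_{f,u}:u'^\flat f^\times\to f'^\times u^\flat$, transitive (in the sense analogous to [C](i),(ii)) for extensions of $\mathfrak s$ by $\mathsf F$-maps horizontally or $\mathsf P$-maps vertically; (ii) if $f\in\mathsf O$ there is a given isomorphism $\gamma^\square_{\mathfrak s}=\gamma^\square_{f,u}:u'^\flat f^\square\to f'^\square u^\flat$, transitive for extensions by $\mathsf F$-maps horizontally or $\mathsf O$-maps vertically. These satisfy: (a) For $f:X\to Y$ in $\mathsf P$, $g:Z\to Y$ in $\mathsf O$, $u:W\to Y$ in $\mathsf F$, form a cartesian cube (all faces fibered squares) with projections $g_2:X\times_YZ\to X$, $f_2:X\times_YZ\to Z$,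 $u_2:X\times_YW\to X$, $f_3:X\times_YW\to W$, $u_3:Z\times_YW\to Z$, $g_3:Z\times_YW\to W$, and from the triple product $T$: $u_1:T\to X\times_YZ$, $g_1:T\to X\times_YW$, $f_1:T\to Z\times_YW$. Then the two composites $g_1^\square u_2^\flat f^\times\to u_1^\flat g_2^\square f^\times\to u_1^\flat f_2^\times g^\square\to f_1^\times u_3^\flat g^\square$ (induced by $(\gamma^\square_{g_2,u_2})^{-1}$, $\beta_{f,g}$, $\gamma^\times_{f_2,u_3}$) and $g_1^\square u_2^\flat f^\times\to g_1^\square f_3^\times u^\flat\to f_1^\times g_3^\square u^\flat\to f_1^\times u_3^\flat g^\square$ (induced by $\gamma^\times_{f,u}$, $\beta_{f_3,g_3}$, $(\gamma^\square_{g,u})^{-1}$) agree. (b) For $X\xrightarrow{f}Y\xrightarrow{g}X$ with $gf=1_X$, $f\in\mathsf P$, $g\in\mathsf O$, and $u:X'\to X$ in $\mathsf F$, with base changes $f':X'\to Y'$, $g':Y'\to X'$, $u':Y'\to Y$, the composite $f'^\times g'^\square u^\flat\to f'^\times u'^\flat g^\square\to u^\flat f^\times g^\square\to u^\flat$ (induced by $(\gamma^\square_{g,u})^{-1}$, $(\gamma^\times_{f,u'})^{-1}$, $\phi_{f,g}$) equals $\phi_{f',g'}(u^\flat)$. **Covers.** $\mathsf Q$ is the smallest subcategory of $\mathsf C$ containing $\mathsf O$ and $\mathsf P$. A (pseudofunctorial) cover is a triple $((-)^{!},\mu^{!}_{\times},\mu^{!}_{\square})$ with $(-)^!$ a pseudofunctor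 on $\mathsf Q$, and $\mu^!_\times:(-)^!|_{\mathsf P}\to(-)^\times$, $\mu^!_\square:(-)^!|_{\mathsf O}\to(-)^\square$ morphisms of pseudofunctors such that: (a) for each $X$ the functors $X^!\to\mathcal D_X$ given by $\mu^!_\times$ and $\mu^!_\square$ coincide (call it $S_X$); (b) for each cartesian square $\mathfrak s$ with $f:X\to Y$ in $\mathsf P$, $i:V\to Y$ in $\mathsf O$ and projections $f':U\to V$, $i':U\to X$, the composite $S_Ui'^!f^!\to i'^\square S_Xf^!\to i'^\square f^\times S_Y\xrightarrow{\beta_{\mathfrak s}}f'^\times i^\square S_Y$ equals $S_Ui'^!f^!\to S_Uf'^!i^!\to f'^\times S_Vi^!\to f'^\times i^\square S_Y$; (c) for $X\xrightarrow{i}Y\xrightarrow{h}X$ with $hi=1_X$, $i\in\mathsf P$, $h\in\mathsf O$, the composite $S_Xi^!h^!\to i^\times S_Yh^!\to i^\times h^\square S_X\xrightarrow{\phi_{i,h}}S_X$ equals the map induced by $C^!_{i,h}$. A morphism of covers $((-)^{\#},\mu^{\#}_\times,\mu^{\#}_\square)\to((-)^!,\mu^!_\times,\mu^!_\square)$ is a morphism of pseudofunctors $\epsilon:(-)^{\#}\to(-)^!$ with $\mu^!_\times\circ\epsilon|_{\mathsf P}=\mu^{\#}_\times$ and $\mu^!_\square\circ\epsilon|_{\mathsf O}=\mu^{\#}_\square$. A cover is perfect if $\mu^!_\times,\mu^!_\square$ are isomorphisms; then each $S_X$ is an isomorphism of categories, by which $X^!$ is identified with $\mathcal D_X$ (so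 that expressions such as $u'^\flat f^!$ make sense). Between any two perfect covers there is a unique isomorphism of covers. *)

theory Defs
  imports Main
begin

section \<open>Categories, functors, natural transformations\<close>

record ('o, 'a) cat =
  obj :: "'o set"
  arr :: "'a set"
  src :: "'a \<Rightarrow> 'o"
  tgt :: "'a \<Rightarrow> 'o"
  ide :: "'o \<Rightarrow> 'a"
  cmp :: "'a \<Rightarrow> 'a \<Rightarrow> 'a"

text \<open>Composition is written in the usual order: \<open>g \<cdot>\<^bsub>C\<^esub> f\<close> is \<open>f\<close> followed by \<open>g\<close>.\<close>

abbreviation cmp_syntax :: "'a \<Rightarrow> ('o, 'a) cat \<Rightarrow> 'a \<Rightarrow> 'a"  ("_ \<cdot>\<^bsub>_\<^esub> _" [71, 0, 70] 70)
  where "g \<cdot>\<^bsub>C\<^esub> f \<equiv> cmp C g f"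

definition hom :: "('o, 'a) cat \<Rightarrow> 'o \<Rightarrow> 'o \<Rightarrow> 'a set" where
  "hom C X Y = {f \<in> arr C. src C f = X \<and> tgt C f = Y}"

locale category =
  fixes C :: "('o, 'a) cat"
  assumes src_obj: "f \<in> arr C \<Longrightarrow> src C f \<in> obj C"
    and tgt_obj: "f \<in> arr C \<Longrightarrow> tgt C f \<in> obj C"
    and ide_hom: "X \<in> obj C \<Longrightarrow> ide C X \<in> hom C X X"
    and cmp_hom: "\<lbrakk>f \<in> hom C X Y; g \<in> hom C Y Z\<rbrakk> \<Longrightarrow> g \<cdot>\<^bsub>C\<^esub> f \<in> hom C X Z"
    and ide_right: "f \<in> hom C X Y \<Longrightarrow> f \<cdot>\<^bsub>C\<^esub> ide C X = f"
    and ide_left: "f \<in> hom C X Y \<Longrightarrow> ide C Y \<cdot>\<^bsub>C\<^esub> f = f"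
    and assoc: "\<lbrakk>f \<in> hom C W X; g \<in> hom C X Y; h \<in> hom C Y Z\<rbrakk>
      \<Longrightarrow> h \<cdot>\<^bsub>C\<^esub> (g \<cdot>\<^bsub>C\<^esub> f) = (h \<cdot>\<^bsub>C\<^esub> g) \<cdot>\<^bsub>C\<^esub> f"

definition inverse_arrows :: "('o, 'a) cat \<Rightarrow> 'a \<Rightarrow> 'a \<Rightarrow> bool" where
  "inverse_arrows C f g \<longleftrightarrow> f \<in> arr C \<and> g \<in> hom C (tgt C f) (src C f) \<and>
     g \<cdot>\<^bsub>C\<^esub> f = ide C (src C f) \<and> f \<cdot>\<^bsub>C\<^esub> g = ide C (tgt C f)"

definition iso_arr :: "('o, 'a) cat \<Rightarrow> 'a \<Rightarrow> bool" where
  "iso_arr C f \<longleftrightarrow> (\<exists>g. inverse_arrows C f g)"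

definition inv_arr :: "('o, 'a) cat \<Rightarrow> 'a \<Rightarrow> 'a" where
  "inv_arr C f = (THE g. inverse_arrows C f g)"

record ('o, 'a, 'p, 'q) func =
  ob :: "'o \<Rightarrow> 'p"
  ar :: "'a \<Rightarrow> 'q"

definition is_functor :: "('o, 'a) cat \<Rightarrow> ('p, 'q) cat \<Rightarrow> ('o, 'a, 'p, 'q) func \<Rightarrow> bool" where
  "is_functor A B F \<longleftrightarrow> category A \<and> category B \<and>
     (\<forall>x\<in>obj A. ob F x \<in> obj B) \<and>
     (\<forall>x y. \<forall>m\<in>hom A x y. ar F m \<in> hom B (ob F x) (ob F y)) \<and>
     (\<forall>x\<in>obj A. ar F (ide A x) = ide B (ob F x)) \<and>
     (\<forall>x y z. \<forall>m\<in>hom A x y. \<forall>n\<in>hom A y z. ar F (n \<cdot>\<^bsub>A\<^esub> m) = ar F n \<cdot>\<^bsub>B\<^esub> ar F m)"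

text \<open>Functions are only meaningful on the carriers, so functors are compared there.\<close>

definition functor_eq :: "('o, 'a) cat \<Rightarrow> ('o, 'a, 'p, 'q) func \<Rightarrow> ('o, 'a, 'p, 'q) func \<Rightarrow> bool" where
  "functor_eq A F G \<longleftrightarrow> (\<forall>x\<in>obj A. ob F x = ob G x) \<and> (\<forall>m\<in>arr A. ar F m = ar G m)"

definition id_functor :: "('o, 'a, 'o, 'a) func" where
  "id_functor = \<lparr>ob = (\<lambda>x. x), ar = (\<lambda>m. m)\<rparr>"

definition comp_functor :: "('p, 'q, 'r, 's) func \<Rightarrow> ('o, 'a, 'p, 'q) func \<Rightarrow> ('o, 'a, 'r, 's) func"
    (infixl "\<circ>\<^sub>F" 65) where
  "G \<circ>\<^sub>F F = \<lparr>ob = (\<lambda>x. ob G (ob F x)), ar = (\<lambda>m. ar G (ar F m))\<rparr>"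

text \<open>Intended for isomorphisms of categories \<open>F\<close> defined on \<open>A\<close>.\<close>

definition inv_functor :: "('o, 'a) cat \<Rightarrow> ('o, 'a, 'p, 'q) func \<Rightarrow> ('p, 'q, 'o, 'a) func" where
  "inv_functor A F = \<lparr>ob = inv_into (obj A) (ob F), ar = inv_into (arr A) (ar F)\<rparr>"

definition nat_trans :: "('o, 'a) cat \<Rightarrow> ('p, 'q) cat \<Rightarrow> ('o, 'a, 'p, 'q) func \<Rightarrow>
    ('o, 'a, 'p, 'q) func \<Rightarrow> ('o \<Rightarrow> 'q) \<Rightarrow> bool" where
  "nat_trans A B F G \<tau> \<longleftrightarrow> is_functor A B F \<and> is_functor A B G \<and>
     (\<forall>x\<in>obj A. \<tau> x \<in> hom B (ob F x) (ob G x)) \<and>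
     (\<forall>x y. \<forall>m\<in>hom A x y. \<tau> y \<cdot>\<^bsub>B\<^esub> ar F m = ar G m \<cdot>\<^bsub>B\<^esub> \<tau> x)"

definition nat_iso :: "('o, 'a) cat \<Rightarrow> ('p, 'q) cat \<Rightarrow> ('o, 'a, 'p, 'q) func \<Rightarrow>
    ('o, 'a, 'p, 'q) func \<Rightarrow> ('o \<Rightarrow> 'q) \<Rightarrow> bool" where
  "nat_iso A B F G \<tau> \<longleftrightarrow> nat_trans A B F G \<tau> \<and> (\<forall>x\<in>obj A. iso_arr B (\<tau> x))"

section \<open>Subcategories and cartesian squares\<close>

text \<open>A subcategory is given by its set of arrows; its objects are those whose identity
  belongs to that set.\<close>

definition subcategory :: "('o, 'a) cat \<Rightarrow> 'a set \<Rightarrow> bool" where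
  "subcategory C S \<longleftrightarrow> S \<subseteq> arr C \<and>
     (\<forall>f\<in>S. ide C (src C f) \<in> S \<and> ide C (tgt C f) \<in> S) \<and>
     (\<forall>f\<in>S. \<forall>g\<in>S. tgt C f = src C g \<longrightarrow> g \<cdot>\<^bsub>C\<^esub> f \<in> S)"

definition subcat :: "('o, 'a) cat \<Rightarrow> 'a set \<Rightarrow> ('o, 'a) cat" where
  "subcat C S = C\<lparr>obj := {X \<in> obj C. ide C X \<in> S}, arr := S\<rparr>"

definition generated_subcategory :: "('o, 'a) cat \<Rightarrow> 'a set \<Rightarrow> 'a set" where
  "generated_subcategory C G = \<Inter>{S. subcategory C S \<and> G \<subseteq> S}"

text \<open>\<open>cartesian C f i f' i'\<close>: \<open>f\<close> and \<open>i\<close> have the same target, \<open>f'\<close> is the projection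
  parallel to \<open>f\<close> (onto the source of \<open>i\<close>) and \<open>i'\<close> the projection parallel to \<open>i\<close>
  (onto the source of \<open>f\<close>). The transposed square is \<open>cartesian C i f i' f'\<close>.\<close>

definition cartesian :: "('o, 'a) cat \<Rightarrow> 'a \<Rightarrow> 'a \<Rightarrow> 'a \<Rightarrow> 'a \<Rightarrow> bool" where
  "cartesian C f i f' i' \<longleftrightarrow>
     f \<in> arr C \<and> i \<in> arr C \<and> tgt C f = tgt C i \<and>
     f' \<in> arr C \<and> i' \<in> arr C \<and> src C f' = src C i' \<and>
     tgt C f' = src C i \<and> tgt C i' = src C f \<and>
     f \<cdot>\<^bsub>C\<^esub> i' = i \<cdot>\<^bsub>C\<^esub> f' \<and>
     (\<forall>W. \<forall>a\<in>hom C W (src C f). \<forall>b\<in>hom C W (src C i). f \<cdot>\<^bsub>C\<^esub> a = i \<cdot>\<^bsub>C\<^esub> b \<longrightarrow>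
        (\<exists>!t. t \<in> hom C W (src C f') \<and> i' \<cdot>\<^bsub>C\<^esub> t = a \<and> f' \<cdot>\<^bsub>C\<^esub> t = b))"

definition stable_under_base_change :: "('o, 'a) cat \<Rightarrow> 'a set \<Rightarrow> 'a set \<Rightarrow> bool" where
  "stable_under_base_change C S R \<longleftrightarrow>
     (\<forall>f\<in>S. \<forall>g\<in>R. tgt C f = tgt C g \<longrightarrow>
        (\<exists>f' g'. cartesian C f g f' g') \<and> (\<forall>f' g'. cartesian C f g f' g' \<longrightarrow> f' \<in> S))"

section \<open>Pseudofunctors\<close>

text \<open>\<open>pcat F X\<close> is \<open>X\<^sup>#\<close>, \<open>F\<langle>f\<rangle>\<close> is \<open>f\<^sup>#\<close>, and \<open>coh F f g\<close> is
  \<open>C\<^sub>f\<^sub>,\<^sub>g : f\<^sup># g\<^sup># \<rightarrow> (gf)\<^sup>#\<close>, given by its components.\<close>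

record ('o, 'a, 'p, 'q) pseudo =
  pcat :: "'o \<Rightarrow> ('p, 'q) cat"
  pfun :: "'a \<Rightarrow> ('p, 'q, 'p, 'q) func"  ("_\<langle>_\<rangle>" [1000, 0] 1000)
  coh :: "'a \<Rightarrow> 'a \<Rightarrow> 'p \<Rightarrow> 'q"

locale pseudofunctor = category K
  for K :: "('o, 'a) cat" +
  fixes F :: "('o, 'a, 'p, 'q) pseudo"
  assumes pcat_category: "X \<in> obj K \<Longrightarrow> category (pcat F X)"
    and pfun_functor: "f \<in> hom K X Y \<Longrightarrow> is_functor (pcat F Y) (pcat F X) (F\<langle>f\<rangle>)"
    and coh_iso: "\<lbrakk>f \<in> hom K X Y; g \<in> hom K Y Z\<rbrakk>
      \<Longrightarrow> nat_iso (pcat F Z) (pcat F X) (F\<langle>f\<rangle> \<circ>\<^sub>F F\<langle>g\<rangle>) (F\<langle>g \<cdot>\<^bsub>K\<^esub> f\<rangle>) (coh F f g)"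
    and coh_assoc: "\<lbrakk>f \<in> hom K X Y; g \<in> hom K Y Z; h \<in> hom K Z W; A \<in> obj (pcat F W)\<rbrakk>
      \<Longrightarrow> coh F (g \<cdot>\<^bsub>K\<^esub> f) h A \<cdot>\<^bsub>pcat F X\<^esub> coh F f g (ob (F\<langle>h\<rangle>) A) =
          coh F f (h \<cdot>\<^bsub>K\<^esub> g) A \<cdot>\<^bsub>pcat F X\<^esub> ar (F\<langle>f\<rangle>) (coh F g h A)"
    and pfun_ide: "X \<in> obj K \<Longrightarrow> functor_eq (pcat F X) (F\<langle>ide K X\<rangle>) id_functor"
    and coh_ide_left: "\<lbrakk>f \<in> hom K X Y; A \<in> obj (pcat F Y)\<rbrakk>
      \<Longrightarrow> coh F (ide K X) f A = ide (pcat F X) (ob (F\<langle>f\<rangle>) A)"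
    and coh_ide_right: "\<lbrakk>f \<in> hom K X Y; A \<in> obj (pcat F Y)\<rbrakk>
      \<Longrightarrow> coh F f (ide K Y) A = ide (pcat F X) (ob (F\<langle>f\<rangle>) A)"

text \<open>A morphism from \<open>U\<close> to \<open>V\<close> consists of functors \<open>mob s X : U X \<rightarrow> V X\<close> and, for
  \<open>f : X \<rightarrow> Y\<close>, a natural transformation \<open>mar s f : mob s X \<circ> U\<langle>f\<rangle> \<rightarrow> V\<langle>f\<rangle> \<circ> mob s Y\<close>.\<close>

record ('o, 'a, 'p, 'q, 'r, 's) pmor =
  mob :: "'o \<Rightarrow> ('p, 'q, 'r, 's) func"
  mar :: "'a \<Rightarrow> 'p \<Rightarrow> 's"

definition pseudo_morphism :: "('o, 'a) cat \<Rightarrow> ('o, 'a, 'p, 'q) pseudo \<Rightarrow> ('o, 'a, 'r, 's) pseudo \<Rightarrow>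
    ('o, 'a, 'p, 'q, 'r, 's) pmor \<Rightarrow> bool" where
  "pseudo_morphism K U V s \<longleftrightarrow> pseudofunctor K U \<and> pseudofunctor K V \<and>
     (\<forall>X\<in>obj K. is_functor (pcat U X) (pcat V X) (mob s X)) \<and>
     (\<forall>X Y. \<forall>f\<in>hom K X Y.
        nat_trans (pcat U Y) (pcat V X) (mob s X \<circ>\<^sub>F U\<langle>f\<rangle>) (V\<langle>f\<rangle> \<circ>\<^sub>F mob s Y) (mar s f)) \<and>
     (\<forall>X Y Z. \<forall>f\<in>hom K X Y. \<forall>g\<in>hom K Y Z. \<forall>A\<in>obj (pcat U Z).
        coh V f g (ob (mob s Z) A) \<cdot>\<^bsub>pcat V X\<^esub>
          (ar (V\<langle>f\<rangle>) (mar s g A) \<cdot>\<^bsub>pcat V X\<^esub> mar s f (ob (U\<langle>g\<rangle>) A)) =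
        mar s (g \<cdot>\<^bsub>K\<^esub> f) A \<cdot>\<^bsub>pcat V X\<^esub> ar (mob s X) (coh U f g A)) \<and>
     (\<forall>X\<in>obj K. \<forall>A\<in>obj (pcat U X). mar s (ide K X) A = ide (pcat V X) (ob (mob s X) A))"

definition pmor_id :: "('o, 'a) cat \<Rightarrow> ('o, 'a, 'p, 'q) pseudo \<Rightarrow> ('o, 'a, 'p, 'q, 'p, 'q) pmor" where
  "pmor_id K U = \<lparr>mob = (\<lambda>X. id_functor), mar = (\<lambda>f A. ide (pcat U (src K f)) (ob (U\<langle>f\<rangle>) A))\<rparr>"

text \<open>\<open>pmor_comp K W t s\<close> is \<open>t \<circ> s\<close>, where \<open>W\<close> is the codomain of \<open>t\<close>.\<close>

definition pmor_comp :: "('o, 'a) cat \<Rightarrow> ('o, 'a, 't, 'u) pseudo \<Rightarrow> ('o, 'a, 'r, 's, 't, 'u) pmor \<Rightarrow>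
    ('o, 'a, 'p, 'q, 'r, 's) pmor \<Rightarrow> ('o, 'a, 'p, 'q, 't, 'u) pmor" where
  "pmor_comp K W t s =
     \<lparr>mob = (\<lambda>X. mob t X \<circ>\<^sub>F mob s X),
      mar = (\<lambda>f A. mar t f (ob (mob s (tgt K f)) A) \<cdot>\<^bsub>pcat W (src K f)\<^esub>
                   ar (mob t (src K f)) (mar s f A))\<rparr>"

definition pmor_eq :: "('o, 'a) cat \<Rightarrow> ('o, 'a, 'p, 'q) pseudo \<Rightarrow> ('o, 'a, 'p, 'q, 'r, 's) pmor \<Rightarrow>
    ('o, 'a, 'p, 'q, 'r, 's) pmor \<Rightarrow> bool" where
  "pmor_eq K U s t \<longleftrightarrow> (\<forall>X\<in>obj K. functor_eq (pcat U X) (mob s X) (mob t X)) \<and>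
     (\<forall>f\<in>arr K. \<forall>A\<in>obj (pcat U (tgt K f)). mar s f A = mar t f A)"

definition pseudo_iso :: "('o, 'a) cat \<Rightarrow> ('o, 'a, 'p, 'q) pseudo \<Rightarrow> ('o, 'a, 'r, 's) pseudo \<Rightarrow>
    ('o, 'a, 'p, 'q, 'r, 's) pmor \<Rightarrow> bool" where
  "pseudo_iso K U V s \<longleftrightarrow> pseudo_morphism K U V s \<and>
     (\<exists>t. pseudo_morphism K V U t \<and>
        pmor_eq K U (pmor_comp K U t s) (pmor_id K U) \<and>
        pmor_eq K V (pmor_comp K V s t) (pmor_id K V))"

section \<open>Base change isomorphisms\<close>

text \<open>\<open>V\<close> is the pseudofunctor pulled back along the vertical maps (those in \<open>R\<close>), \<open>H\<close> the one
  pulled back along the horizontal maps (those in \<open>L\<close>); \<open>V\<close> and \<open>H\<close> take the same values on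
  objects. For a cartesian square with \<open>f \<in> R\<close>, \<open>i \<in> L\<close> and projections \<open>f'\<close>, \<open>i'\<close>,
  \<open>\<beta> f i f' i'\<close> is an isomorphism \<open>H\<langle>i'\<rangle> V\<langle>f\<rangle> \<rightarrow> V\<langle>f'\<rangle> H\<langle>i\<rangle>\<close>.\<close>

locale base_change =
  fixes C :: "('o, 'a) cat"
    and R :: "'a set"
    and L :: "'a set"
    and V :: "('o, 'a, 'p, 'q) pseudo"
    and H :: "('o, 'a, 'p, 'q) pseudo"
    and \<beta> :: "'a \<Rightarrow> 'a \<Rightarrow> 'a \<Rightarrow> 'a \<Rightarrow> 'p \<Rightarrow> 'q"
  assumes bc_iso: "\<lbrakk>cartesian C f i f' i'; f \<in> R; i \<in> L\<rbrakk>
      \<Longrightarrow> nat_iso (pcat V (tgt C f)) (pcat V (src C f'))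
            (H\<langle>i'\<rangle> \<circ>\<^sub>F V\<langle>f\<rangle>) (V\<langle>f'\<rangle> \<circ>\<^sub>F H\<langle>i\<rangle>) (\<beta> f i f' i')"
    and horizontal: "\<lbrakk>cartesian C f i f' i'; f \<in> R; i \<in> L;
        cartesian C f' j f'' j'; j \<in> L; A \<in> obj (pcat V (tgt C f))\<rbrakk>
      \<Longrightarrow> \<beta> f (i \<cdot>\<^bsub>C\<^esub> j) f'' (i' \<cdot>\<^bsub>C\<^esub> j') A \<cdot>\<^bsub>pcat V (src C f'')\<^esub> coh H j' i' (ob (V\<langle>f\<rangle>) A) =
          ar (V\<langle>f''\<rangle>) (coh H j i A) \<cdot>\<^bsub>pcat V (src C f'')\<^esub>
            (\<beta> f' j f'' j' (ob (H\<langle>i\<rangle>) A) \<cdot>\<^bsub>pcat V (src C f'')\<^esub> ar (H\<langle>j'\<rangle>) (\<beta> f i f' i' A))"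
    and vertical: "\<lbrakk>cartesian C f i f' i'; f \<in> R; i \<in> L;
        cartesian C g i' g' i''; g \<in> R; A \<in> obj (pcat V (tgt C f))\<rbrakk>
      \<Longrightarrow> \<beta> (f \<cdot>\<^bsub>C\<^esub> g) i (f' \<cdot>\<^bsub>C\<^esub> g') i'' A \<cdot>\<^bsub>pcat V (src C g')\<^esub> ar (H\<langle>i''\<rangle>) (coh V g f A) =
          coh V g' f' (ob (H\<langle>i\<rangle>) A) \<cdot>\<^bsub>pcat V (src C g')\<^esub>
            (ar (V\<langle>g'\<rangle>) (\<beta> f i f' i' A) \<cdot>\<^bsub>pcat V (src C g')\<^esub> \<beta> g i' g' i'' (ob (V\<langle>f\<rangle>) A))"

section \<open>The input data\<close>

text \<open>\<open>T\<close> is the pseudofunctor \<open>(-)\<^sup>\<times>\<close> on the subcategory \<open>Pc\<close> and \<open>B\<close> the pseudofunctor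
  \<open>(-)\<^sup>\<box>\<close> on \<open>Oc\<close>; the common value \<open>\<D>\<^sub>X\<close> is \<open>pcat T X\<close>.\<close>

definition retract_pair :: "('o, 'a) cat \<Rightarrow> 'a \<Rightarrow> 'a \<Rightarrow> bool" where
  "retract_pair C f g \<longleftrightarrow> f \<in> arr C \<and> g \<in> hom C (tgt C f) (src C f) \<and>
     g \<cdot>\<^bsub>C\<^esub> f = ide C (src C f)"

locale pasting_data = category C
  for C :: "('o, 'a) cat" +
  fixes Oc :: "'a set"
    and Pc :: "'a set"
    and T :: "('o, 'a, 'p, 'q) pseudo"
    and B :: "('o, 'a, 'p, 'q) pseudo"
    and \<beta> :: "'a \<Rightarrow> 'a \<Rightarrow> 'a \<Rightarrow> 'a \<Rightarrow> 'p \<Rightarrow> 'q"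
    and \<phi> :: "'a \<Rightarrow> 'a \<Rightarrow> 'p \<Rightarrow> 'q"
  assumes Oc_subcategory: "subcategory C Oc"
    and Pc_subcategory: "subcategory C Pc"
    and Oc_stable: "stable_under_base_change C Oc (arr C)"
    and Pc_stable: "stable_under_base_change C Pc (arr C)"
    and iso_Oc: "iso_arr C f \<Longrightarrow> f \<in> Oc"
    and iso_Pc: "iso_arr C f \<Longrightarrow> f \<in> Pc"
    and Pc_cancel: "\<lbrakk>f \<in> hom C X Y; g \<in> hom C Y Z; g \<cdot>\<^bsub>C\<^esub> f \<in> Pc; g \<in> Oc \<or> g \<in> Pc\<rbrakk> \<Longrightarrow> f \<in> Pc"
    and T_pseudofunctor: "pseudofunctor (subcat C Pc) T"
    and B_pseudofunctor: "pseudofunctor (subcat C Oc) B"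
    and same_cat: "X \<in> obj C \<Longrightarrow> pcat B X = pcat T X"
    and \<beta>_base_change: "base_change C Pc Oc T B \<beta>"
    and \<phi>_iso: "\<lbrakk>retract_pair C f g; g \<in> Oc\<rbrakk>
      \<Longrightarrow> nat_iso (pcat T (src C f)) (pcat T (src C f)) (T\<langle>f\<rangle> \<circ>\<^sub>F B\<langle>g\<rangle>) id_functor (\<phi> f g)"
    and \<phi>_base_change_Pc: "\<lbrakk>retract_pair C f g; g \<in> Oc; retract_pair C f' g'; h \<in> Pc;
        cartesian C g h g' h'; cartesian C f h' f' h; A \<in> obj (pcat T (src C f))\<rbrakk>
      \<Longrightarrow> \<phi> f' g' (ob (T\<langle>h\<rangle>) A) =
          ar (T\<langle>h\<rangle>) (\<phi> f g A) \<cdot>\<^bsub>pcat T (src C h)\<^esub>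
            (inv_arr (pcat T (src C h)) (coh T h f (ob (B\<langle>g\<rangle>) A)) \<cdot>\<^bsub>pcat T (src C h)\<^esub>
              (coh T f' h' (ob (B\<langle>g\<rangle>) A) \<cdot>\<^bsub>pcat T (src C h)\<^esub>
                ar (T\<langle>f'\<rangle>) (\<beta> h g h' g' A)))"
    and \<phi>_base_change_Oc: "\<lbrakk>retract_pair C f g; g \<in> Oc; retract_pair C f' g'; h \<in> Oc;
        cartesian C g h g' h'; cartesian C f h' f' h; A \<in> obj (pcat T (src C f))\<rbrakk>
      \<Longrightarrow> \<phi> f' g' (ob (B\<langle>h\<rangle>) A) =
          ar (B\<langle>h\<rangle>) (\<phi> f g A) \<cdot>\<^bsub>pcat T (src C h)\<^esub>
            (inv_arr (pcat T (src C h)) (\<beta> f h' f' h (ob (B\<langle>g\<rangle>) A)) \<cdot>\<^bsub>pcat T (src C h)\<^esub>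
              ar (T\<langle>f'\<rangle>)
                (inv_arr (pcat T (src C h')) (coh B h' g A) \<cdot>\<^bsub>pcat T (src C h')\<^esub> coh B g' h A))"
    and \<phi>_composite: "\<lbrakk>retract_pair C f g; retract_pair C i k;
        f \<in> Pc; h \<in> Pc; i \<in> Pc; g \<in> Oc; j \<in> Oc; k \<in> Oc;
        src C i = src C f; cartesian C i j h g; A \<in> obj (pcat T (src C f))\<rbrakk>
      \<Longrightarrow> \<phi> i k A \<cdot>\<^bsub>pcat T (src C f)\<^esub>
            (\<phi> f g (ob (T\<langle>i\<rangle>) (ob (B\<langle>k\<rangle>) A)) \<cdot>\<^bsub>pcat T (src C f)\<^esub>
              ar (T\<langle>f\<rangle>) (inv_arr (pcat T (src C h)) (\<beta> i j h g (ob (B\<langle>k\<rangle>) A)))) =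
          \<phi> (h \<cdot>\<^bsub>C\<^esub> f) (k \<cdot>\<^bsub>C\<^esub> j) A \<cdot>\<^bsub>pcat T (src C f)\<^esub>
            (ar (T\<langle>h \<cdot>\<^bsub>C\<^esub> f\<rangle>) (coh B j k A) \<cdot>\<^bsub>pcat T (src C f)\<^esub>
              coh T f h (ob (B\<langle>j\<rangle>) (ob (B\<langle>k\<rangle>) A)))"

text \<open>\<open>Fl\<close> is the pseudofunctor \<open>(-)\<^sup>\<flat>\<close> on the subcategory \<open>Fc\<close>; \<open>\<gamma>T\<close> and \<open>\<gamma>B\<close> are
  \<open>\<gamma>\<^sup>\<times>\<close> and \<open>\<gamma>\<^sup>\<box>\<close>.\<close>

locale flat_data = pasting_data C Oc Pc T B \<beta> \<phi>
  for C :: "('o, 'a) cat"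
    and Oc :: "'a set"
    and Pc :: "'a set"
    and T :: "('o, 'a, 'p, 'q) pseudo"
    and B :: "('o, 'a, 'p, 'q) pseudo"
    and \<beta> :: "'a \<Rightarrow> 'a \<Rightarrow> 'a \<Rightarrow> 'a \<Rightarrow> 'p \<Rightarrow> 'q"
    and \<phi> :: "'a \<Rightarrow> 'a \<Rightarrow> 'p \<Rightarrow> 'q" +
  fixes Fc :: "'a set"
    and Fl :: "('o, 'a, 'p, 'q) pseudo"
    and \<gamma>T :: "'a \<Rightarrow> 'a \<Rightarrow> 'a \<Rightarrow> 'a \<Rightarrow> 'p \<Rightarrow> 'q"
    and \<gamma>B :: "'a \<Rightarrow> 'a \<Rightarrow> 'a \<Rightarrow> 'a \<Rightarrow> 'p \<Rightarrow> 'q"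
  assumes Fc_subcategory: "subcategory C Fc"
    and Fc_stable: "stable_under_base_change C Fc (Oc \<union> Pc)"
    and iso_Fc: "iso_arr C f \<Longrightarrow> f \<in> Fc"
    and Fl_pseudofunctor: "pseudofunctor (subcat C Fc) Fl"
    and Fl_same_cat: "X \<in> obj C \<Longrightarrow> pcat Fl X = pcat T X"
    and \<gamma>T_base_change: "base_change C Pc Fc T Fl \<gamma>T"
    and \<gamma>B_base_change: "base_change C Oc Fc B Fl \<gamma>B"
    and cube: "\<lbrakk>f \<in> Pc; g \<in> Oc; u \<in> Fc;
        cartesian C f g f\<^sub>2 g\<^sub>2; cartesian C f u f\<^sub>3 u\<^sub>2; cartesian C g u g\<^sub>3 u\<^sub>3;
        cartesian C g\<^sub>2 u\<^sub>2 g\<^sub>1 u\<^sub>1; cartesian C f\<^sub>2 u\<^sub>3 f\<^sub>1 u\<^sub>1; cartesian C f\<^sub>3 g\<^sub>3 f\<^sub>1 g\<^sub>1;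
        A \<in> obj (pcat T (tgt C f))\<rbrakk>
      \<Longrightarrow> \<gamma>T f\<^sub>2 u\<^sub>3 f\<^sub>1 u\<^sub>1 (ob (B\<langle>g\<rangle>) A) \<cdot>\<^bsub>pcat T (src C f\<^sub>1)\<^esub>
            (ar (Fl\<langle>u\<^sub>1\<rangle>) (\<beta> f g f\<^sub>2 g\<^sub>2 A) \<cdot>\<^bsub>pcat T (src C f\<^sub>1)\<^esub>
              inv_arr (pcat T (src C f\<^sub>1)) (\<gamma>B g\<^sub>2 u\<^sub>2 g\<^sub>1 u\<^sub>1 (ob (T\<langle>f\<rangle>) A))) =
          ar (T\<langle>f\<^sub>1\<rangle>) (inv_arr (pcat T (src C g\<^sub>3)) (\<gamma>B g u g\<^sub>3 u\<^sub>3 A)) \<cdot>\<^bsub>pcat T (src C f\<^sub>1)\<^esub>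
            (\<beta> f\<^sub>3 g\<^sub>3 f\<^sub>1 g\<^sub>1 (ob (Fl\<langle>u\<rangle>) A) \<cdot>\<^bsub>pcat T (src C f\<^sub>1)\<^esub>
              ar (B\<langle>g\<^sub>1\<rangle>) (\<gamma>T f u f\<^sub>3 u\<^sub>2 A))"
    and \<phi>_flat: "\<lbrakk>retract_pair C f g; f \<in> Pc; g \<in> Oc; u \<in> Fc; retract_pair C f' g';
        cartesian C g u g' u'; cartesian C f u' f' u; A \<in> obj (pcat T (src C f))\<rbrakk>
      \<Longrightarrow> ar (Fl\<langle>u\<rangle>) (\<phi> f g A) \<cdot>\<^bsub>pcat T (src C u)\<^esub>
            (inv_arr (pcat T (src C u)) (\<gamma>T f u' f' u (ob (B\<langle>g\<rangle>) A)) \<cdot>\<^bsub>pcat T (src C u)\<^esub>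
              ar (T\<langle>f'\<rangle>) (inv_arr (pcat T (src C g')) (\<gamma>B g u g' u' A))) =
          \<phi> f' g' (ob (Fl\<langle>u\<rangle>) A)"

section \<open>Covers\<close>

record ('o, 'a, 'r, 's, 'p, 'q) cover =
  pse :: "('o, 'a, 'r, 's) pseudo"
  muT :: "('o, 'a, 'r, 's, 'p, 'q) pmor"
  muB :: "('o, 'a, 'r, 's, 'p, 'q) pmor"

text \<open>The functor \<open>S\<^sub>X : X\<^sup>! \<rightarrow> \<D>\<^sub>X\<close>.\<close>

abbreviation cover_S :: "('o, 'a, 'r, 's, 'p, 'q) cover \<Rightarrow> 'o \<Rightarrow> ('r, 's, 'p, 'q) func" where
  "cover_S K X \<equiv> mob (muT K) X"

definition is_cover :: "('o, 'a) cat \<Rightarrow> 'a set \<Rightarrow> 'a set \<Rightarrow> ('o, 'a, 'p, 'q) pseudo \<Rightarrow>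
    ('o, 'a, 'p, 'q) pseudo \<Rightarrow> ('a \<Rightarrow> 'a \<Rightarrow> 'a \<Rightarrow> 'a \<Rightarrow> 'p \<Rightarrow> 'q) \<Rightarrow> ('a \<Rightarrow> 'a \<Rightarrow> 'p \<Rightarrow> 'q) \<Rightarrow>
    ('o, 'a, 'r, 's, 'p, 'q) cover \<Rightarrow> bool" where
  "is_cover C Oc Pc T B \<beta> \<phi> K \<longleftrightarrow>
     pseudofunctor (subcat C (generated_subcategory C (Oc \<union> Pc))) (pse K) \<and>
     pseudo_morphism (subcat C Pc) (pse K) T (muT K) \<and>
     pseudo_morphism (subcat C Oc) (pse K) B (muB K) \<and>
     (\<forall>X\<in>obj C. functor_eq (pcat (pse K) X) (mob (muT K) X) (mob (muB K) X)) \<and>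
     (\<forall>f i f' i'. cartesian C f i f' i' \<longrightarrow> f \<in> Pc \<longrightarrow> i \<in> Oc \<longrightarrow>
        (\<forall>A\<in>obj (pcat (pse K) (tgt C f)).
           \<beta> f i f' i' (ob (cover_S K (tgt C f)) A) \<cdot>\<^bsub>pcat T (src C f')\<^esub>
             (ar (B\<langle>i'\<rangle>) (mar (muT K) f A) \<cdot>\<^bsub>pcat T (src C f')\<^esub>
               mar (muB K) i' (ob ((pse K)\<langle>f\<rangle>) A)) =
           ar (T\<langle>f'\<rangle>) (mar (muB K) i A) \<cdot>\<^bsub>pcat T (src C f')\<^esub>
             (mar (muT K) f' (ob ((pse K)\<langle>i\<rangle>) A) \<cdot>\<^bsub>pcat T (src C f')\<^esub>
               ar (cover_S K (src C f'))
                 (inv_arr (pcat (pse K) (src C f')) (coh (pse K) f' i A)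
                   \<cdot>\<^bsub>pcat (pse K) (src C f')\<^esub> coh (pse K) i' f A)))) \<and>
     (\<forall>i h. retract_pair C i h \<longrightarrow> i \<in> Pc \<longrightarrow> h \<in> Oc \<longrightarrow>
        (\<forall>A\<in>obj (pcat (pse K) (src C i)).
           \<phi> i h (ob (cover_S K (src C i)) A) \<cdot>\<^bsub>pcat T (src C i)\<^esub>
             (ar (T\<langle>i\<rangle>) (mar (muB K) h A) \<cdot>\<^bsub>pcat T (src C i)\<^esub>
               mar (muT K) i (ob ((pse K)\<langle>h\<rangle>) A)) =
           ar (cover_S K (src C i)) (coh (pse K) i h A)))"

definition perfect_cover :: "('o, 'a) cat \<Rightarrow> 'a set \<Rightarrow> 'a set \<Rightarrow> ('o, 'a, 'p, 'q) pseudo \<Rightarrow>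
    ('o, 'a, 'p, 'q) pseudo \<Rightarrow> ('a \<Rightarrow> 'a \<Rightarrow> 'a \<Rightarrow> 'a \<Rightarrow> 'p \<Rightarrow> 'q) \<Rightarrow> ('a \<Rightarrow> 'a \<Rightarrow> 'p \<Rightarrow> 'q) \<Rightarrow>
    ('o, 'a, 'r, 's, 'p, 'q) cover \<Rightarrow> bool" where
  "perfect_cover C Oc Pc T B \<beta> \<phi> K \<longleftrightarrow> is_cover C Oc Pc T B \<beta> \<phi> K \<and>
     pseudo_iso (subcat C Pc) (pse K) T (muT K) \<and>
     pseudo_iso (subcat C Oc) (pse K) B (muB K)"

definition cover_morphism :: "('o, 'a) cat \<Rightarrow> 'a set \<Rightarrow> 'a set \<Rightarrow> ('o, 'a, 'p, 'q) pseudo \<Rightarrow>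
    ('o, 'a, 'p, 'q) pseudo \<Rightarrow> ('o, 'a, 't, 'u, 'p, 'q) cover \<Rightarrow> ('o, 'a, 'r, 's, 'p, 'q) cover \<Rightarrow>
    ('o, 'a, 't, 'u, 'r, 's) pmor \<Rightarrow> bool" where
  "cover_morphism C Oc Pc T B K' K \<epsilon> \<longleftrightarrow>
     pseudo_morphism (subcat C (generated_subcategory C (Oc \<union> Pc))) (pse K') (pse K) \<epsilon> \<and>
     pmor_eq (subcat C Pc) (pse K') (pmor_comp (subcat C Pc) T (muT K) \<epsilon>) (muT K') \<and>
     pmor_eq (subcat C Oc) (pse K') (pmor_comp (subcat C Oc) B (muB K) \<epsilon>) (muB K')"

definition cover_iso :: "('o, 'a) cat \<Rightarrow> 'a set \<Rightarrow> 'a set \<Rightarrow> ('o, 'a, 'p, 'q) pseudo \<Rightarrow>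
    ('o, 'a, 'p, 'q) pseudo \<Rightarrow> ('o, 'a, 't, 'u, 'p, 'q) cover \<Rightarrow> ('o, 'a, 'r, 's, 'p, 'q) cover \<Rightarrow>
    ('o, 'a, 't, 'u, 'r, 's) pmor \<Rightarrow> bool" where
  "cover_iso C Oc Pc T B K' K \<epsilon> \<longleftrightarrow> cover_morphism C Oc Pc T B K' K \<epsilon> \<and>
     (\<exists>\<eta>. cover_morphism C Oc Pc T B K K' \<eta> \<and>
        (let Q = subcat C (generated_subcategory C (Oc \<union> Pc)) in
           pmor_eq Q (pse K') (pmor_comp Q (pse K') \<eta> \<epsilon>) (pmor_id Q (pse K')) \<and>
           pmor_eq Q (pse K) (pmor_comp Q (pse K) \<epsilon> \<eta>) (pmor_id Q (pse K))))"

text \<open>The identification of \<open>X\<^sup>!\<close> with \<open>\<D>\<^sub>X\<close> by the isomorphism \<open>S\<^sub>X\<close> of a perfect cover: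
  \<open>f\<^sup>!\<close> becomes \<open>S\<^sub>X f\<^sup>! S\<^sub>Y\<inverse> : \<D>\<^sub>Y \<rightarrow> \<D>\<^sub>X\<close> for \<open>f : X \<rightarrow> Y\<close>, the other data are
  transported accordingly, and the functors \<open>S\<^sub>X\<close> become identities.\<close>

definition cover_Sinv :: "('o, 'a, 'r, 's, 'p, 'q) cover \<Rightarrow> 'o \<Rightarrow> ('p, 'q, 'r, 's) func" where
  "cover_Sinv K X = inv_functor (pcat (pse K) X) (cover_S K X)"

definition identified :: "('o, 'a) cat \<Rightarrow> ('o, 'a, 'p, 'q) pseudo \<Rightarrow>
    ('o, 'a, 'r, 's, 'p, 'q) cover \<Rightarrow> ('o, 'a, 'p, 'q, 'p, 'q) cover" where
  "identified C T K =
     \<lparr>pse =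
        \<lparr>pcat = pcat T,
         pfun = (\<lambda>f. cover_S K (src C f) \<circ>\<^sub>F (pse K)\<langle>f\<rangle> \<circ>\<^sub>F cover_Sinv K (tgt C f)),
         coh = (\<lambda>f g A. ar (cover_S K (src C f)) (coh (pse K) f g (ob (cover_Sinv K (tgt C g)) A)))\<rparr>,
      muT = \<lparr>mob = (\<lambda>X. id_functor),
             mar = (\<lambda>f A. mar (muT K) f (ob (cover_Sinv K (tgt C f)) A))\<rparr>,
      muB = \<lparr>mob = (\<lambda>X. id_functor),
             mar = (\<lambda>f A. mar (muB K) f (ob (cover_Sinv K (tgt C f)) A))\<rparr>\<rparr>"

text \<open>Likewise for a morphism of covers \<open>\<epsilon> : K' \<rightarrow> K\<close>: the component at \<open>A\<close> of the map from
  the identified \<open>f\<^sup>#\<close> to the identified \<open>f\<^sup>!\<close> that \<open>\<epsilon>\<close> induces.\<close>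

definition identified_map :: "('o, 'a) cat \<Rightarrow> ('o, 'a, 't, 'u, 'p, 'q) cover \<Rightarrow>
    ('o, 'a, 'r, 's, 'p, 'q) cover \<Rightarrow> ('o, 'a, 't, 'u, 'r, 's) pmor \<Rightarrow> 'a \<Rightarrow> 'p \<Rightarrow> 'q" where
  "identified_map C K' K \<epsilon> f A =
     ar (cover_S K (src C f)) (mar \<epsilon> f (ob (cover_Sinv K' (tgt C f)) A))"

definition flat_base_change :: "('o, 'a) cat \<Rightarrow> 'a set \<Rightarrow> 'a set \<Rightarrow> ('o, 'a, 'p, 'q) pseudo \<Rightarrow>
    'a set \<Rightarrow> ('o, 'a, 'p, 'q) pseudo \<Rightarrow>
    ('a \<Rightarrow> 'a \<Rightarrow> 'a \<Rightarrow> 'a \<Rightarrow> 'p \<Rightarrow> 'q) \<Rightarrow> ('a \<Rightarrow> 'a \<Rightarrow> 'a \<Rightarrow> 'a \<Rightarrow> 'p \<Rightarrow> 'q) \<Rightarrow>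
    ('o, 'a, 'r, 's, 'p, 'q) cover \<Rightarrow> ('a \<Rightarrow> 'a \<Rightarrow> 'a \<Rightarrow> 'a \<Rightarrow> 'p \<Rightarrow> 'q) \<Rightarrow> bool" where
  "flat_base_change C Oc Pc T Fc Fl \<gamma>T \<gamma>B K \<gamma> \<longleftrightarrow>
     base_change C (generated_subcategory C (Oc \<union> Pc)) Fc (pse (identified C T K)) Fl \<gamma> \<and>
     (\<forall>f u f' u'. cartesian C f u f' u' \<longrightarrow> f \<in> Pc \<longrightarrow> u \<in> Fc \<longrightarrow>
        (\<forall>A\<in>obj (pcat T (tgt C f)).
           mar (muT (identified C T K)) f' (ob (Fl\<langle>u\<rangle>) A) \<cdot>\<^bsub>pcat T (src C f')\<^esub> \<gamma> f u f' u' A =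
           \<gamma>T f u f' u' A \<cdot>\<^bsub>pcat T (src C f')\<^esub>
             ar (Fl\<langle>u'\<rangle>) (mar (muT (identified C T K)) f A))) \<and>
     (\<forall>f u f' u'. cartesian C f u f' u' \<longrightarrow> f \<in> Oc \<longrightarrow> u \<in> Fc \<longrightarrow>
        (\<forall>A\<in>obj (pcat T (tgt C f)).
           mar (muB (identified C T K)) f' (ob (Fl\<langle>u\<rangle>) A) \<cdot>\<^bsub>pcat T (src C f')\<^esub> \<gamma> f u f' u' A =
           \<gamma>B f u f' u' A \<cdot>\<^bsub>pcat T (src C f')\<^esub>
             ar (Fl\<langle>u'\<rangle>) (mar (muB (identified C T K)) f A)))"

end

theory Submission
  imports Defs
begin

text \<open>
  Arrange the cartesian squares over flat maps into a category, a square over \<open>f\<close> being an arrow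
  between the two flat maps, and let a second category over it have as arrows the squares together
  with a base change isomorphism, composed by vertical pasting. Then \<open>\<gamma>\<^sup>\<times>\<close> and \<open>\<gamma>\<^sup>\<box>\<close>, transported to
  \<open>(-)\<^sup>!\<close>, are sections over the squares on \<open>P\<close>- and \<open>O\<close>-maps. The cube condition says that
  they commute along fibre squares, and the condition on \<open>\<phi>\<close> that the section of an \<open>O\<close>-map has the
  inverse value. This is enough for gluing: if two factorizations \<open>\<sigma>\<close>, \<open>\<tau>\<close> into \<open>P\<close>- and \<open>O\<close>-maps have
  the same composite \<open>f\<close>, pull them back along each other to factorizations \<open>a\<close>, \<open>b\<close> of the
  projections of the fibre square of \<open>f\<close>. Exchange gives \<open>s(\<sigma>) s(b) = s(\<tau>) s(a)\<close>, and the diagonal, which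
  lies in \<open>P\<close>, splits \<open>a\<close> and \<open>b\<close>, hence \<open>s(\<sigma>) = s(\<tau>)\<close>. Uniqueness is clear on
  generators, and the comparison of two perfect covers follows by transporting \<open>\<gamma>\<^sup>!\<close> along the
  isomorphism of covers.
\<close>

section \<open>Categories and cartesian squares\<close>

text \<open>An arrow of \<open>Q\<close> is only known as a string of maps from \<open>P\<close> and
  \<open>O\<close>, of any length and without a normal form, so the difficulty is independence of
  the string; fibre products are what makes two strings comparable. Why the hypotheses take the form
  used for gluing: conjugated by the comparison maps of the cover, \<beta> becomes the comparison of
  two coherence maps of \<open>(-)^!\<close>, and \<phi> becomes a coherence map itself. The cube
  condition is then an equation between two pastes over the same composite, and the condition on
  \<phi> says that a certain paste is trivial. The diagonal lies in \<open>P\<close> because it is a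
  section: along a string of maps from \<open>P\<close> and \<open>O\<close> the cancellation
  property of \<open>P\<close> can be applied one arrow at a time. The second category records
  vertical pasting only. Horizontal transitivity is therefore not a consequence of gluing and is
  proved afterwards, by induction over \<open>Q\<close>. All values are first moved to the
  categories \<open>pcat T X\<close>, so that the comparison maps have identity functors
  underneath.\<close>

abbreviation (input) cmp_short :: "'a \<Rightarrow> ('o, 'a) cat \<Rightarrow> 'a \<Rightarrow> 'a"  ("_ *[_] _" [71, 0, 70] 70)
  where "g *[C] f \<equiv> cmp C g f"

lemma homI: "f \<in> arr C \<Longrightarrow> src C f = X \<Longrightarrow> tgt C f = Y \<Longrightarrow> f \<in> hom C X Y"
  by (simp add: hom_def)

lemma homD:
  assumes "f \<in> hom C X Y"
  shows "f \<in> arr C" "src C f = X" "tgt C f = Y"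
  using assms by (auto simp: hom_def)

context category
begin

lemma cmp_arr:
  assumes "f \<in> arr C" "g \<in> arr C" "tgt C f = src C g"
  shows "g *[C] f \<in> arr C" "src C (g *[C] f) = src C f" "tgt C (g *[C] f) = tgt C g"
  using cmp_hom[of f "src C f" "tgt C f" g "tgt C g"] assms by (auto simp: hom_def)

lemma ide_arr:
  assumes "X \<in> obj C"
  shows "ide C X \<in> arr C" "src C (ide C X) = X" "tgt C (ide C X) = X"
  using ide_hom[OF assms] by (auto simp: hom_def)

lemma cmp_assoc:
  assumes "f \<in> arr C" "g \<in> arr C" "h \<in> arr C" "tgt C f = src C g" "tgt C g = src C h"
  shows "(h *[C] g) *[C] f = h *[C] (g *[C] f)"
  using assoc[of f "src C f" "tgt C f" g "tgt C g" h "tgt C h"] assms by (auto simp: hom_def)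

lemma cmp_ide:
  assumes "f \<in> arr C"
  shows "tgt C f = Y \<Longrightarrow> ide C Y *[C] f = f" "src C f = X \<Longrightarrow> f *[C] ide C X = f"
  using ide_left[of f "src C f" "tgt C f"] ide_right[of f "src C f" "tgt C f"] assms
  by (auto simp: hom_def)

lemmas cat_simps = src_obj tgt_obj cmp_arr ide_arr cmp_assoc cmp_ide

text \<open>Composites are normalised to brackets on the right, where the left side of an equation
  \<open>a b = c\<close> is no longer a subterm once another arrow precedes \<open>b\<close>. This
  form applies the equation inside such a composite.\<close>

lemma reassoc:
  assumes "a *[C] b = c" "a \<in> arr C" "b \<in> arr C" "tgt C b = src C a" "x \<in> arr C" "tgt C x = src C b"
  shows "a *[C] (b *[C] x) = c *[C] x"
  using assms(1) cmp_assoc[OF assms(5,3,2,6,4)] by simp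

lemma inverse_unique:
  assumes "inverse_arrows C f g" "inverse_arrows C f h"
  shows "g = h"
proof -
  have t: "f \<in> arr C" "g \<in> arr C" "h \<in> arr C" "src C g = tgt C f" "tgt C g = src C f"
    "src C h = tgt C f" "tgt C h = src C f"
    using assms by (auto simp: inverse_arrows_def hom_def)
  have "g = g *[C] (f *[C] h)"
    using assms(2) t by (simp add: inverse_arrows_def cat_simps)
  also have "\<dots> = (g *[C] f) *[C] h" using t by (simp add: cat_simps)
  also have "\<dots> = h" using assms(1) t by (simp add: inverse_arrows_def cat_simps)
  finally show ?thesis .
qed

lemma inv_arr_eq: "inverse_arrows C f g \<Longrightarrow> inv_arr C f = g"
  unfolding inv_arr_def using inverse_unique by blast

lemma inverse_inv: "iso_arr C f \<Longrightarrow> inverse_arrows C f (inv_arr C f)"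
  using inv_arr_eq by (auto simp: iso_arr_def)

lemma iso_simps:
  assumes "iso_arr C f"
  shows "f \<in> arr C" "inv_arr C f \<in> arr C" "src C (inv_arr C f) = tgt C f"
    "tgt C (inv_arr C f) = src C f" "inv_arr C f *[C] f = ide C (src C f)"
    "f *[C] inv_arr C f = ide C (tgt C f)"
  using inverse_inv[OF assms] by (auto simp: inverse_arrows_def hom_def)

lemma iso_cancel:
  assumes "iso_arr C f" "x \<in> arr C"
  shows "tgt C x = src C f \<Longrightarrow> inv_arr C f *[C] (f *[C] x) = x"
    "tgt C x = tgt C f \<Longrightarrow> f *[C] (inv_arr C f *[C] x) = x"
  using assms reassoc[OF iso_simps(5)] reassoc[OF iso_simps(6)]
  by (simp_all add: cat_simps iso_simps)

lemma iso_arrI: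
  assumes "f \<in> arr C" "g \<in> arr C" "src C g = tgt C f" "tgt C g = src C f"
    "g *[C] f = ide C (src C f)" "f *[C] g = ide C (tgt C f)"
  shows "iso_arr C f"
  using assms by (auto simp: iso_arr_def inverse_arrows_def hom_def)

lemma iso_inv: "iso_arr C f \<Longrightarrow> iso_arr C (inv_arr C f)"
  by (rule iso_arrI[where g = f]) (simp_all add: iso_simps)

lemma iso_ide: "X \<in> obj C \<Longrightarrow> iso_arr C (ide C X)"
  by (rule iso_arrI[where g = "ide C X"]) (simp_all add: cat_simps)

lemma iso_cmp:
  assumes "iso_arr C f" "iso_arr C g" "tgt C f = src C g"
  shows "iso_arr C (g *[C] f)"
  by (rule iso_arrI[where g = "inv_arr C f *[C] inv_arr C g"])
    (use assms in \<open>simp_all add: cat_simps iso_simps iso_cancel\<close>)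

lemma iso_left_cancel:
  assumes "f *[C] x = f *[C] y" "iso_arr C f" "x \<in> arr C" "y \<in> arr C"
    "tgt C x = src C f" "tgt C y = src C f"
  shows "x = y"
  using assms iso_cancel(1) by metis

lemma iso_right_cancel:
  assumes "x *[C] f = y *[C] f" "iso_arr C f" "x \<in> arr C" "y \<in> arr C"
    "src C x = tgt C f" "src C y = tgt C f"
  shows "x = y"
proof -
  have "(x *[C] f) *[C] inv_arr C f = (y *[C] f) *[C] inv_arr C f" using assms(1) by simp
  then show ?thesis using assms(2-6) by (simp add: cat_simps iso_simps)
qed

section \<open>Cartesian squares and the pasting law\<close>

lemma cartesianD:
  assumes "cartesian C f i f' i'"
  shows "f \<in> arr C" "i \<in> arr C" "f' \<in> arr C" "i' \<in> arr C" "tgt C i = tgt C f"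
    "src C i' = src C f'" "src C i = tgt C f'" "tgt C i' = src C f"
  using assms by (simp_all add: cartesian_def)

lemma cartesian_commute: "cartesian C f i f' i' \<Longrightarrow> f *[C] i' = i *[C] f'"
  by (simp add: cartesian_def)

lemma cartesian_sym: "cartesian C f i f' i' \<Longrightarrow> cartesian C i f i' f'"
  unfolding cartesian_def
  by (elim conjE, intro conjI; (simp; fail)?)
    (intro allI ballI impI, drule spec, drule bspec, assumption, drule bspec, assumption, simp add: conj_commute)

lemma cartesian_factor:
  assumes "cartesian C f i f' i'" "a \<in> arr C" "b \<in> arr C" "src C a = src C b"
    "tgt C a = src C f" "tgt C b = src C i" "f *[C] a = i *[C] b"
  shows "\<exists>t. t \<in> arr C \<and> src C t = src C a \<and> tgt C t = src C f' \<and>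
    i' *[C] t = a \<and> f' *[C] t = b"
proof -
  have "a \<in> hom C (src C a) (src C f)" "b \<in> hom C (src C a) (src C i)"
    using assms by (simp_all add: hom_def)
  then have "\<exists>t. t \<in> hom C (src C a) (src C f') \<and> i' *[C] t = a \<and> f' *[C] t = b"
    using assms(1,7) unfolding cartesian_def by blast
  then show ?thesis by (auto simp: hom_def)
qed

lemma cartesian_unique:
  assumes "cartesian C f i f' i'" "s \<in> arr C" "t \<in> arr C" "src C s = src C t"
    "tgt C s = src C f'" "tgt C t = src C f'"
    "i' *[C] s = i' *[C] t" "f' *[C] s = f' *[C] t"
  shows "s = t"
proof -
  note c = cartesianD[OF assms(1)]
  note ccomm = cartesian_commute[OF assms(1)]
  have "f *[C] (i' *[C] t) = (f *[C] i') *[C] t" using c assms by (simp add: cat_simps)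
  also have "\<dots> = (i *[C] f') *[C] t" using ccomm by simp
  also have "\<dots> = i *[C] (f' *[C] t)" using c assms by (simp add: cat_simps)
  finally have e: "f *[C] (i' *[C] t) = i *[C] (f' *[C] t)" .
  have m: "i' *[C] t \<in> hom C (src C t) (src C f)" "f' *[C] t \<in> hom C (src C t) (src C i)"
    using c assms by (simp_all add: cat_simps hom_def)
  have "\<exists>!r. r \<in> hom C (src C t) (src C f') \<and> i' *[C] r = i' *[C] t \<and> f' *[C] r = f' *[C] t"
    using assms(1) m e unfolding cartesian_def by blast
  moreover have "s \<in> hom C (src C t) (src C f')" "t \<in> hom C (src C t) (src C f')"
    using assms by (simp_all add: hom_def)
  ultimately show ?thesis using assms(7,8) by blast
qed

lemma cartesianI:
  assumes "f \<in> arr C" "i \<in> arr C" "f' \<in> arr C" "i' \<in> arr C" "tgt C i = tgt C f"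
    "src C i' = src C f'" "src C i = tgt C f'" "tgt C i' = src C f"
    "f *[C] i' = i *[C] f'"
    "\<And>a b. \<lbrakk>a \<in> arr C; b \<in> arr C; src C b = src C a; tgt C a = src C f; tgt C b = src C i;
       f *[C] a = i *[C] b\<rbrakk> \<Longrightarrow> \<exists>t. t \<in> arr C \<and> src C t = src C a \<and> tgt C t = src C f' \<and>
         i' *[C] t = a \<and> f' *[C] t = b"
    "\<And>s t. \<lbrakk>s \<in> arr C; t \<in> arr C; src C s = src C t; tgt C s = src C f'; tgt C t = src C f';
       i' *[C] s = i' *[C] t; f' *[C] s = f' *[C] t\<rbrakk> \<Longrightarrow> s = t"
  shows "cartesian C f i f' i'"
  unfolding cartesian_def
proof (intro conjI allI ballI impI)
  fix W a b assume h: "a \<in> hom C W (src C f)" "b \<in> hom C W (src C i)" "f *[C] a = i *[C] b"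
  note ha = homD[OF h(1)] and hb = homD[OF h(2)]
  from assms(10)[OF ha(1) hb(1) _ ha(3) hb(3) h(3)] ha hb
  obtain t where t: "t \<in> arr C" "src C t = W" "tgt C t = src C f'" "i' *[C] t = a" "f' *[C] t = b"
    by auto
  show "\<exists>!t. t \<in> hom C W (src C f') \<and> i' *[C] t = a \<and> f' *[C] t = b"
  proof (rule ex1I[of _ t])
    show "t \<in> hom C W (src C f') \<and> i' *[C] t = a \<and> f' *[C] t = b" using t by (simp add: hom_def)
    fix s assume "s \<in> hom C W (src C f') \<and> i' *[C] s = a \<and> f' *[C] s = b"
    then show "s = t" using assms(11)[of s t] t by (simp add: hom_def)
  qed
qed (use assms(1-9) in auto)

text \<open>Pasting law. A cone \<open>(a, b)\<close> over the composite gives the cone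
  \<open>(g a, b)\<close> over the first square; the arrow obtained from it, together with
  \<open>a\<close>, is a cone over the second.\<close>

lemma cartesian_vertical:
  assumes "cartesian C f i f' i'" "cartesian C g i' g' i''"
  shows "cartesian C (f *[C] g) i (f' *[C] g') i''"
proof -
  note c = cartesianD[OF assms(1)] and d0 = cartesianD[OF assms(2)]
  have tg: "tgt C g = src C f" "tgt C g' = src C f'" using c d0 by auto
  note d = d0(1-4,6,8) tg
  note ccomm = cartesian_commute[OF assms(1)] and dcomm = cartesian_commute[OF assms(2)]
  have e: "f *[C] (i' *[C] x) = i *[C] (f' *[C] x)" if "x \<in> arr C" "tgt C x = src C f'" for x
    using reassoc[OF ccomm, of x] that c by (simp add: cat_simps)
  have e': "g *[C] (i'' *[C] x) = i' *[C] (g' *[C] x)" if "x \<in> arr C" "tgt C x = src C g'" for x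
    using reassoc[OF dcomm, of x] that c d by (simp add: cat_simps)
  show ?thesis
  proof (rule cartesianI)
    show "(f *[C] g) *[C] i'' = i *[C] f' *[C] g'" using c d e[of g'] dcomm by (simp add: cat_simps)
  next
    fix a b assume h: "a \<in> arr C" "b \<in> arr C" "src C b = src C a" "tgt C a = src C (f *[C] g)"
      "tgt C b = src C i" "(f *[C] g) *[C] a = i *[C] b"
    have ta: "tgt C a = src C g" using h c d by (simp add: cat_simps)
    have fga: "f *[C] (g *[C] a) = i *[C] b" using h(6) ta h(1) c d by (simp add: cat_simps)
    have "\<exists>s. s \<in> arr C \<and>
      src C s = src C (g *[C] a) \<and>
      tgt C s = src C f' \<and>
      i' *[C] s = g *[C] a \<and>
      f' *[C] s = b"
      by (rule cartesian_factor[OF assms(1) _ _ _ _ _ fga])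
        (simp_all add: cat_simps h(1-3,5) c d ta)
    then obtain s where s: "s \<in> arr C" "src C s = src C (g *[C] a)" "tgt C s = src C f'"
      "i' *[C] s = g *[C] a" "f' *[C] s = b" by blast
    have "\<exists>t. t \<in> arr C \<and>
      src C t = src C a \<and>
      tgt C t = src C g' \<and>
      i'' *[C] t = a \<and>
      g' *[C] t = s"
      by (rule cartesian_factor[OF assms(2) h(1) s(1) _ ta _ s(4)[symmetric]])
        (simp_all add: cat_simps h(1-3,5) c d ta s(1-3))
    then obtain t where t: "t \<in> arr C" "src C t = src C a" "tgt C t = src C g'"
      "i'' *[C] t = a" "g' *[C] t = s" by blast
    show "\<exists>t. t \<in> arr C \<and> src C t = src C a \<and> tgt C t = src C (f' *[C] g') \<and>
         i'' *[C] t = a \<and> (f' *[C] g') *[C] t = b"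
    proof (intro exI[of _ t] conjI)
      show "tgt C t = src C (f' *[C] g')" using c d t(3) by (simp add: cmp_arr)
      have "(f' *[C] g') *[C] t = f' *[C] (g' *[C] t)" using c d t(1,3) by (simp add: cmp_assoc)
      then show "(f' *[C] g') *[C] t = b" using t s by simp
    qed (use t in simp_all)
  next
    fix s t assume h: "s \<in> arr C" "t \<in> arr C" "src C s = src C t" "tgt C s = src C (f' *[C] g')"
      "tgt C t = src C (f' *[C] g')" "i'' *[C] s = i'' *[C] t" "(f' *[C] g') *[C] s = (f' *[C] g') *[C] t"
    have ty: "tgt C s = src C g'" "tgt C t = src C g'" using h c d by (simp_all add: cat_simps)
    have "g' *[C] s = g' *[C] t"
    proof (rule cartesian_unique[OF assms(1)])
      show "i' *[C] g' *[C] s = i' *[C] g' *[C] t" using e'[of s] e'[of t] h ty by simp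
      show "f' *[C] g' *[C] s = f' *[C] g' *[C] t" using h(7) h ty c d by (simp add: cat_simps)
    qed (use h c d ty in \<open>simp_all add: cat_simps\<close>)
    then show "s = t"
      by (intro cartesian_unique[OF assms(2) h(1,2,3) ty h(6)])
  qed (use c d in \<open>simp_all add: cat_simps\<close>)
qed

lemma cartesian_horizontal:
  assumes "cartesian C f i f' i'" "cartesian C f' j f'' j'"
  shows "cartesian C f (i *[C] j) f'' (i' *[C] j')"
  using cartesian_sym[OF cartesian_vertical[OF cartesian_sym[OF assms(1)] cartesian_sym[OF assms(2)]]] .

text \<open>The converse half of the pasting law, needed to cut squares over a composite.
  Commutativity of the new square is a hypothesis because the outer square yields it only after
  composition with \<open>f\<close>.\<close>

lemma cartesian_vertical_cancel:
  assumes "cartesian C f i f' i'" "cartesian C (f *[C] g) i (f' *[C] g') i''"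
    "g \<in> arr C" "tgt C g = src C f" "g' \<in> arr C" "tgt C g' = src C f'" "g *[C] i'' = i' *[C] g'"
  shows "cartesian C g i' g' i''"
proof -
  note c = cartesianD[OF assms(1)] and d = cartesianD[OF assms(2)]
  note ccomm = cartesian_commute[OF assms(1)] and dcomm = cartesian_commute[OF assms(2)]
  have ty: "src C i'' = src C g'" "tgt C i'' = src C g" using d c assms by (simp_all add: cat_simps)
  have e: "f *[C] (i' *[C] x) = i *[C] (f' *[C] x)" if "x \<in> arr C" "tgt C x = src C f'" for x
    using reassoc[OF ccomm, of x] that c by (simp add: cat_simps)
  have e': "g *[C] (i'' *[C] x) = i' *[C] (g' *[C] x)" if "x \<in> arr C" "tgt C x = src C g'" for x
    using reassoc[OF assms(7), of x] that c d assms(3-6) ty by (simp add: cat_simps)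
  show ?thesis
  proof (rule cartesianI)
    fix a b assume h: "a \<in> arr C" "b \<in> arr C" "src C b = src C a" "tgt C a = src C g"
      "tgt C b = src C i'" "g *[C] a = i' *[C] b"
    have k: "(f *[C] g) *[C] a = i *[C] f' *[C] b" using e[of b] h c assms(3-6) by (simp add: cat_simps)
    have "\<exists>t. t \<in> arr C \<and>
      src C t = src C a \<and>
      tgt C t = src C (f' *[C] g') \<and>
      i'' *[C] t = a \<and>
      (f' *[C] g') *[C] t = f' *[C] b"
      by (rule cartesian_factor[OF assms(2) _ _ _ _ _ k])
        (use h c assms(3-6) in \<open>simp_all add: cat_simps\<close>)
    then obtain t where t: "t \<in> arr C" "src C t = src C a" "tgt C t = src C (f' *[C] g')"
      "i'' *[C] t = a" "(f' *[C] g') *[C] t = f' *[C] b" by blast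
    have tt: "tgt C t = src C g'" using t c assms by (simp add: cat_simps)
    have "g' *[C] t = b"
    proof (rule cartesian_unique[OF assms(1)])
      show "i' *[C] g' *[C] t = i' *[C] b" using e'[of t] t tt h by simp
      show "f' *[C] g' *[C] t = f' *[C] b" using t tt c assms(3-6) by (simp add: cat_simps)
    qed (use h c assms(3-6) t tt in \<open>simp_all add: cat_simps\<close>)
    then show "\<exists>t. t \<in> arr C \<and> src C t = src C a \<and> tgt C t = src C g' \<and> i'' *[C] t = a \<and> g' *[C] t = b"
      using t tt by blast
  next
    fix s t assume h: "s \<in> arr C" "t \<in> arr C" "src C s = src C t" "tgt C s = src C g'"
      "tgt C t = src C g'" "i'' *[C] s = i'' *[C] t" "g' *[C] s = g' *[C] t"
    show "s = t"
      by (rule cartesian_unique[OF assms(2) h(1-3) _ _ h(6)])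
        (use h c assms(3-6) in \<open>simp_all add: cat_simps\<close>)
  qed (use c d assms(3-7) ty in \<open>simp_all add: cat_simps\<close>)
qed

lemma cartesian_horizontal_cancel:
  assumes "cartesian C f i f' i'" "cartesian C f (i *[C] j) f'' (i' *[C] j')"
    "j \<in> arr C" "tgt C j = src C i" "j' \<in> arr C" "tgt C j' = src C i'" "f' *[C] j' = j *[C] f''"
  shows "cartesian C f' j f'' j'"
  by (rule cartesian_sym, rule cartesian_vertical_cancel[OF cartesian_sym[OF assms(1)] cartesian_sym[OF assms(2)]])
    (use assms in simp_all)

lemma cartesian_ide:
  assumes "u \<in> arr C"
  shows "cartesian C (ide C (tgt C u)) u (ide C (src C u)) u"
proof (rule cartesianI)
  fix a b assume h: "a \<in> arr C" "b \<in> arr C" "src C b = src C a" "tgt C a = src C (ide C (tgt C u))"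
    "tgt C b = src C u" "ide C (tgt C u) *[C] a = u *[C] b"
  show "\<exists>t. t \<in> arr C \<and> src C t = src C a \<and> tgt C t = src C (ide C (src C u)) \<and> u *[C] t = a \<and>
      ide C (src C u) *[C] t = b"
    by (rule exI[of _ b]) (use h assms in \<open>simp add: cat_simps\<close>)
qed (use assms in \<open>simp_all add: cat_simps\<close>)

end

section \<open>Functors and natural transformations\<close>

lemma comp_functor_simps:
  "ob (G \<circ>\<^sub>F F) x = ob G (ob F x)" "ar (G \<circ>\<^sub>F F) m = ar G (ar F m)"
  by (simp_all add: comp_functor_def)

lemma id_functor_simps: "ob id_functor x = x" "ar id_functor m = m"
  by (simp_all add: id_functor_def)

lemma functor_category:
  assumes "is_functor A B F"
  shows "category A" "category B"
  using assms by (auto simp: is_functor_def)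

lemma functor_simps:
  assumes "is_functor A B F"
  shows "x \<in> obj A \<Longrightarrow> ob F x \<in> obj B"
    "m \<in> arr A \<Longrightarrow> ar F m \<in> arr B"
    "m \<in> arr A \<Longrightarrow> src B (ar F m) = ob F (src A m)"
    "m \<in> arr A \<Longrightarrow> tgt B (ar F m) = ob F (tgt A m)"
    "x \<in> obj A \<Longrightarrow> ar F (ide A x) = ide B (ob F x)"
  using assms by (auto simp: is_functor_def hom_def)

lemma functor_typing:
  assumes "is_functor A B F"
  shows "(\<forall>x. x \<in> obj A \<longrightarrow> ob F x \<in> obj B) \<and>
    (\<forall>m. m \<in> arr A \<longrightarrow> ar F m \<in> arr B \<and> src B (ar F m) = ob F (src A m) \<and> tgt B (ar F m) = ob F (tgt A m))"
  using functor_simps[OF assms] by blast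

lemma functor_cmp:
  assumes "is_functor A B F" "m \<in> arr A" "n \<in> arr A" "tgt A m = src A n"
  shows "ar F (n *[A] m) = ar F n *[B] ar F m"
  using assms unfolding is_functor_def hom_def by auto

lemma functor_iso:
  assumes F: "is_functor A B F" and m: "iso_arr A m"
  shows "iso_arr B (ar F m)" "ar F (inv_arr A m) = inv_arr B (ar F m)"
proof -
  interpret A: category A using functor_category[OF F] by simp
  interpret B: category B using functor_category[OF F] by simp
  note s = A.iso_simps[OF m] functor_simps[OF F]
  have 1: "ar F (inv_arr A m) *[B] ar F m = ide B (src B (ar F m))"
    using functor_cmp[OF F, of m "inv_arr A m"] by (simp add: s A.cat_simps)
  have 2: "ar F m *[B] ar F (inv_arr A m) = ide B (tgt B (ar F m))"
    using functor_cmp[OF F, of "inv_arr A m" m] by (simp add: s A.cat_simps)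
  show "iso_arr B (ar F m)"
    by (rule B.iso_arrI[OF _ _ _ _ 1 2]) (simp_all add: s)
  have "inverse_arrows B (ar F m) (ar F (inv_arr A m))"
    using 1 2 by (simp add: inverse_arrows_def hom_def s)
  then show "ar F (inv_arr A m) = inv_arr B (ar F m)" using B.inv_arr_eq by simp
qed

lemma functor_id: "category A \<Longrightarrow> is_functor A A id_functor"
  by (auto simp: is_functor_def id_functor_def)

lemma functor_comp: "is_functor A B F \<Longrightarrow> is_functor B D G \<Longrightarrow> is_functor A D (G \<circ>\<^sub>F F)"
  by (simp add: is_functor_def comp_functor_simps) blast

lemma nat_transD:
  assumes "nat_trans A B F G \<tau>"
  shows "is_functor A B F" "is_functor A B G"
    "x \<in> obj A \<Longrightarrow> \<tau> x \<in> arr B"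
    "x \<in> obj A \<Longrightarrow> src B (\<tau> x) = ob F x"
    "x \<in> obj A \<Longrightarrow> tgt B (\<tau> x) = ob G x"
  using assms by (auto simp: nat_trans_def hom_def)

lemma nat_trans_typing:
  assumes "nat_trans A B F G \<tau>"
  shows "\<forall>x. x \<in> obj A \<longrightarrow> \<tau> x \<in> arr B \<and> src B (\<tau> x) = ob F x \<and> tgt B (\<tau> x) = ob G x"
  using nat_transD[OF assms] by blast

lemma nat_trans_natural:
  assumes "nat_trans A B F G \<tau>" "m \<in> arr A" "src A m = x" "tgt A m = y"
  shows "\<tau> y *[B] ar F m = ar G m *[B] \<tau> x"
  using assms unfolding nat_trans_def hom_def by auto

lemma nat_transI:
  assumes "is_functor A B F" "is_functor A B G"
    "\<And>x. x \<in> obj A \<Longrightarrow> \<tau> x \<in> arr B \<and> src B (\<tau> x) = ob F x \<and> tgt B (\<tau> x) = ob G x"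
    "\<And>m. m \<in> arr A \<Longrightarrow> \<tau> (tgt A m) *[B] ar F m = ar G m *[B] \<tau> (src A m)"
  shows "nat_trans A B F G \<tau>"
  using assms unfolding nat_trans_def hom_def by auto

lemma nat_isoD:
  assumes "nat_iso A B F G \<tau>"
  shows "nat_trans A B F G \<tau>" "x \<in> obj A \<Longrightarrow> iso_arr B (\<tau> x)"
  using assms by (auto simp: nat_iso_def)

lemma nat_isoI:
  "nat_trans A B F G \<tau> \<Longrightarrow> (\<And>x. x \<in> obj A \<Longrightarrow> iso_arr B (\<tau> x)) \<Longrightarrow> nat_iso A B F G \<tau>"
  by (auto simp: nat_iso_def)

section \<open>Gluing two functors along exchange squares\<close>

text \<open>\<open>K True\<close> and \<open>K False\<close> stand for the classes \<open>P\<close> and \<open>O\<close>.\<close>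

locale gluing = S: category S + M: category M
  for S :: "('x, 's) cat" and M :: "('x, 'm) cat" +
  fixes K :: "bool \<Rightarrow> 's set"
    and s :: "bool \<Rightarrow> 's \<Rightarrow> 'm"
  assumes K_arr: "f \<in> K l \<Longrightarrow> f \<in> arr S"
    and obj_eq: "obj M = obj S"
    and s_arr: "f \<in> K l \<Longrightarrow> s l f \<in> arr M \<and> src M (s l f) = src S f \<and> tgt M (s l f) = tgt S f"
    and s_ide: "X \<in> obj S \<Longrightarrow> ide S X \<in> K True \<and> s True (ide S X) = ide M X"
    and s_cmp: "\<lbrakk>f \<in> K True; g \<in> K True; tgt S f = src S g\<rbrakk>
      \<Longrightarrow> g *[S] f \<in> K True \<and> s True (g *[S] f) = s True g *[M] s True f"
    and exch: "\<lbrakk>f \<in> K l; g \<in> K l'; tgt S g = tgt S f\<rbrakk>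
      \<Longrightarrow> \<exists>f' g'. cartesian S f g f' g' \<and> f' \<in> K l \<and> g' \<in> K l' \<and>
            s l f *[M] s l' g' = s l' g *[M] s l f'"
    and retr: "\<lbrakk>h \<in> K l; i \<in> arr S; tgt S i = src S h; src S i = tgt S h; h *[S] i = ide S (src S i)\<rbrakk>
      \<Longrightarrow> i \<in> K True \<and> s l h *[M] s True i = ide M (src S i)"
begin

text \<open>\<open>G f m\<close>: some factorization of \<open>f\<close> into arrows of the two classes is sent to \<open>m\<close>.\<close>

inductive G :: "'s \<Rightarrow> 'm \<Rightarrow> bool" where
  G_ide: "X \<in> obj S \<Longrightarrow> G (ide S X) (ide M X)"
| G_step: "\<lbrakk>G f m; g \<in> K l; tgt S g = src S f\<rbrakk> \<Longrightarrow> G (f *[S] g) (m *[M] s l g)"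

lemma s_simps:
  assumes "f \<in> K l"
  shows "f \<in> arr S" "s l f \<in> arr M" "src M (s l f) = src S f" "tgt M (s l f) = tgt S f"
  using K_arr[OF assms] s_arr[OF assms] by auto

lemma G_arr: "G f m \<Longrightarrow> f \<in> arr S \<and> m \<in> arr M \<and> src M m = src S f \<and> tgt M m = tgt S f"
  by (induction rule: G.induct) (simp_all add: S.cat_simps M.cat_simps obj_eq s_simps)

lemma G_simps:
  assumes "G f m"
  shows "f \<in> arr S" "m \<in> arr M" "src M m = src S f" "tgt M m = tgt S f"
  using G_arr[OF assms] by auto

lemma G_generator:
  assumes "f \<in> K l"
  shows "G f (s l f)"
proof -
  have "tgt S f \<in> obj S" using s_simps[OF assms] by (simp add: S.cat_simps)
  from G_step[OF G_ide[OF this] assms] this show ?thesis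
    by (simp add: S.cat_simps M.cat_simps s_simps[OF assms])
qed

text \<open>Induction on the factorization of the inner arrow, because \<open>G_step\<close> extends
  a string on the source side.\<close>

lemma G_cmp: "G g n \<Longrightarrow> G f m \<Longrightarrow> tgt S g = src S f \<Longrightarrow> G (f *[S] g) (m *[M] n)"
proof (induction rule: G.induct)
  case (G_ide X)
  then show ?case by (simp add: S.cat_simps M.cat_simps G_simps[OF G_ide(2)])
next
  case (G_step g n h l)
  note t = G_simps[OF G_step(1)] G_simps[OF G_step(5)] s_simps[OF G_step(2)]
  have c: "tgt S g = src S f" using G_step by (simp add: S.cat_simps t)
  have "G ((f *[S] g) *[S] h) ((m *[M] n) *[M] s l h)"
    using G_step c by (intro G.G_step) (simp_all add: S.cat_simps t)
  then show ?case using G_step(3) c by (simp add: S.cat_simps M.cat_simps t)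
qed

text \<open>Fibre squares are stacked along the string of \<open>f\<close>. Each projection parallel
  to \<open>g\<close> stays in the class of \<open>g\<close>, so \<open>exch\<close> applies again
  to it and the next arrow.\<close>

lemma exch_generator:
  "G f m \<Longrightarrow> g \<in> K l \<Longrightarrow> tgt S g = tgt S f \<Longrightarrow>
    \<exists>f' g' m'. cartesian S f g f' g' \<and> g' \<in> K l \<and> G f' m' \<and> m *[M] s l g' = s l g *[M] m'"
proof (induction rule: G.induct)
  case (G_ide X)
  note t = s_simps[OF G_ide(2)]
  have X: "X = tgt S g" using G_ide by (simp add: S.cat_simps)
  have "src S g \<in> obj S" "tgt S g \<in> obj S" using t by (simp_all add: S.cat_simps)
  then show ?case
    using S.cartesian_ide[OF t(1)] G.G_ide[of "src S g"] G_ide(2)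
    by (intro exI[of _ "ide S (src S g)"] exI[of _ g] exI[of _ "ide M (src S g)"])
      (simp add: X M.cat_simps t)
next
  case (G_step f m h k)
  note th = s_simps[OF G_step(2)] and tf = G_simps[OF G_step(1)]
  have tg: "tgt S g = tgt S f" using G_step(3,6) by (simp add: S.cat_simps th tf)
  from G_step.IH[OF G_step(5) tg] obtain f' g' m' where
    1: "cartesian S f g f' g'" "g' \<in> K l" "G f' m'" "m *[M] s l g' = s l g *[M] m'" by blast
  note c = S.cartesianD[OF 1(1)]
  have "tgt S g' = tgt S h" using c(8) G_step(3) by simp
  from exch[OF G_step(2) 1(2) this] obtain h' g'' where
    2: "cartesian S h g' h' g''" "h' \<in> K k" "g'' \<in> K l" "s k h *[M] s l g'' = s l g' *[M] s k h'"
    by blast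
  note d = S.cartesianD[OF 2(1)]
  have th': "tgt S h' = src S f'" using c(6) d(7) by simp
  note t = th tf s_simps[OF G_step(5)] s_simps[OF 1(2)] G_simps[OF 1(3)] s_simps[OF 2(2)]
    s_simps[OF 2(3)]
  have "(m *[M] s k h) *[M] s l g'' = m *[M] (s k h *[M] s l g'')"
    by (simp add: M.cat_simps t G_step(3) d(8))
  also have "\<dots> = (m *[M] s l g') *[M] s k h'"
    by (simp add: M.cat_simps t 2(4) c(8) d(7))
  also have "\<dots> = s l g *[M] (m' *[M] s k h')"
    unfolding 1(4) by (simp add: M.cat_simps t th' c(7))
  finally show ?case
    using S.cartesian_vertical[OF 1(1) 2(1)] 2(3) G.G_step[OF 1(3) 2(2) th'] by blast
qed

text \<open>Here the string of \<open>g\<close> grows. The base change of \<open>f\<close> is again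
  a string with a value, so \<open>exch_generator\<close> applies to it and the next arrow of
  \<open>g\<close>.\<close>

lemma exch_G:
  "G g n \<Longrightarrow> G f m \<Longrightarrow> tgt S g = tgt S f \<Longrightarrow>
    \<exists>f' g' m' n'. cartesian S f g f' g' \<and> G f' m' \<and> G g' n' \<and> m *[M] n' = n *[M] m'"
proof (induction rule: G.induct)
  case (G_ide X)
  note t = G_simps[OF G_ide(2)]
  have X: "X = tgt S f" using G_ide by (simp add: S.cat_simps)
  have "src S f \<in> obj S" "tgt S f \<in> obj S" using t by (simp_all add: S.cat_simps)
  then show ?case
    using S.cartesian_sym[OF S.cartesian_ide[OF t(1)]] G.G_ide[of "src S f"] G_ide(2)
    by (intro exI[of _ "ide S (src S f)"] exI[of _ f] exI[of _ "ide M (src S f)"] exI[of _ m])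
      (simp add: X M.cat_simps t)
next
  case (G_step g n h k)
  note th = s_simps[OF G_step(2)] and tg = G_simps[OF G_step(1)]
  have tgf: "tgt S g = tgt S f" using G_step(3,6) by (simp add: S.cat_simps th tg)
  from G_step.IH[OF G_step(5) tgf] obtain f' g' m' n' where
    1: "cartesian S f g f' g'" "G f' m'" "G g' n'" "m *[M] n' = n *[M] m'" by blast
  note c = S.cartesianD[OF 1(1)]
  have "tgt S h = tgt S f'" using c(7) G_step(3) by simp
  from exch_generator[OF 1(2) G_step(2) this] obtain f'' h' m'' where
    2: "cartesian S f' h f'' h'" "h' \<in> K k" "G f'' m''" "m' *[M] s k h' = s k h *[M] m''"
    by blast
  note d = S.cartesianD[OF 2(1)]
  have th': "tgt S h' = src S g'" using c(6) d(8) by simp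
  note t = th tg G_simps[OF G_step(5)] G_simps[OF 1(2)] G_simps[OF 1(3)] s_simps[OF 2(2)]
    G_simps[OF 2(3)]
  have "m *[M] (n' *[M] s k h') = (m *[M] n') *[M] s k h'"
    by (simp add: M.cat_simps t c(8) th')
  also have "\<dots> = n *[M] (m' *[M] s k h')"
    unfolding 1(4) by (simp add: M.cat_simps t c(7) d(8))
  also have "\<dots> = (n *[M] s k h) *[M] m''"
    by (simp add: M.cat_simps t 2(4) c(7) d(7) G_step(3))
  finally show ?case
    using S.cartesian_horizontal[OF 1(1) 2(1)] 2(3) G.G_step[OF 1(3) 2(2) th'] by blast
qed

text \<open>The section of a string is split by pulling back the section of its tail along the
  first arrow.\<close>

lemma retr_G:
  "G h m \<Longrightarrow> i \<in> arr S \<Longrightarrow> tgt S i = src S h \<Longrightarrow> src S i = tgt S h \<Longrightarrow> h *[S] i = ide S (src S i)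
    \<Longrightarrow> i \<in> K True \<and> m *[M] s True i = ide M (src S i)"
proof (induction arbitrary: i rule: G.induct)
  case (G_ide X)
  have "i = ide S X" "src S i = X" using G_ide by (simp_all add: S.cat_simps)
  with s_ide[OF G_ide(1)] show ?case using G_ide(1) obj_eq by (simp add: M.cat_simps)
next
  case (G_step h m g l)
  note tg = s_simps[OF G_step(2)] and th = G_simps[OF G_step(1)]
  have ti: "tgt S i = src S g" "src S i = tgt S h"
    using G_step(3,6,7) by (simp_all add: S.cat_simps tg th)
  have hgi: "h *[S] (g *[S] i) = ide S (src S i)"
    using G_step(8) by (simp add: S.cat_simps tg th ti G_step(3,5))
  \<comment> \<open>Composing the section with the arrow nearest the source gives a section of the
    tail \<open>h\<close>. The induction hypothesis puts it into \<open>K True\<close>, so that it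
    can take part in an exchange square.\<close>
  have gi: "g *[S] i \<in> K True \<and> m *[M] s True (g *[S] i) = ide M (src S (g *[S] i))"
    by (rule G_step.IH) (simp_all add: S.cat_simps tg th ti G_step(3,5) hgi)
  let ?d = "g *[S] i"
  have td: "src S ?d = tgt S h" "tgt S ?d = tgt S g" by (simp_all add: S.cat_simps tg th ti G_step(5))
  obtain g' d where 1: "cartesian S g ?d g' d" "g' \<in> K l" "d \<in> K True"
    "s l g *[M] s True d = s True ?d *[M] s l g'"
    using exch[OF G_step(2) conjunct1[OF gi] td(2)] by blast
  note c = S.cartesianD[OF 1(1)]
  have o: "tgt S h \<in> obj S" using th by (simp add: S.cat_simps)
  \<comment> \<open>The section \<open>i\<close> and an identity form a cone over \<open>g\<close>
    and \<open>g i\<close>. The induced \<open>t\<close> is a section of the base change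
    \<open>g'\<close> with \<open>d t = i\<close>, and \<open>retr\<close> applies to it because
    \<open>g'\<close> is a single generator.\<close>
  have "\<exists>t. t \<in> arr S \<and> src S t = src S i \<and> tgt S t = src S g' \<and>
      d *[S] t = i \<and> g' *[S] t = ide S (tgt S h)"
    by (rule S.cartesian_factor[OF 1(1)])
      (simp_all add: G_step(5) o S.cat_simps ti td c(2) tg)
  then obtain t where t: "t \<in> arr S" "src S t = src S i" "tgt S t = src S g'"
    "d *[S] t = i" "g' *[S] t = ide S (tgt S h)" by blast
  have "src S t = tgt S g'" using t(2) ti(2) td(1) c(7) by simp
  from retr[OF 1(2) t(1,3) this] t(2,5) ti(2)
  have r: "t \<in> K True" "s l g' *[M] s True t = ide M (tgt S h)" by simp_all
  have dt: "tgt S t = src S d" using t(3) c(6) by simp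
  \<comment> \<open>Multiplicativity of \<open>s True\<close> enters here: \<open>i\<close> is a
    composite of two arrows of \<open>K True\<close>.\<close>
  have i: "i \<in> K True" "s True i = s True d *[M] s True t"
    using s_cmp[OF r(1) 1(3) dt] t(4) by simp_all
  note ty = tg th s_simps[OF 1(2)] s_simps[OF 1(3)] s_simps[OF r(1)] s_simps[OF conjunct1[OF gi]]
  have "(m *[M] s l g) *[M] s True i = m *[M] ((s l g *[M] s True d) *[M] s True t)"
    unfolding i by (simp add: M.cat_simps ty dt c(8) G_step(3))
  also have "\<dots> = (m *[M] s True ?d) *[M] (s l g' *[M] s True t)"
    unfolding 1(4) using c(7)
    by (simp add: M.cat_simps ty t(3) td G_step(3) del: r(2))
  also have "\<dots> = ide M (src S i)"
    unfolding r(2) using conjunct2[OF gi] o obj_eq ti by (simp add: td M.cat_simps)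
  finally show ?case using i by simp
qed

text \<open>Base change of two factorizations of \<open>f\<close> along each other gives factorizations of the
  projections of the fibre square of \<open>f\<close>; both are split by the diagonal.\<close>

theorem G_unique:
  assumes f: "G f m" and g: "G f n"
  shows "m = n"
proof -
  obtain a b m' n' where 1: "cartesian S f f a b" "G a m'" "G b n'" "m *[M] n' = n *[M] m'"
    using exch_G[OF g f] by blast
  note c = S.cartesianD[OF 1(1)] and t = G_simps[OF f] G_simps[OF g] G_simps[OF 1(2)] G_simps[OF 1(3)]
  have o: "src S f \<in> obj S" using t by (simp add: S.cat_simps)
  \<comment> \<open>The diagonal of \<open>f\<close>, a section of both projections.\<close>
  have "\<exists>d. d \<in> arr S \<and> src S d = src S (ide S (src S f)) \<and> tgt S d = src S a \<and>
      b *[S] d = ide S (src S f) \<and> a *[S] d = ide S (src S f)"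
    by (rule S.cartesian_factor[OF 1(1)]) (simp_all add: o S.cat_simps)
  then obtain d where d: "d \<in> arr S" "src S d = src S f" "tgt S d = src S a"
    "b *[S] d = ide S (src S f)" "a *[S] d = ide S (src S f)"
    by (auto simp: S.cat_simps o)
  have "src S d = tgt S a" "src S d = tgt S b" "tgt S d = src S b" using d c by simp_all
  with retr_G[OF 1(2) d(1,3)] retr_G[OF 1(3) d(1)] d
  have r: "d \<in> K True" "m' *[M] s True d = ide M (src S f)" "n' *[M] s True d = ide M (src S f)"
    by simp_all
  note td = s_simps[OF r(1)]
  \<comment> \<open>Insert \<open>n' s(d) = 1\<close>, exchange \<open>m n'\<close> for
    \<open>n m'\<close>, and remove \<open>m' s(d) = 1\<close>.\<close>
  have "m = (m *[M] n') *[M] s True d"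
    using r(3) c d by (simp add: M.cat_simps t td)
  also have "\<dots> = n"
    unfolding 1(4) using r(2) c d by (simp add: M.cat_simps t td)
  finally show ?thesis .
qed

end

section \<open>Base change isomorphisms and strict isomorphisms of pseudofunctors\<close>

lemma subcat_simps:
  "src (subcat C R) = src C" "tgt (subcat C R) = tgt C" "ide (subcat C R) = ide C"
  "cmp (subcat C R) = cmp C" "arr (subcat C R) = R"
  by (simp_all add: subcat_def)

lemma subcategoryD:
  assumes "subcategory C R"
  shows "f \<in> R \<Longrightarrow> f \<in> arr C"
    "f \<in> R \<Longrightarrow> g \<in> R \<Longrightarrow> tgt C f = src C g \<Longrightarrow> g *[C] f \<in> R"
  using assms unfolding subcategory_def by blast+

text \<open>\<open>f\<close> and \<open>g\<close> are pulled back by \<open>Vf\<close>, \<open>Vg\<close> or by \<open>Wf\<close>, \<open>Wg\<close>, their flat base changes by the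
  primed functors, and the flat maps by \<open>U\<close>, \<open>U'\<close>, \<open>U''\<close>; the categories \<open>QY\<close>, \<open>QX\<close>, \<open>QX1\<close> belong
  to the base-changed objects.\<close>

lemma paste_conjugate:
  assumes U: "is_functor DY QY U" and U': "is_functor DX QX U'" and U'': "is_functor DX1 QX1 U''"
    and \<mu>f: "nat_trans DY DX Vf Wf \<mu>f" and \<mu>g: "nat_trans DX DX1 Vg Wg \<mu>g"
    and \<mu>f': "nat_trans QY QX Vf' Wf' \<mu>f'" and \<mu>g': "nat_trans QX QX1 Vg' Wg' \<mu>g'"
    and a: "nat_trans DY QX (U' \<circ>\<^sub>F Vf) (Vf' \<circ>\<^sub>F U) a"
    and a': "nat_trans DY QX (U' \<circ>\<^sub>F Wf) (Wf' \<circ>\<^sub>F U) a'"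
    and b: "nat_trans DX QX1 (U'' \<circ>\<^sub>F Vg) (Vg' \<circ>\<^sub>F U') b"
    and b': "nat_trans DX QX1 (U'' \<circ>\<^sub>F Wg) (Wg' \<circ>\<^sub>F U') b'"
    and hf: "\<And>A. A \<in> obj DY \<Longrightarrow> \<mu>f' (ob U A) *[QX] a A = a' A *[QX] ar U' (\<mu>f A)"
    and hg: "\<And>A. A \<in> obj DX \<Longrightarrow> \<mu>g' (ob U' A) *[QX1] b A = b' A *[QX1] ar U'' (\<mu>g A)"
    and A: "A \<in> obj DY"
  shows "ar Wg' (\<mu>f' (ob U A)) *[QX1] (\<mu>g' (ob Vf' (ob U A)) *[QX1]
      (ar Vg' (a A) *[QX1] b (ob Vf A))) =
    ar Wg' (a' A) *[QX1] (b' (ob Wf A) *[QX1]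
      (ar U'' (ar Wg (\<mu>f A)) *[QX1] ar U'' (\<mu>g (ob Vf A))))"
proof -
  interpret QX1: category QX1 using functor_category[OF U''] by simp
  note fs = functor_simps[OF U] functor_simps[OF U'] functor_simps[OF U'']
    functor_simps[OF nat_transD(1)[OF \<mu>f]] functor_simps[OF nat_transD(2)[OF \<mu>f]]
    functor_simps[OF nat_transD(1)[OF \<mu>g]] functor_simps[OF nat_transD(2)[OF \<mu>g]]
    functor_simps[OF nat_transD(1)[OF \<mu>f']] functor_simps[OF nat_transD(2)[OF \<mu>f']]
    functor_simps[OF nat_transD(1)[OF \<mu>g']] functor_simps[OF nat_transD(2)[OF \<mu>g']]
  note ns = nat_transD(3-5)[OF \<mu>f] nat_transD(3-5)[OF \<mu>g] nat_transD(3-5)[OF \<mu>f']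
    nat_transD(3-5)[OF \<mu>g'] nat_transD(3-5)[OF a] nat_transD(3-5)[OF a'] nat_transD(3-5)[OF b]
    nat_transD(3-5)[OF b']
  note ty = A fs ns comp_functor_simps
  have 1: "\<mu>g' (ob Vf' (ob U A)) *[QX1] ar Vg' (a A) = ar Wg' (a A) *[QX1] \<mu>g' (ob U' (ob Vf A))"
    using nat_trans_natural[OF \<mu>g', of "a A"] by (simp add: ty)
  have 2: "\<mu>g' (ob U' (ob Vf A)) *[QX1] b (ob Vf A) = b' (ob Vf A) *[QX1] ar U'' (\<mu>g (ob Vf A))"
    by (simp add: hg ty)
  have 3: "ar Wg' (\<mu>f' (ob U A)) *[QX1] ar Wg' (a A) = ar Wg' (a' A) *[QX1] ar Wg' (ar U' (\<mu>f A))"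
    using hf[OF A] by (simp add: functor_cmp[OF nat_transD(2)[OF \<mu>g'], symmetric] ty)
  have 4: "ar Wg' (ar U' (\<mu>f A)) *[QX1] b' (ob Vf A) = b' (ob Wf A) *[QX1] ar U'' (ar Wg (\<mu>f A))"
    using nat_trans_natural[OF b', of "\<mu>f A"] by (simp add: ty)
  show ?thesis
    by (simp add: QX1.cat_simps ty 2 QX1.reassoc[OF 1] QX1.reassoc[OF 3] QX1.reassoc[OF 4])
qed

text \<open>The family \<open>a\<close> is the only one with \<open>\<mu>' a = a' \<mu>\<close>. Its
  naturality is checked after composition with the invertible \<open>\<mu>'\<close>, where it
  follows from naturality of \<open>\<mu>\<close>, \<open>a'\<close> and
  \<open>\<mu>'\<close>.\<close>

lemma conjugate_iso:
  assumes U: "is_functor DY QY U" and U': "is_functor DX QX U'"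
    and \<mu>: "nat_iso DY DX V W \<mu>" and \<mu>': "nat_iso QY QX V' W' \<mu>'"
    and a': "nat_iso DY QX (U' \<circ>\<^sub>F W) (W' \<circ>\<^sub>F U) a'"
    and a: "\<And>A. A \<in> obj DY \<Longrightarrow> a A = inv_arr QX (\<mu>' (ob U A)) *[QX] (a' A *[QX] ar U' (\<mu> A))"
  shows "nat_iso DY QX (U' \<circ>\<^sub>F V) (V' \<circ>\<^sub>F U) a"
    and "A \<in> obj DY \<Longrightarrow> \<mu>' (ob U A) *[QX] a A = a' A *[QX] ar U' (\<mu> A)"
proof -
  interpret QX: category QX using functor_category[OF U'] by simp
  interpret DY: category DY using functor_category[OF U] by simp
  note \<mu>n = nat_isoD(1)[OF \<mu>] and \<mu>'n = nat_isoD(1)[OF \<mu>'] and a'n = nat_isoD(1)[OF a']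
  note FV = nat_transD(1)[OF \<mu>n] and FW = nat_transD(2)[OF \<mu>n]
    and FV' = nat_transD(1)[OF \<mu>'n] and FW' = nat_transD(2)[OF \<mu>'n]
  note fs = functor_simps[OF U] functor_simps[OF U'] functor_simps[OF FV] functor_simps[OF FW]
    functor_simps[OF FV'] functor_simps[OF FW']
  note ns = nat_transD(3-5)[OF \<mu>n] nat_transD(3-5)[OF \<mu>'n] nat_transD(3-5)[OF a'n]
  note ty = fs ns comp_functor_simps DY.cat_simps
  note isos = nat_isoD(2)[OF \<mu>] nat_isoD(2)[OF \<mu>'] nat_isoD(2)[OF a'] functor_iso(1)[OF U']
  have isA: "iso_arr QX (\<mu>' (ob U A))" if "A \<in> obj DY" for A using that by (simp add: isos ty)
  note ii = QX.iso_simps[OF isA] QX.iso_cancel[OF isA]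
  have e: "\<mu>' (ob U A) *[QX] a A = a' A *[QX] ar U' (\<mu> A)" if "A \<in> obj DY" for A
    using that by (simp add: ii QX.cat_simps ty a)
  have aty: "a A \<in> arr QX \<and> src QX (a A) = ob U' (ob V A) \<and> tgt QX (a A) = ob V' (ob U A)"
    if "A \<in> obj DY" for A using that by (simp add: ii QX.cat_simps ty a)
  have nat: "a (tgt DY m) *[QX] ar U' (ar V m) = ar V' (ar U m) *[QX] a (src DY m)" if m: "m \<in> arr DY" for m
  proof (rule QX.iso_left_cancel)
    let ?x = "src DY m" and ?y = "tgt DY m"
    note xy = DY.src_obj[OF m] DY.tgt_obj[OF m] m
    have 1: "ar U' (\<mu> ?y) *[QX] ar U' (ar V m) = ar U' (ar W m) *[QX] ar U' (\<mu> ?x)"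
      using nat_trans_natural[OF \<mu>n, of m] xy by (simp add: functor_cmp[OF U', symmetric] ty)
    have 2: "a' ?y *[QX] ar U' (ar W m) = ar W' (ar U m) *[QX] a' ?x"
      using nat_trans_natural[OF a'n, of m] xy by (simp add: ty)
    have 3: "ar W' (ar U m) *[QX] \<mu>' (ob U ?x) = \<mu>' (ob U ?y) *[QX] ar V' (ar U m)"
      using nat_trans_natural[OF \<mu>'n, of "ar U m"] xy by (simp add: ty)
    have "\<mu>' (ob U ?y) *[QX] (a ?y *[QX] ar U' (ar V m)) = (\<mu>' (ob U ?y) *[QX] a ?y) *[QX] ar U' (ar V m)"
      using xy by (simp add: QX.cat_simps ty aty)
    also have "\<dots> = ar W' (ar U m) *[QX] (a' ?x *[QX] ar U' (\<mu> ?x))"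
      unfolding e[OF xy(2)] using xy by (simp add: QX.cat_simps ty 1 QX.reassoc[OF 2])
    also have "\<dots> = \<mu>' (ob U ?y) *[QX] (ar V' (ar U m) *[QX] a ?x)"
      unfolding e[OF xy(1), symmetric] using xy by (simp add: QX.cat_simps ty aty QX.reassoc[OF 3])
    finally show "\<mu>' (ob U ?y) *[QX] (a ?y *[QX] ar U' (ar V m)) =
      \<mu>' (ob U ?y) *[QX] (ar V' (ar U m) *[QX] a ?x)" .
  qed (use m in \<open>simp_all add: isA QX.cat_simps ty aty\<close>)
  have iso: "iso_arr QX (a A)" if "A \<in> obj DY" for A
    using that by (simp add: a) (intro QX.iso_cmp QX.iso_inv; simp add: isos ty ii QX.cat_simps)
  show "nat_iso DY QX (U' \<circ>\<^sub>F V) (V' \<circ>\<^sub>F U) a"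
    using aty nat iso functor_comp[OF FV U'] functor_comp[OF U FV']
    by (intro nat_isoI nat_transI) (simp_all add: comp_functor_simps)
  show "A \<in> obj DY \<Longrightarrow> \<mu>' (ob U A) *[QX] a A = a' A *[QX] ar U' (\<mu> A)" by (rule e)
qed

text \<open>The values on objects are a parameter \<open>D\<close>, compared with
  \<open>pcat V X\<close> only for objects of \<open>C\<close>, so that pseudofunctors on different
  classes of arrows can share the same categories. By \<open>ide_R\<close> every object of
  \<open>C\<close> is an object of the subcategory.\<close>

locale pseudo_on = category C
  for C :: "('o, 'a) cat" +
  fixes R :: "'a set"
    and V :: "('o, 'a, 'p, 'q) pseudo"
    and D :: "'o \<Rightarrow> ('p, 'q) cat"
  assumes sub: "subcategory C R"
    and ide_R: "X \<in> obj C \<Longrightarrow> ide C X \<in> R"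
    and pseudo: "pseudofunctor (subcat C R) V"
    and pcat_eq: "X \<in> obj C \<Longrightarrow> pcat V X = D X"
begin

lemma R_arr: "f \<in> R \<Longrightarrow> f \<in> arr C"
  and R_cmp: "f \<in> R \<Longrightarrow> g \<in> R \<Longrightarrow> tgt C f = src C g \<Longrightarrow> g *[C] f \<in> R"
  using subcategoryD[OF sub] by blast+

lemma R_hom: "f \<in> R \<Longrightarrow> src C f = X \<Longrightarrow> tgt C f = Y \<Longrightarrow> f \<in> hom (subcat C R) X Y"
  by (simp add: hom_def subcat_simps)

lemma obj_sub: "obj (subcat C R) = obj C"
  using ide_R by (auto simp: subcat_def)

lemma D_category: "X \<in> obj C \<Longrightarrow> category (D X)"
  using pseudofunctor.pcat_category[OF pseudo, of X] by (simp add: obj_sub pcat_eq)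

lemma pull:
  assumes "f \<in> R" "src C f = X" "tgt C f = Y"
  shows "is_functor (D Y) (D X) (V\<langle>f\<rangle>)"
  using pseudofunctor.pfun_functor[OF pseudo R_hom[OF assms]] R_arr[OF assms(1)] assms
  by (auto simp: pcat_eq cat_simps)

lemma coh_nat:
  assumes "f \<in> R" "g \<in> R" "src C f = X" "tgt C f = Y" "src C g = Y" "tgt C g = Z"
  shows "nat_iso (D Z) (D X) (V\<langle>f\<rangle> \<circ>\<^sub>F V\<langle>g\<rangle>) (V\<langle>g *[C] f\<rangle>) (coh V f g)"
  using pseudofunctor.coh_iso[OF pseudo R_hom[OF assms(1,3,4)] R_hom[OF assms(2,5,6)]]
    R_arr[OF assms(1)] R_arr[OF assms(2)] assms
  by (auto simp: pcat_eq cat_simps subcat_simps)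

lemma coh_associative:
  assumes "f \<in> R" "g \<in> R" "h \<in> R" "src C f = X" "tgt C f = Y" "src C g = Y" "tgt C g = Z"
    "src C h = Z" "tgt C h = W" "A \<in> obj (D W)"
  shows "coh V (g *[C] f) h A *[D X] coh V f g (ob (V\<langle>h\<rangle>) A) =
    coh V f (h *[C] g) A *[D X] ar (V\<langle>f\<rangle>) (coh V g h A)"
proof -
  have o: "X \<in> obj C" "W \<in> obj C" using R_arr assms cat_simps by auto
  show ?thesis
    using pseudofunctor.coh_assoc[OF pseudo R_hom[OF assms(1,4,5)] R_hom[OF assms(2,6,7)] R_hom[OF assms(3,8,9)]]
      assms(10) by (simp add: pcat_eq o subcat_simps)
qed

lemma pull_ide:
  assumes "X \<in> obj C"
  shows "A \<in> obj (D X) \<Longrightarrow> ob (V\<langle>ide C X\<rangle>) A = A" "m \<in> arr (D X) \<Longrightarrow> ar (V\<langle>ide C X\<rangle>) m = m"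
  using pseudofunctor.pfun_ide[OF pseudo, of X] assms
  by (auto simp: obj_sub subcat_simps pcat_eq functor_eq_def id_functor_simps)

lemma coh_ide:
  assumes "f \<in> R" "src C f = X" "tgt C f = Y" "A \<in> obj (D Y)"
  shows "coh V (ide C X) f A = ide (D X) (ob (V\<langle>f\<rangle>) A)" "coh V f (ide C Y) A = ide (D X) (ob (V\<langle>f\<rangle>) A)"
proof -
  have o: "X \<in> obj C" "Y \<in> obj C" using R_arr assms cat_simps by auto
  show "coh V (ide C X) f A = ide (D X) (ob (V\<langle>f\<rangle>) A)" "coh V f (ide C Y) A = ide (D X) (ob (V\<langle>f\<rangle>) A)"
    using pseudofunctor.coh_ide_left[OF pseudo R_hom[OF assms(1,2,3)]]
      pseudofunctor.coh_ide_right[OF pseudo R_hom[OF assms(1,2,3)]] assms(4)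
    by (simp_all add: pcat_eq o subcat_simps)
qed

end

text \<open>An isomorphism of pseudofunctors with identity functors underneath: the form taken by
  the comparison maps of a perfect cover once \<open>X^!\<close> is identified with
  \<open>\<D>\<^sub>X\<close>.\<close>

definition strict_iso :: "('o, 'a) cat \<Rightarrow> 'a set \<Rightarrow> ('o \<Rightarrow> ('p, 'q) cat) \<Rightarrow> ('o, 'a, 'p, 'q) pseudo \<Rightarrow>
    ('o, 'a, 'p, 'q) pseudo \<Rightarrow> ('a \<Rightarrow> 'p \<Rightarrow> 'q) \<Rightarrow> bool" where
  "strict_iso C R D V W \<mu> \<longleftrightarrow>
     (\<forall>f\<in>R. nat_iso (D (tgt C f)) (D (src C f)) (V\<langle>f\<rangle>) (W\<langle>f\<rangle>) (\<mu> f)) \<and>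
     (\<forall>f\<in>R. \<forall>g\<in>R. tgt C f = src C g \<longrightarrow> (\<forall>A\<in>obj (D (tgt C g)).
        coh W f g A *[D (src C f)] (ar (W\<langle>f\<rangle>) (\<mu> g A) *[D (src C f)] \<mu> f (ob (V\<langle>g\<rangle>) A)) =
        \<mu> (g *[C] f) A *[D (src C f)] coh V f g A))"

text \<open>Stability is asked only of squares that are given; existence of fibre products is a
  separate matter and enters where squares are built.\<close>

locale flat_pseudo = pseudo_on C R V D + Fl: pseudo_on C Fc Fl D
  for C :: "('o, 'a) cat" and R V Fc Fl D +
  assumes stable: "\<lbrakk>cartesian C f u f' u'; f \<in> R; u \<in> Fc\<rbrakk> \<Longrightarrow> f' \<in> R \<and> u' \<in> Fc"
begin

text \<open>Names for the four corners. As rewrite rules they bring the sources and targets of all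
  sides to one form, which makes the typing conditions accessible to simplification.\<close>

lemma square:
  assumes "cartesian C f u f' u'" "f \<in> R" "u \<in> Fc"
  obtains X Y X' Y' where "src C f = X" "tgt C f = Y" "src C f' = X'" "tgt C f' = Y'"
    "src C u = Y'" "tgt C u = Y" "src C u' = X'" "tgt C u' = X" "f' \<in> R" "u' \<in> Fc"
    "X \<in> obj C" "Y \<in> obj C" "X' \<in> obj C" "Y' \<in> obj C"
  using stable[OF assms] cartesianD[OF assms(1)] cat_simps(1,2) by metis

lemma base_changeI:
  assumes "\<And>f u f' u'. \<lbrakk>cartesian C f u f' u'; f \<in> R; u \<in> Fc\<rbrakk>
      \<Longrightarrow> nat_iso (D (tgt C f)) (D (src C f'))
            (Fl\<langle>u'\<rangle> \<circ>\<^sub>F V\<langle>f\<rangle>) (V\<langle>f'\<rangle> \<circ>\<^sub>F Fl\<langle>u\<rangle>) (\<gamma> f u f' u')"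
    and "\<And>f i f' i' j f'' j' A. \<lbrakk>cartesian C f i f' i'; f \<in> R; i \<in> Fc;
        cartesian C f' j f'' j'; j \<in> Fc; A \<in> obj (D (tgt C f))\<rbrakk>
      \<Longrightarrow> \<gamma> f (i *[C] j) f'' (i' *[C] j') A *[D (src C f'')] coh Fl j' i' (ob (V\<langle>f\<rangle>) A) =
          ar (V\<langle>f''\<rangle>) (coh Fl j i A) *[D (src C f'')]
            (\<gamma> f' j f'' j' (ob (Fl\<langle>i\<rangle>) A) *[D (src C f'')] ar (Fl\<langle>j'\<rangle>) (\<gamma> f i f' i' A))"
    and "\<And>f i f' i' g g' i'' A. \<lbrakk>cartesian C f i f' i'; f \<in> R; i \<in> Fc;
        cartesian C g i' g' i''; g \<in> R; A \<in> obj (D (tgt C f))\<rbrakk>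
      \<Longrightarrow> \<gamma> (f *[C] g) i (f' *[C] g') i'' A *[D (src C g')] ar (Fl\<langle>i''\<rangle>) (coh V g f A) =
          coh V g' f' (ob (Fl\<langle>i\<rangle>) A) *[D (src C g')]
            (ar (V\<langle>g'\<rangle>) (\<gamma> f i f' i' A) *[D (src C g')] \<gamma> g i' g' i'' (ob (V\<langle>f\<rangle>) A))"
  shows "base_change C R Fc V Fl \<gamma>"
proof
  fix f i f' i' assume h: "cartesian C f i f' i'" "f \<in> R" "i \<in> Fc"
  note c = cartesianD[OF h(1)]
  have o: "tgt C f \<in> obj C" "src C f' \<in> obj C" using c by (auto intro: src_obj tgt_obj)
  show "nat_iso (pcat V (tgt C f)) (pcat V (src C f')) (Fl\<langle>i'\<rangle> \<circ>\<^sub>F V\<langle>f\<rangle>) (V\<langle>f'\<rangle> \<circ>\<^sub>F Fl\<langle>i\<rangle>) (\<gamma> f i f' i')"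
    using assms(1)[OF h] by (simp add: pcat_eq o)
  { fix j f'' j' A assume k: "cartesian C f' j f'' j'" "j \<in> Fc" "A \<in> obj (pcat V (tgt C f))"
    have o': "src C f'' \<in> obj C" using cartesianD[OF k(1)] by (auto intro: src_obj tgt_obj)
    show "\<gamma> f (i *[C] j) f'' (i' *[C] j') A *[pcat V (src C f'')] coh Fl j' i' (ob (V\<langle>f\<rangle>) A) =
          ar (V\<langle>f''\<rangle>) (coh Fl j i A) *[pcat V (src C f'')]
            (\<gamma> f' j f'' j' (ob (Fl\<langle>i\<rangle>) A) *[pcat V (src C f'')] ar (Fl\<langle>j'\<rangle>) (\<gamma> f i f' i' A))"
      using assms(2)[OF h k(1,2)] k(3) by (simp add: pcat_eq o o') }
  { fix g g' i'' A assume k: "cartesian C g i' g' i''" "g \<in> R" "A \<in> obj (pcat V (tgt C f))"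
    have o': "src C g' \<in> obj C" using cartesianD[OF k(1)] by (auto intro: src_obj tgt_obj)
    show "\<gamma> (f *[C] g) i (f' *[C] g') i'' A *[pcat V (src C g')] ar (Fl\<langle>i''\<rangle>) (coh V g f A) =
          coh V g' f' (ob (Fl\<langle>i\<rangle>) A) *[pcat V (src C g')]
            (ar (V\<langle>g'\<rangle>) (\<gamma> f i f' i' A) *[pcat V (src C g')] \<gamma> g i' g' i'' (ob (V\<langle>f\<rangle>) A))"
      using assms(3)[OF h k(1,2)] k(3) by (simp add: pcat_eq o o') }
qed

lemma base_changeD:
  assumes "base_change C R Fc V Fl \<gamma>" "cartesian C f i f' i'" "f \<in> R" "i \<in> Fc"
  shows "nat_iso (D (tgt C f)) (D (src C f')) (Fl\<langle>i'\<rangle> \<circ>\<^sub>F V\<langle>f\<rangle>) (V\<langle>f'\<rangle> \<circ>\<^sub>F Fl\<langle>i\<rangle>) (\<gamma> f i f' i')"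
    and "\<lbrakk>cartesian C f' j f'' j'; j \<in> Fc; A \<in> obj (D (tgt C f))\<rbrakk>
      \<Longrightarrow> \<gamma> f (i *[C] j) f'' (i' *[C] j') A *[D (src C f'')] coh Fl j' i' (ob (V\<langle>f\<rangle>) A) =
          ar (V\<langle>f''\<rangle>) (coh Fl j i A) *[D (src C f'')]
            (\<gamma> f' j f'' j' (ob (Fl\<langle>i\<rangle>) A) *[D (src C f'')] ar (Fl\<langle>j'\<rangle>) (\<gamma> f i f' i' A))"
    and "\<lbrakk>cartesian C g i' g' i''; g \<in> R; A \<in> obj (D (tgt C f))\<rbrakk>
      \<Longrightarrow> \<gamma> (f *[C] g) i (f' *[C] g') i'' A *[D (src C g')] ar (Fl\<langle>i''\<rangle>) (coh V g f A) =
          coh V g' f' (ob (Fl\<langle>i\<rangle>) A) *[D (src C g')]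
            (ar (V\<langle>g'\<rangle>) (\<gamma> f i f' i' A) *[D (src C g')] \<gamma> g i' g' i'' (ob (V\<langle>f\<rangle>) A))"
proof -
  have o: "tgt C f \<in> obj C" "src C f' \<in> obj C" using cartesianD[OF assms(2)] by (auto intro: src_obj tgt_obj)
  show "nat_iso (D (tgt C f)) (D (src C f')) (Fl\<langle>i'\<rangle> \<circ>\<^sub>F V\<langle>f\<rangle>) (V\<langle>f'\<rangle> \<circ>\<^sub>F Fl\<langle>i\<rangle>) (\<gamma> f i f' i')"
    using base_change.bc_iso[OF assms] by (simp add: pcat_eq o)
  show "\<gamma> f (i *[C] j) f'' (i' *[C] j') A *[D (src C f'')] coh Fl j' i' (ob (V\<langle>f\<rangle>) A) =
          ar (V\<langle>f''\<rangle>) (coh Fl j i A) *[D (src C f'')]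
            (\<gamma> f' j f'' j' (ob (Fl\<langle>i\<rangle>) A) *[D (src C f'')] ar (Fl\<langle>j'\<rangle>) (\<gamma> f i f' i' A))"
    if k: "cartesian C f' j f'' j'" "j \<in> Fc" "A \<in> obj (D (tgt C f))"
  proof -
    have o': "src C f'' \<in> obj C" using cartesianD[OF k(1)] by (auto intro: src_obj tgt_obj)
    show ?thesis using base_change.horizontal[OF assms k(1,2)] k(3) by (simp add: pcat_eq o o')
  qed
  show "\<gamma> (f *[C] g) i (f' *[C] g') i'' A *[D (src C g')] ar (Fl\<langle>i''\<rangle>) (coh V g f A) =
          coh V g' f' (ob (Fl\<langle>i\<rangle>) A) *[D (src C g')]
            (ar (V\<langle>g'\<rangle>) (\<gamma> f i f' i' A) *[D (src C g')] \<gamma> g i' g' i'' (ob (V\<langle>f\<rangle>) A))"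
    if k: "cartesian C g i' g' i''" "g \<in> R" "A \<in> obj (D (tgt C f))"
  proof -
    have o': "src C g' \<in> obj C" using cartesianD[OF k(1)] by (auto intro: src_obj tgt_obj)
    show ?thesis using base_change.vertical[OF assms k(1,2)] k(3) by (simp add: pcat_eq o o')
  qed
qed

end

text \<open>The solution \<delta> of \<open>\<mu> \<delta> = \<gamma> \<mu>\<close>, forced by
  invertibility of \<mu>: the family \<gamma> carried from the target of \<mu> to its
  source.\<close>

definition conjugate :: "('o, 'a) cat \<Rightarrow> ('o \<Rightarrow> ('p, 'q) cat) \<Rightarrow> ('o, 'a, 'p, 'q) pseudo \<Rightarrow>
    ('a \<Rightarrow> 'p \<Rightarrow> 'q) \<Rightarrow> ('a \<Rightarrow> 'a \<Rightarrow> 'a \<Rightarrow> 'a \<Rightarrow> 'p \<Rightarrow> 'q) \<Rightarrow> 'a \<Rightarrow> 'a \<Rightarrow> 'a \<Rightarrow> 'a \<Rightarrow> 'p \<Rightarrow> 'q" where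
  "conjugate C D Fl \<mu> \<gamma> f u f' u' A =
     inv_arr (D (src C f')) (\<mu> f' (ob (Fl\<langle>u\<rangle>) A)) *[D (src C f')]
       (\<gamma> f u f' u' A *[D (src C f')] ar (Fl\<langle>u'\<rangle>) (\<mu> f A))"

lemma strict_isoD:
  assumes "strict_iso C R D V W \<mu>"
  shows "\<lbrakk>f \<in> R; src C f = X; tgt C f = Y\<rbrakk> \<Longrightarrow> nat_iso (D Y) (D X) (V\<langle>f\<rangle>) (W\<langle>f\<rangle>) (\<mu> f)"
    and "\<lbrakk>f \<in> R; g \<in> R; src C f = X; tgt C f = Y; src C g = Y; tgt C g = Z; A \<in> obj (D Z)\<rbrakk> \<Longrightarrow>
      coh W f g A *[D X] (ar (W\<langle>f\<rangle>) (\<mu> g A) *[D X] \<mu> f (ob (V\<langle>g\<rangle>) A)) =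
      \<mu> (g *[C] f) A *[D X] coh V f g A"
  using assms by (auto simp: strict_iso_def)

text \<open>Used for the comparison maps of a cover, with \<open>R\<close> equal to \<open>P\<close>
  or \<open>O\<close>, and once more for an isomorphism between two covers, with \<open>R\<close>
  equal to \<open>Q\<close>.\<close>

locale conjugation = V: flat_pseudo C R V Fc Fl D + W: flat_pseudo C R W Fc Fl D
  for C :: "('o, 'a) cat" and R V W Fc Fl D +
  fixes \<mu> \<gamma>
  assumes \<mu>: "strict_iso C R D V W \<mu>"
    and \<gamma>: "base_change C R Fc W Fl \<gamma>"
begin

abbreviation "\<delta> \<equiv> conjugate C D Fl \<mu> \<gamma>"

lemma conjugate_square:
  assumes "cartesian C f u f' u'" "f \<in> R" "u \<in> Fc"
  shows "nat_iso (D (tgt C f)) (D (src C f')) (Fl\<langle>u'\<rangle> \<circ>\<^sub>F V\<langle>f\<rangle>) (V\<langle>f'\<rangle> \<circ>\<^sub>F Fl\<langle>u\<rangle>) (\<delta> f u f' u')"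
    and "A \<in> obj (D (tgt C f)) \<Longrightarrow>
      \<mu> f' (ob (Fl\<langle>u\<rangle>) A) *[D (src C f')] \<delta> f u f' u' A =
      \<gamma> f u f' u' A *[D (src C f')] ar (Fl\<langle>u'\<rangle>) (\<mu> f A)"
proof -
  obtain X Y X' Y' where t: "src C f = X" "tgt C f = Y" "src C f' = X'" "tgt C f' = Y'"
    "src C u = Y'" "tgt C u = Y" "src C u' = X'" "tgt C u' = X" "f' \<in> R" "u' \<in> Fc"
    by (rule V.square[OF assms])
  note iso = conjugate_iso[OF V.Fl.pull[OF assms(3) t(5,6)] V.Fl.pull[OF t(10,7,8)]
    strict_isoD(1)[OF \<mu> assms(2) t(1,2)] strict_isoD(1)[OF \<mu> t(9,3,4)], where a = "\<delta> f u f' u'" and a' = "\<gamma> f u f' u'"]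
  show "nat_iso (D (tgt C f)) (D (src C f')) (Fl\<langle>u'\<rangle> \<circ>\<^sub>F V\<langle>f\<rangle>) (V\<langle>f'\<rangle> \<circ>\<^sub>F Fl\<langle>u\<rangle>) (\<delta> f u f' u')"
    using iso(1) W.base_changeD(1)[OF \<gamma> assms] by (simp add: t conjugate_def)
  show "\<mu> f' (ob (Fl\<langle>u\<rangle>) A) *[D (src C f')] \<delta> f u f' u' A =
      \<gamma> f u f' u' A *[D (src C f')] ar (Fl\<langle>u'\<rangle>) (\<mu> f A)" if "A \<in> obj (D (tgt C f))"
    using iso(2)[of A] that W.base_changeD(1)[OF \<gamma> assms] by (simp add: t conjugate_def)
qed

lemma conjugate_horizontal:
  assumes s: "cartesian C f i f' i'" "f \<in> R" "i \<in> Fc" and s': "cartesian C f' j f'' j'" "j \<in> Fc"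
    and A: "A \<in> obj (D (tgt C f))"
  shows "\<delta> f (i *[C] j) f'' (i' *[C] j') A *[D (src C f'')] coh Fl j' i' (ob (V\<langle>f\<rangle>) A) =
          ar (V\<langle>f''\<rangle>) (coh Fl j i A) *[D (src C f'')]
            (\<delta> f' j f'' j' (ob (Fl\<langle>i\<rangle>) A) *[D (src C f'')] ar (Fl\<langle>j'\<rangle>) (\<delta> f i f' i' A))"
proof -
  obtain X Y X' Y' where t: "src C f = X" "tgt C f = Y" "src C f' = X'" "tgt C f' = Y'"
    "src C i = Y'" "tgt C i = Y" "src C i' = X'" "tgt C i' = X" "f' \<in> R" "i' \<in> Fc"
    by (rule V.square[OF s])
  obtain X'' Y'' where t': "src C f'' = X''" "tgt C f'' = Y''"
    "src C j = Y''" "tgt C j = Y'" "src C j' = X''" "tgt C j' = X'" "f'' \<in> R" "j' \<in> Fc" "X'' \<in> obj C"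
    using V.square[OF s'(1) t(9) s'(2)] t by metis
  interpret Q: category "D X''" using V.D_category t' by simp
  note arrC = V.Fl.R_arr
  have ij: "src C (i *[C] j) = Y''" "tgt C (i *[C] j) = Y" "i *[C] j \<in> Fc"
    "src C (i' *[C] j') = X''" "tgt C (i' *[C] j') = X" "i' *[C] j' \<in> Fc"
    using V.Fl.R_cmp[OF s'(2) s(3)] V.Fl.R_cmp[OF t'(8) t(10)] V.cmp_arr[OF arrC[OF s'(2)] arrC[OF s(3)]]
      V.cmp_arr[OF arrC[OF t'(8)] arrC[OF t(10)]] t t' by simp_all
  note c = V.cartesian_horizontal[OF s(1) s'(1)]
  note sq = conjugate_square(1)[OF s] conjugate_square(1)[OF s'(1) t(9) s'(2)]
    conjugate_square(1)[OF c s(2) ij(3)]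
  note sqW = W.base_changeD(1)[OF \<gamma> s] W.base_changeD(1)[OF \<gamma> s'(1) t(9) s'(2)]
    W.base_changeD(1)[OF \<gamma> c s(2) ij(3)]
  note sqs = sq[unfolded t t', THEN nat_isoD(1)] sqW[unfolded t t', THEN nat_isoD(1)]
  note rel = conjugate_square(2)[OF s, unfolded t] conjugate_square(2)[OF s'(1) t(9) s'(2), unfolded t t']
    conjugate_square(2)[OF c s(2) ij(3), unfolded t t']
  have isos: "nat_iso (D Y) (D X) (V\<langle>f\<rangle>) (W\<langle>f\<rangle>) (\<mu> f)" "nat_iso (D Y') (D X') (V\<langle>f'\<rangle>) (W\<langle>f'\<rangle>) (\<mu> f')"
    "nat_iso (D Y'') (D X'') (V\<langle>f''\<rangle>) (W\<langle>f''\<rangle>) (\<mu> f'')"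
    using strict_isoD(1)[OF \<mu>] s(2) t t' by simp_all
  note \<mu>s = isos[THEN nat_isoD(1)]
  have FFl: "is_functor (D Y) (D Y') (Fl\<langle>i\<rangle>)" "is_functor (D X) (D X') (Fl\<langle>i'\<rangle>)"
    "is_functor (D Y') (D Y'') (Fl\<langle>j\<rangle>)" "is_functor (D X') (D X'') (Fl\<langle>j'\<rangle>)"
    "is_functor (D Y) (D Y'') (Fl\<langle>i *[C] j\<rangle>)" "is_functor (D X) (D X'') (Fl\<langle>i' *[C] j'\<rangle>)"
    using V.Fl.pull s s' t t' ij by simp_all
  note coh = V.Fl.coh_nat[OF s'(2) s(3) t'(3,4) t(5,6), THEN nat_isoD(1)]
    V.Fl.coh_nat[OF t'(8) t(10) t'(5,6) t(7,8), THEN nat_isoD(1)]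
  note ty = A[unfolded t] comp_functor_simps FFl[THEN functor_typing]
    \<mu>s[THEN nat_transD(1), THEN functor_typing]
    \<mu>s[THEN nat_transD(2), THEN functor_typing]
    \<mu>s[THEN nat_trans_typing]
    sqs[THEN nat_trans_typing]
    coh[THEN nat_trans_typing]
  \<comment> \<open>After composition with \<open>\<mu> f''\<close> each \<delta> can be traded for
    a \<gamma>: 1, 4 and 5 are the defining relations, 2 and 6 naturality, 3 the transitivity of
    \<gamma>. At the end \<open>\<mu> f''\<close> is cancelled.\<close>
  have 1: "\<mu> f'' (ob (Fl\<langle>i *[C] j\<rangle>) A) *[D X''] \<delta> f (i *[C] j) f'' (i' *[C] j') A =
      \<gamma> f (i *[C] j) f'' (i' *[C] j') A *[D X''] ar (Fl\<langle>i' *[C] j'\<rangle>) (\<mu> f A)"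
    by (simp add: rel ty)
  have 2: "ar (Fl\<langle>i' *[C] j'\<rangle>) (\<mu> f A) *[D X''] coh Fl j' i' (ob (V\<langle>f\<rangle>) A) =
      coh Fl j' i' (ob (W\<langle>f\<rangle>) A) *[D X''] ar (Fl\<langle>j'\<rangle>) (ar (Fl\<langle>i'\<rangle>) (\<mu> f A))"
    using nat_trans_natural[OF coh(2), of "\<mu> f A"] by (simp add: ty)
  have 3: "\<gamma> f (i *[C] j) f'' (i' *[C] j') A *[D X''] coh Fl j' i' (ob (W\<langle>f\<rangle>) A) =
      ar (W\<langle>f''\<rangle>) (coh Fl j i A) *[D X'']
            (\<gamma> f' j f'' j' (ob (Fl\<langle>i\<rangle>) A) *[D X''] ar (Fl\<langle>j'\<rangle>) (\<gamma> f i f' i' A))"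
    using W.base_changeD(2)[OF \<gamma> s s' A] by (simp add: t')
  have 4: "ar (Fl\<langle>j'\<rangle>) (\<gamma> f i f' i' A) *[D X''] ar (Fl\<langle>j'\<rangle>) (ar (Fl\<langle>i'\<rangle>) (\<mu> f A)) =
      ar (Fl\<langle>j'\<rangle>) (\<mu> f' (ob (Fl\<langle>i\<rangle>) A)) *[D X''] ar (Fl\<langle>j'\<rangle>) (\<delta> f i f' i' A)"
    by (simp add: functor_cmp[OF FFl(4), symmetric] ty rel)
  have 5: "\<gamma> f' j f'' j' (ob (Fl\<langle>i\<rangle>) A) *[D X''] ar (Fl\<langle>j'\<rangle>) (\<mu> f' (ob (Fl\<langle>i\<rangle>) A)) =
      \<mu> f'' (ob (Fl\<langle>j\<rangle>) (ob (Fl\<langle>i\<rangle>) A)) *[D X''] \<delta> f' j f'' j' (ob (Fl\<langle>i\<rangle>) A)"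
    by (simp add: rel ty)
  have 6: "ar (W\<langle>f''\<rangle>) (coh Fl j i A) *[D X''] \<mu> f'' (ob (Fl\<langle>j\<rangle>) (ob (Fl\<langle>i\<rangle>) A)) =
      \<mu> f'' (ob (Fl\<langle>i *[C] j\<rangle>) A) *[D X''] ar (V\<langle>f''\<rangle>) (coh Fl j i A)"
    using nat_trans_natural[OF \<mu>s(3), of "coh Fl j i A"] by (simp add: ty)
  have "\<mu> f'' (ob (Fl\<langle>i *[C] j\<rangle>) A) *[D X''] (\<delta> f (i *[C] j) f'' (i' *[C] j') A *[D X''] coh Fl j' i' (ob (V\<langle>f\<rangle>) A)) =
      \<mu> f'' (ob (Fl\<langle>i *[C] j\<rangle>) A) *[D X''] (ar (V\<langle>f''\<rangle>) (coh Fl j i A) *[D X'']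
            (\<delta> f' j f'' j' (ob (Fl\<langle>i\<rangle>) A) *[D X''] ar (Fl\<langle>j'\<rangle>) (\<delta> f i f' i' A)))"
    by (simp add: Q.cat_simps ty Q.reassoc[OF 1] 2 Q.reassoc[OF 3] 4 Q.reassoc[OF 5] Q.reassoc[OF 6])
  then show ?thesis unfolding t t'
    by (rule Q.iso_left_cancel) (simp_all add: nat_isoD(2)[OF isos(3)] Q.cat_simps ty)
qed

text \<open>The coherence maps of \<open>V\<close> and \<open>W\<close> differ, so besides
  transitivity of \<gamma> the multiplicativity of \<mu> is needed twice: for the base maps
  (equation 2) and for their base changes (equation 5).\<close>

lemma conjugate_vertical:
  assumes s: "cartesian C f i f' i'" "f \<in> R" "i \<in> Fc" and s': "cartesian C g i' g' i''" "g \<in> R"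
    and A: "A \<in> obj (D (tgt C f))"
  shows "\<delta> (f *[C] g) i (f' *[C] g') i'' A *[D (src C g')] ar (Fl\<langle>i''\<rangle>) (coh V g f A) =
          coh V g' f' (ob (Fl\<langle>i\<rangle>) A) *[D (src C g')]
            (ar (V\<langle>g'\<rangle>) (\<delta> f i f' i' A) *[D (src C g')] \<delta> g i' g' i'' (ob (V\<langle>f\<rangle>) A))"
proof -
  obtain X Y X' Y' where t: "src C f = X" "tgt C f = Y" "src C f' = X'" "tgt C f' = Y'"
    "src C i = Y'" "tgt C i = Y" "src C i' = X'" "tgt C i' = X" "f' \<in> R" "i' \<in> Fc"
    by (rule V.square[OF s])
  obtain X1 X1' where t': "src C g = X1" "tgt C g = X" "src C g' = X1'" "tgt C g' = X'"
    "src C i'' = X1'" "tgt C i'' = X1" "g' \<in> R" "i'' \<in> Fc" "X1' \<in> obj C"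
    using V.square[OF s'(1) s'(2) t(10)] t by metis
  interpret Q: category "D X1'" using V.D_category t' by simp
  note arrC = V.R_arr
  have fg: "src C (f *[C] g) = X1" "tgt C (f *[C] g) = Y" "f *[C] g \<in> R"
    "src C (f' *[C] g') = X1'" "tgt C (f' *[C] g') = Y'" "f' *[C] g' \<in> R"
    using V.R_cmp[OF s'(2) s(2)] V.R_cmp[OF t'(7) t(9)] V.cmp_arr[OF arrC[OF s'(2)] arrC[OF s(2)]]
      V.cmp_arr[OF arrC[OF t'(7)] arrC[OF t(9)]] t t' by simp_all
  note c = V.cartesian_vertical[OF s(1) s'(1)]
  note sq = conjugate_square(1)[OF s] conjugate_square(1)[OF s' t(10)]
    conjugate_square(1)[OF c fg(3) s(3)]
  note sqW = W.base_changeD(1)[OF \<gamma> s] W.base_changeD(1)[OF \<gamma> s' t(10)]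
    W.base_changeD(1)[OF \<gamma> c fg(3) s(3)]
  note sqs = sq[unfolded t t' fg, THEN nat_isoD(1)] sqW[unfolded t t' fg, THEN nat_isoD(1)]
  note rel = conjugate_square(2)[OF s, unfolded t] conjugate_square(2)[OF s' t(10), unfolded t t']
    conjugate_square(2)[OF c fg(3) s(3), unfolded t t' fg]
  have isos: "nat_iso (D Y) (D X) (V\<langle>f\<rangle>) (W\<langle>f\<rangle>) (\<mu> f)" "nat_iso (D Y') (D X') (V\<langle>f'\<rangle>) (W\<langle>f'\<rangle>) (\<mu> f')"
    "nat_iso (D X) (D X1) (V\<langle>g\<rangle>) (W\<langle>g\<rangle>) (\<mu> g)" "nat_iso (D X') (D X1') (V\<langle>g'\<rangle>) (W\<langle>g'\<rangle>) (\<mu> g')"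
    "nat_iso (D Y) (D X1) (V\<langle>f *[C] g\<rangle>) (W\<langle>f *[C] g\<rangle>) (\<mu> (f *[C] g))"
    "nat_iso (D Y') (D X1') (V\<langle>f' *[C] g'\<rangle>) (W\<langle>f' *[C] g'\<rangle>) (\<mu> (f' *[C] g'))"
    using strict_isoD(1)[OF \<mu>] s(2) s'(2) t t' fg by simp_all
  note \<mu>s = isos[THEN nat_isoD(1)]
  have FFl: "is_functor (D Y) (D Y') (Fl\<langle>i\<rangle>)" "is_functor (D X) (D X') (Fl\<langle>i'\<rangle>)"
    "is_functor (D X1) (D X1') (Fl\<langle>i''\<rangle>)"
    using V.Fl.pull s s' t t' by simp_all
  note coh = V.coh_nat[OF s'(2) s(2) t'(1,2) t(1,2), THEN nat_isoD(1)]
    V.coh_nat[OF t'(7) t(9) t'(3,4) t(3,4), THEN nat_isoD(1)]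
    W.coh_nat[OF s'(2) s(2) t'(1,2) t(1,2), THEN nat_isoD(1)]
    W.coh_nat[OF t'(7) t(9) t'(3,4) t(3,4), THEN nat_isoD(1)]
  note ty = A[unfolded t] comp_functor_simps FFl[THEN functor_typing]
    \<mu>s[THEN nat_transD(1), THEN functor_typing]
    \<mu>s[THEN nat_transD(2), THEN functor_typing]
    \<mu>s[THEN nat_trans_typing]
    sqs[THEN nat_trans_typing]
    coh[THEN nat_trans_typing]
  note X1 = functor_category(2)[OF nat_transD(1)[OF \<mu>s(3)]]
  interpret X1: category "D X1" by (rule X1)
  have 1: "\<mu> (f' *[C] g') (ob (Fl\<langle>i\<rangle>) A) *[D X1'] \<delta> (f *[C] g) i (f' *[C] g') i'' A =
      \<gamma> (f *[C] g) i (f' *[C] g') i'' A *[D X1'] ar (Fl\<langle>i''\<rangle>) (\<mu> (f *[C] g) A)"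
    by (simp add: rel ty)
  have 2: "ar (Fl\<langle>i''\<rangle>) (\<mu> (f *[C] g) A) *[D X1'] ar (Fl\<langle>i''\<rangle>) (coh V g f A) =
      ar (Fl\<langle>i''\<rangle>) (coh W g f A) *[D X1'] (ar (Fl\<langle>i''\<rangle>) (ar (W\<langle>g\<rangle>) (\<mu> f A)) *[D X1']
        ar (Fl\<langle>i''\<rangle>) (\<mu> g (ob (V\<langle>f\<rangle>) A)))"
    using strict_isoD(2)[OF \<mu> s'(2) s(2) t'(1,2) t(1,2), of A]
    by (simp add: functor_cmp[OF FFl(3), symmetric] ty X1.cat_simps)
  have 3: "\<gamma> (f *[C] g) i (f' *[C] g') i'' A *[D X1'] ar (Fl\<langle>i''\<rangle>) (coh W g f A) =
          coh W g' f' (ob (Fl\<langle>i\<rangle>) A) *[D X1']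
            (ar (W\<langle>g'\<rangle>) (\<gamma> f i f' i' A) *[D X1'] \<gamma> g i' g' i'' (ob (W\<langle>f\<rangle>) A))"
    using W.base_changeD(3)[OF \<gamma> s s' A] by (simp add: t')
  have 4: "ar (W\<langle>g'\<rangle>) (\<mu> f' (ob (Fl\<langle>i\<rangle>) A)) *[D X1'] (\<mu> g' (ob (V\<langle>f'\<rangle>) (ob (Fl\<langle>i\<rangle>) A)) *[D X1']
      (ar (V\<langle>g'\<rangle>) (\<delta> f i f' i' A) *[D X1'] \<delta> g i' g' i'' (ob (V\<langle>f\<rangle>) A))) =
    ar (W\<langle>g'\<rangle>) (\<gamma> f i f' i' A) *[D X1'] (\<gamma> g i' g' i'' (ob (W\<langle>f\<rangle>) A) *[D X1']
      (ar (Fl\<langle>i''\<rangle>) (ar (W\<langle>g\<rangle>) (\<mu> f A)) *[D X1'] ar (Fl\<langle>i''\<rangle>) (\<mu> g (ob (V\<langle>f\<rangle>) A))))"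
    by (rule paste_conjugate[OF FFl \<mu>s(1,3,2,4) sqs(1,4,2,5) rel(1,2)]) (simp_all add: ty)
  have 5: "coh W g' f' (ob (Fl\<langle>i\<rangle>) A) *[D X1'] (ar (W\<langle>g'\<rangle>) (\<mu> f' (ob (Fl\<langle>i\<rangle>) A)) *[D X1']
      \<mu> g' (ob (V\<langle>f'\<rangle>) (ob (Fl\<langle>i\<rangle>) A))) =
      \<mu> (f' *[C] g') (ob (Fl\<langle>i\<rangle>) A) *[D X1'] coh V g' f' (ob (Fl\<langle>i\<rangle>) A)"
    by (rule strict_isoD(2)[OF \<mu> t'(7) t(9) t'(3,4) t(3,4)]) (simp add: ty)
  have "\<mu> (f' *[C] g') (ob (Fl\<langle>i\<rangle>) A) *[D X1'] (\<delta> (f *[C] g) i (f' *[C] g') i'' A *[D X1'] ar (Fl\<langle>i''\<rangle>) (coh V g f A)) =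
      coh W g' f' (ob (Fl\<langle>i\<rangle>) A) *[D X1'] (ar (W\<langle>g'\<rangle>) (\<gamma> f i f' i' A) *[D X1'] (\<gamma> g i' g' i'' (ob (W\<langle>f\<rangle>) A) *[D X1']
      (ar (Fl\<langle>i''\<rangle>) (ar (W\<langle>g\<rangle>) (\<mu> f A)) *[D X1'] ar (Fl\<langle>i''\<rangle>) (\<mu> g (ob (V\<langle>f\<rangle>) A)))))"
    by (simp add: Q.cat_simps ty Q.reassoc[OF 1] 2 Q.reassoc[OF 3])
  also have "\<dots> = (coh W g' f' (ob (Fl\<langle>i\<rangle>) A) *[D X1'] (ar (W\<langle>g'\<rangle>) (\<mu> f' (ob (Fl\<langle>i\<rangle>) A)) *[D X1']
      \<mu> g' (ob (V\<langle>f'\<rangle>) (ob (Fl\<langle>i\<rangle>) A)))) *[D X1'] (ar (V\<langle>g'\<rangle>) (\<delta> f i f' i' A) *[D X1'] \<delta> g i' g' i'' (ob (V\<langle>f\<rangle>) A))"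
    unfolding 4[symmetric] by (simp add: Q.cat_simps ty)
  also have "\<dots> = \<mu> (f' *[C] g') (ob (Fl\<langle>i\<rangle>) A) *[D X1'] (coh V g' f' (ob (Fl\<langle>i\<rangle>) A) *[D X1']
            (ar (V\<langle>g'\<rangle>) (\<delta> f i f' i' A) *[D X1'] \<delta> g i' g' i'' (ob (V\<langle>f\<rangle>) A)))"
    unfolding 5 by (simp add: Q.cat_simps ty)
  finally show ?thesis unfolding t t'
    by (rule Q.iso_left_cancel) (simp_all add: nat_isoD(2)[OF isos(6)] Q.cat_simps ty)
qed

lemma conjugate_base_change: "base_change C R Fc V Fl \<delta>"
  by (rule V.base_changeI) (fact conjugate_square(1) conjugate_horizontal conjugate_vertical)+

end

section \<open>Pasting squares vertically\<close>

lemma nat_iso_comp: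
  assumes "nat_iso A B F G \<sigma>" "nat_iso A B G H \<tau>"
  shows "nat_iso A B F H (\<lambda>x. \<tau> x *[B] \<sigma> x)"
proof -
  note s = nat_isoD(1)[OF assms(1)] and t = nat_isoD(1)[OF assms(2)]
  interpret A: category A using functor_category nat_transD(1)[OF s] by blast
  interpret B: category B using functor_category nat_transD(1)[OF s] by blast
  note ty = nat_transD(3-5)[OF s] nat_transD(3-5)[OF t] functor_simps[OF nat_transD(1)[OF s]]
    functor_simps[OF nat_transD(1)[OF t]] functor_simps[OF nat_transD(2)[OF t]] A.cat_simps B.cat_simps
  show ?thesis
  proof (intro nat_isoI nat_transI)
    fix m assume m: "m \<in> arr A"
    show "(\<tau> (tgt A m) *[B] \<sigma> (tgt A m)) *[B] ar F m = ar H m *[B] \<tau> (src A m) *[B] \<sigma> (src A m)"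
      using nat_trans_natural[OF s m refl refl] B.reassoc[OF nat_trans_natural[OF t m refl refl]] m
      by (simp add: ty)
  qed (use nat_transD[OF s] nat_transD[OF t] nat_isoD(2)[OF assms(1)] nat_isoD(2)[OF assms(2)]
      in \<open>auto simp: ty intro: B.iso_cmp\<close>)
qed

lemma nat_iso_whisker_left:
  assumes "nat_iso A B F G \<tau>" "is_functor B E H"
  shows "nat_iso A E (H \<circ>\<^sub>F F) (H \<circ>\<^sub>F G) (\<lambda>x. ar H (\<tau> x))"
proof -
  note t = nat_isoD(1)[OF assms(1)]
  interpret A: category A using functor_category nat_transD(1)[OF t] by blast
  note ty = nat_transD(3-5)[OF t] functor_simps[OF nat_transD(1)[OF t]]
    functor_simps[OF nat_transD(2)[OF t]] functor_simps[OF assms(2)] A.cat_simps comp_functor_simps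
  show ?thesis
  proof (intro nat_isoI nat_transI)
    fix m assume m: "m \<in> arr A"
    show "ar H (\<tau> (tgt A m)) *[E] ar (H \<circ>\<^sub>F F) m = ar (H \<circ>\<^sub>F G) m *[E] ar H (\<tau> (src A m))"
      using nat_trans_natural[OF t m refl refl] m
      by (simp add: ty functor_cmp[OF assms(2), symmetric])
  qed (use nat_transD[OF t] functor_comp[OF _ assms(2)] functor_iso(1)[OF assms(2) nat_isoD(2)[OF assms(1)]]
      in \<open>auto simp: ty\<close>)
qed

lemma nat_iso_whisker_right:
  assumes "nat_iso A B F G \<tau>" "is_functor Z A H"
  shows "nat_iso Z B (F \<circ>\<^sub>F H) (G \<circ>\<^sub>F H) (\<lambda>z. \<tau> (ob H z))"
proof -
  note t = nat_isoD(1)[OF assms(1)]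
  note ty = nat_transD(3-5)[OF t] functor_simps[OF nat_transD(1)[OF t]]
    functor_simps[OF nat_transD(2)[OF t]] functor_simps[OF assms(2)] comp_functor_simps
  show ?thesis
  proof (intro nat_isoI nat_transI)
    fix m assume m: "m \<in> arr Z"
    show "\<tau> (ob H (tgt Z m)) *[B] ar (F \<circ>\<^sub>F H) m = ar (G \<circ>\<^sub>F H) m *[B] \<tau> (ob H (src Z m))"
      using nat_trans_natural[OF t, of "ar H m"] m by (simp add: ty)
  qed (use functor_comp[OF assms(2)] nat_transD(1,2)[OF t] nat_isoD(2)[OF assms(1)] in \<open>auto simp: ty\<close>)
qed

lemma nat_iso_inverse:
  assumes "nat_iso A B F G \<tau>"
  shows "nat_iso A B G F (\<lambda>x. inv_arr B (\<tau> x))"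
proof -
  note t = nat_isoD(1)[OF assms(1)]
  interpret A: category A using functor_category nat_transD(1)[OF t] by blast
  interpret B: category B using functor_category nat_transD(1)[OF t] by blast
  note ty = nat_transD(3-5)[OF t] functor_simps[OF nat_transD(1)[OF t]]
    functor_simps[OF nat_transD(2)[OF t]] A.cat_simps B.cat_simps
  note i = nat_isoD(2)[OF assms]
  show ?thesis
  proof (intro nat_isoI nat_transI)
    fix m assume m: "m \<in> arr A"
    let ?x = "src A m" and ?y = "tgt A m"
    have xy: "?x \<in> obj A" "?y \<in> obj A" using m by (simp_all add: A.cat_simps)
    note ii = B.iso_simps[OF i[OF xy(1)]] B.iso_simps[OF i[OF xy(2)]]
      B.iso_cancel[OF i[OF xy(1)]] B.iso_cancel[OF i[OF xy(2)]]
    have "inv_arr B (\<tau> ?y) *[B] ar G m = inv_arr B (\<tau> ?y) *[B] ((ar G m *[B] \<tau> ?x) *[B] inv_arr B (\<tau> ?x))"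
      using m xy by (simp add: ty ii)
    also have "\<dots> = ar F m *[B] inv_arr B (\<tau> ?x)"
      unfolding nat_trans_natural[OF t m refl refl, symmetric] using m xy by (simp add: ty ii)
    finally show "inv_arr B (\<tau> ?y) *[B] ar G m = ar F m *[B] inv_arr B (\<tau> ?x)" .
  qed (use nat_transD(1,2)[OF t] B.iso_simps[OF i] B.iso_inv[OF i] in \<open>auto simp: ty\<close>)
qed

lemma nat_iso_cong:
  assumes "nat_iso A B F G \<sigma>" "\<And>x. x \<in> obj A \<Longrightarrow> \<sigma> x = \<tau> x"
  shows "nat_iso A B F G \<tau>"
proof -
  interpret A: category A using assms functor_category by (auto simp: nat_iso_def nat_trans_def)
  show ?thesis
    using assms by (auto simp: nat_iso_def nat_trans_def hom_def A.cat_simps)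
qed

lemma comp_functor_assoc: "H \<circ>\<^sub>F (G \<circ>\<^sub>F F) = H \<circ>\<^sub>F G \<circ>\<^sub>F F"
  by (simp add: comp_functor_def)

context flat_pseudo
begin

text \<open>\<open>a\<close> and \<open>b\<close> belong to the squares with base maps \<open>f\<close>, \<open>g\<close> and base-changed maps
  \<open>f'\<close>, \<open>g'\<close>; \<open>u\<close> and \<open>v\<close> are the outer flat maps.\<close>

definition paste :: "'a \<Rightarrow> 'a \<Rightarrow> 'a \<Rightarrow> 'a \<Rightarrow> 'a \<Rightarrow> 'a \<Rightarrow> ('b \<Rightarrow> 'c) \<Rightarrow> ('b \<Rightarrow> 'c) \<Rightarrow> 'b \<Rightarrow> 'c" where
  "paste f f' u g g' v a b A =
     coh V g' f' (ob (Fl\<langle>u\<rangle>) A) *[D (src C g')]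
       (ar (V\<langle>g'\<rangle>) (a A) *[D (src C g')]
         (b (ob (V\<langle>f\<rangle>) A) *[D (src C g')] inv_arr (D (src C g')) (ar (Fl\<langle>v\<rangle>) (coh V g f A))))"

abbreviation bc :: "'a \<Rightarrow> 'a \<Rightarrow> 'a \<Rightarrow> 'a \<Rightarrow> ('b \<Rightarrow> 'c) \<Rightarrow> bool" where
  "bc f u f' u' a \<equiv> nat_iso (D (tgt C f)) (D (src C f')) (Fl\<langle>u'\<rangle> \<circ>\<^sub>F V\<langle>f\<rangle>) (V\<langle>f'\<rangle> \<circ>\<^sub>F Fl\<langle>u\<rangle>) a"

text \<open>The paste is a composite of four whiskered isomorphisms, made so that the equation of
  vertical transitivity holds; that equation, for an arbitrary pair \<open>a\<close>,
  \<open>b\<close>, is the second claim.\<close>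

lemma paste_iso:
  assumes s: "cartesian C f u f' u'" "f \<in> R" "u \<in> Fc" and s': "cartesian C g u' g' u''" "g \<in> R"
    and a: "bc f u f' u' a" and b: "bc g u' g' u'' b"
  shows "bc (f *[C] g) u (f' *[C] g') u'' (paste f f' u g g' u'' a b)"
    and "A \<in> obj (D (tgt C f)) \<Longrightarrow>
      paste f f' u g g' u'' a b A *[D (src C g')] ar (Fl\<langle>u''\<rangle>) (coh V g f A) =
      coh V g' f' (ob (Fl\<langle>u\<rangle>) A) *[D (src C g')]
        (ar (V\<langle>g'\<rangle>) (a A) *[D (src C g')] b (ob (V\<langle>f\<rangle>) A))"
proof -
  obtain X Y X' Y' where t: "src C f = X" "tgt C f = Y" "src C f' = X'" "tgt C f' = Y'"
    "src C u = Y'" "tgt C u = Y" "src C u' = X'" "tgt C u' = X" "f' \<in> R" "u' \<in> Fc"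
    by (rule square[OF s])
  obtain X1 X1' where t': "src C g = X1" "tgt C g = X" "src C g' = X1'" "tgt C g' = X'"
    "src C u'' = X1'" "tgt C u'' = X1" "g' \<in> R" "u'' \<in> Fc" "X1' \<in> obj C"
    using square[OF s'(1) s'(2) t(10)] t by metis
  interpret Q: category "D X1'" using D_category t' by simp
  have fg: "src C (f *[C] g) = X1" "tgt C (f *[C] g) = Y"
    "src C (f' *[C] g') = X1'" "tgt C (f' *[C] g') = Y'"
    using cmp_arr[OF R_arr[OF s'(2)] R_arr[OF s(2)]] cmp_arr[OF R_arr[OF t'(7)] R_arr[OF t(9)]] t t'
    by simp_all
  note c = coh_nat[OF s'(2) s(2) t'(1,2) t(1,2)] and c' = coh_nat[OF t'(7) t(9) t'(3,4) t(3,4)]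
  note U = Fl.pull[OF s(3) t(5,6)] and U'' = Fl.pull[OF t'(8,5,6)]
  note 1 = nat_iso_inverse[OF nat_iso_whisker_left[OF c U''], unfolded comp_functor_assoc]
  note 2 = nat_iso_whisker_right[OF b[unfolded t t'] pull[OF s(2) t(1,2)], unfolded comp_functor_assoc]
  note 3 = nat_iso_whisker_left[OF a[unfolded t t'] pull[OF t'(7,3,4)], unfolded comp_functor_assoc]
  note 4 = nat_iso_whisker_right[OF c' U, unfolded comp_functor_assoc]
  show "bc (f *[C] g) u (f' *[C] g') u'' (paste f f' u g g' u'' a b)"
    using nat_iso_comp[OF nat_iso_comp[OF nat_iso_comp[OF 1 2] 3] 4] unfolding paste_def fg t'(3) .
  note ns = c[THEN nat_isoD(1)] c'[THEN nat_isoD(1)] a[unfolded t t', THEN nat_isoD(1)] b[unfolded t t', THEN nat_isoD(1)]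
  note ty = functor_simps[OF U] functor_simps[OF U''] functor_simps[OF pull[OF s(2) t(1,2)]]
    functor_simps[OF pull[OF t'(7,3,4)]] ns[THEN nat_trans_typing] comp_functor_simps Q.cat_simps
  show "paste f f' u g g' u'' a b A *[D (src C g')] ar (Fl\<langle>u''\<rangle>) (coh V g f A) =
      coh V g' f' (ob (Fl\<langle>u\<rangle>) A) *[D (src C g')]
        (ar (V\<langle>g'\<rangle>) (a A) *[D (src C g')] b (ob (V\<langle>f\<rangle>) A))" if "A \<in> obj (D (tgt C f))"
  proof -
    have A: "A \<in> obj (D Y)" using that t by simp
    note i = functor_iso(1)[OF U'' nat_isoD(2)[OF c A]]
    show ?thesis unfolding paste_def t' by (simp add: ty A Q.iso_simps[OF i])
  qed
qed

text \<open>A coherence map stays invertible under \<open>Fl\<langle>u''\<rangle>\<close>, so the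
  equation of vertical transitivity determines the paste. Pastes are identified later by verifying
  this equation.\<close>

lemma paste_eqI:
  assumes s: "cartesian C f u f' u'" "f \<in> R" "u \<in> Fc" and s': "cartesian C g u' g' u''" "g \<in> R"
    and a: "bc f u f' u' a" and b: "bc g u' g' u'' b"
    and A: "A \<in> obj (D (tgt C f))"
    and x: "x \<in> arr (D (src C g'))" "src (D (src C g')) x = ob (Fl\<langle>u''\<rangle>) (ob (V\<langle>f *[C] g\<rangle>) A)"
    and e: "x *[D (src C g')] ar (Fl\<langle>u''\<rangle>) (coh V g f A) =
      coh V g' f' (ob (Fl\<langle>u\<rangle>) A) *[D (src C g')]
        (ar (V\<langle>g'\<rangle>) (a A) *[D (src C g')] b (ob (V\<langle>f\<rangle>) A))"
  shows "paste f f' u g g' u'' a b A = x"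
proof -
  obtain X Y X' Y' where t: "src C f = X" "tgt C f = Y" "src C f' = X'" "tgt C f' = Y'"
    "src C u = Y'" "tgt C u = Y" "src C u' = X'" "tgt C u' = X" "f' \<in> R" "u' \<in> Fc"
    by (rule square[OF s])
  obtain X1 X1' where t': "src C g = X1" "tgt C g = X" "src C g' = X1'" "tgt C g' = X'"
    "src C u'' = X1'" "tgt C u'' = X1" "g' \<in> R" "u'' \<in> Fc" "X1' \<in> obj C"
    using square[OF s'(1) s'(2) t(10)] t by metis
  interpret Q: category "D X1'" using D_category t' by simp
  have fg: "src C (f *[C] g) = X1" "tgt C (f *[C] g) = Y"
    "src C (f' *[C] g') = X1'" "tgt C (f' *[C] g') = Y'"
    using cmp_arr[OF R_arr[OF s'(2)] R_arr[OF s(2)]] cmp_arr[OF R_arr[OF t'(7)] R_arr[OF t(9)]] t t'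
    by simp_all
  note c = coh_nat[OF s'(2) s(2) t'(1,2) t(1,2)]
  have AY: "A \<in> obj (D Y)" using A t by simp
  note U'' = Fl.pull[OF t'(8,5,6)]
  note i = functor_iso(1)[OF U'' nat_isoD(2)[OF c AY]]
  note p = nat_isoD(1)[OF paste_iso(1)[OF s s' a b], unfolded fg]
  have "paste f f' u g g' u'' a b A *[D X1'] ar (Fl\<langle>u''\<rangle>) (coh V g f A) =
      x *[D X1'] ar (Fl\<langle>u''\<rangle>) (coh V g f A)"
    using e paste_iso(2)[OF s s' a b A] unfolding t' by simp
  then show ?thesis
    by (rule Q.iso_right_cancel[OF _ i])
      (simp_all add: x[unfolded t'] AY functor_simps[OF U''] nat_transD(3-5)[OF nat_isoD(1)[OF c]]
        nat_transD(3-5)[OF p] comp_functor_simps)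
qed

text \<open>Each side reduces to the same product of \<open>a\<close>, \<open>b\<close>,
  \<open>c\<close> together with coherence maps. The difference between the coherence maps is
  removed by associativity, used once for the base-changed maps (equation 4) and once for the base
  maps (equation 5).\<close>

lemma paste_assoc:
  assumes s: "cartesian C f u f' u'" "f \<in> R" "u \<in> Fc" and s': "cartesian C g u' g' u''" "g \<in> R"
    and s'': "cartesian C h u'' h' w" "h \<in> R"
    and a: "bc f u f' u' a" and b: "bc g u' g' u'' b" and c: "bc h u'' h' w c"
    and A: "A \<in> obj (D (tgt C f))"
  shows "paste (f *[C] g) (f' *[C] g') u h h' w (paste f f' u g g' u'' a b) c A =
    paste f f' u (g *[C] h) (g' *[C] h') w a (paste g g' u' h h' w b c) A"
proof -
  obtain X Y X' Y' where t: "src C f = X" "tgt C f = Y" "src C f' = X'" "tgt C f' = Y'"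
    "src C u = Y'" "tgt C u = Y" "src C u' = X'" "tgt C u' = X" "f' \<in> R" "u' \<in> Fc"
    by (rule square[OF s])
  obtain X1 X1' where t': "src C g = X1" "tgt C g = X" "src C g' = X1'" "tgt C g' = X'"
    "src C u'' = X1'" "tgt C u'' = X1" "g' \<in> R" "u'' \<in> Fc"
    using square[OF s'(1) s'(2) t(10)] t by metis
  obtain X2 X2' where t'': "src C h = X2" "tgt C h = X1" "src C h' = X2'" "tgt C h' = X1'"
    "src C w = X2'" "tgt C w = X2" "h' \<in> R" "w \<in> Fc" "X2' \<in> obj C" "X2 \<in> obj C"
    using square[OF s''(1) s''(2) t'(8)] t' by metis
  interpret Q: category "D X2'" using D_category t'' by simp
  interpret Q1: category "D X2" using D_category t'' by simp
  note cs = cmp_arr[OF R_arr R_arr]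
  have fg: "src C (f *[C] g) = X1" "tgt C (f *[C] g) = Y" "f *[C] g \<in> R"
    "src C (f' *[C] g') = X1'" "tgt C (f' *[C] g') = Y'" "f' *[C] g' \<in> R"
    "src C (g *[C] h) = X2" "tgt C (g *[C] h) = X" "g *[C] h \<in> R"
    "src C (g' *[C] h') = X2'" "tgt C (g' *[C] h') = X'" "g' *[C] h' \<in> R"
    using R_cmp cs s(2) s'(2) s''(2) t(1-4,9) t'(1-4,7) t''(1-4,7) by simp_all
  have as: "(f *[C] g) *[C] h = f *[C] (g *[C] h)"
    using R_arr s(2) s'(2) s''(2) t(1-4,9) t'(1-4,7) t''(1-4,7) by (simp add: cmp_assoc)
  have as': "(f' *[C] g') *[C] h' = f' *[C] (g' *[C] h')"
    using R_arr t(1-4,9) t'(1-4,7) t''(1-4,7) by (simp add: cmp_assoc)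
  note c1 = cartesian_vertical[OF s(1) s'(1)] and c2 = cartesian_vertical[OF s'(1) s''(1)]
  note pfg = paste_iso[OF s s' a b] and pgh = paste_iso[OF s'(1,2) t(10) s'' b c]
  note p1 = paste_iso[OF c1 fg(3) s(3) s'' pfg(1) c]
  note p2 = paste_iso[OF s c2 fg(9) a pgh(1)]
  have AY: "A \<in> obj (D Y)" using A t by simp
  note all = t t' t'' fg
  have Fs: "is_functor (D Y) (D X) (V\<langle>f\<rangle>)" "is_functor (D X) (D X1) (V\<langle>g\<rangle>)" "is_functor (D X1) (D X2) (V\<langle>h\<rangle>)"
    "is_functor (D Y') (D X') (V\<langle>f'\<rangle>)" "is_functor (D X') (D X1') (V\<langle>g'\<rangle>)" "is_functor (D X1') (D X2') (V\<langle>h'\<rangle>)"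
    "is_functor (D Y) (D X1) (V\<langle>f *[C] g\<rangle>)" "is_functor (D X) (D X2) (V\<langle>g *[C] h\<rangle>)"
    "is_functor (D Y') (D X1') (V\<langle>f' *[C] g'\<rangle>)" "is_functor (D X') (D X2') (V\<langle>g' *[C] h'\<rangle>)"
    "is_functor (D Y) (D Y') (Fl\<langle>u\<rangle>)" "is_functor (D X) (D X') (Fl\<langle>u'\<rangle>)" "is_functor (D X1) (D X1') (Fl\<langle>u''\<rangle>)"
    "is_functor (D X2) (D X2') (Fl\<langle>w\<rangle>)"
    using pull Fl.pull s s' s'' all by simp_all
  have ch: "nat_iso (D Y) (D X1) (V\<langle>g\<rangle> \<circ>\<^sub>F V\<langle>f\<rangle>) (V\<langle>f *[C] g\<rangle>) (coh V g f)"
    "nat_iso (D Y') (D X1') (V\<langle>g'\<rangle> \<circ>\<^sub>F V\<langle>f'\<rangle>) (V\<langle>f' *[C] g'\<rangle>) (coh V g' f')"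
    "nat_iso (D X) (D X2) (V\<langle>h\<rangle> \<circ>\<^sub>F V\<langle>g\<rangle>) (V\<langle>g *[C] h\<rangle>) (coh V h g)"
    "nat_iso (D X') (D X2') (V\<langle>h'\<rangle> \<circ>\<^sub>F V\<langle>g'\<rangle>) (V\<langle>g' *[C] h'\<rangle>) (coh V h' g')"
    "nat_iso (D Y) (D X2) (V\<langle>h\<rangle> \<circ>\<^sub>F V\<langle>f *[C] g\<rangle>) (V\<langle>(f *[C] g) *[C] h\<rangle>) (coh V h (f *[C] g))"
    "nat_iso (D Y) (D X2) (V\<langle>g *[C] h\<rangle> \<circ>\<^sub>F V\<langle>f\<rangle>) (V\<langle>f *[C] (g *[C] h)\<rangle>) (coh V (g *[C] h) f)"
    "nat_iso (D Y') (D X2') (V\<langle>h'\<rangle> \<circ>\<^sub>F V\<langle>f' *[C] g'\<rangle>) (V\<langle>(f' *[C] g') *[C] h'\<rangle>) (coh V h' (f' *[C] g'))"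
    "nat_iso (D Y') (D X2') (V\<langle>g' *[C] h'\<rangle> \<circ>\<^sub>F V\<langle>f'\<rangle>) (V\<langle>f' *[C] (g' *[C] h')\<rangle>) (coh V (g' *[C] h') f')"
    using coh_nat s s' s'' all by simp_all
  have src3: "src C (f' *[C] (g' *[C] h')) = X2'" "tgt C (f *[C] (g *[C] h)) = Y"
    using cs s(2) all by simp_all
  note chn = ch[unfolded as as', THEN nat_isoD(1)]
  note sqn = a[unfolded all, THEN nat_isoD(1)] b[unfolded all, THEN nat_isoD(1)] c[unfolded all, THEN nat_isoD(1)]
    pfg(1)[unfolded all, THEN nat_isoD(1)] pgh(1)[unfolded all, THEN nat_isoD(1)]
    p1(1)[unfolded as as' src3, unfolded all, THEN nat_isoD(1)] p2(1)[unfolded src3, THEN nat_isoD(1)]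
  note ty = AY comp_functor_simps Fs[THEN functor_typing]
    sqn[THEN nat_trans_typing]
    chn[THEN nat_trans_typing]
  let ?uA = "ob (Fl\<langle>u\<rangle>) A" and ?fA = "ob (V\<langle>f\<rangle>) A"
  let ?ab = "paste f f' u g g' u'' a b" and ?bc = "paste g g' u' h h' w b c"
  let ?p1 = "paste (f *[C] g) (f' *[C] g') u h h' w ?ab c A"
  let ?p2 = "paste f f' u (g *[C] h) (g' *[C] h') w a ?bc A"
  have 1: "?p1 *[D X2'] ar (Fl\<langle>w\<rangle>) (coh V h (f *[C] g) A) =
      coh V h' (f' *[C] g') ?uA *[D X2'] (ar (V\<langle>h'\<rangle>) (?ab A) *[D X2'] c (ob (V\<langle>f *[C] g\<rangle>) A))"
    using p1(2)[of A] AY by (simp add: all)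
  have 2: "c (ob (V\<langle>f *[C] g\<rangle>) A) *[D X2'] ar (Fl\<langle>w\<rangle>) (ar (V\<langle>h\<rangle>) (coh V g f A)) =
      ar (V\<langle>h'\<rangle>) (ar (Fl\<langle>u''\<rangle>) (coh V g f A)) *[D X2'] c (ob (V\<langle>g\<rangle>) ?fA)"
    using nat_trans_natural[OF sqn(3), of "coh V g f A"] by (simp add: ty)
  have 3: "ar (V\<langle>h'\<rangle>) (?ab A) *[D X2'] ar (V\<langle>h'\<rangle>) (ar (Fl\<langle>u''\<rangle>) (coh V g f A)) =
      ar (V\<langle>h'\<rangle>) (coh V g' f' ?uA) *[D X2'] (ar (V\<langle>h'\<rangle>) (ar (V\<langle>g'\<rangle>) (a A)) *[D X2'] ar (V\<langle>h'\<rangle>) (b ?fA))"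
  proof -
    interpret Q': category "D X1'" using functor_category[OF Fs(6)] by simp
    show ?thesis using pfg(2)[of A] AY
      by (simp add: functor_cmp[OF Fs(6), symmetric] all ty Q'.cat_simps)
  qed
  have 4: "coh V h' (f' *[C] g') ?uA *[D X2'] ar (V\<langle>h'\<rangle>) (coh V g' f' ?uA) =
      coh V (g' *[C] h') f' ?uA *[D X2'] coh V h' g' (ob (V\<langle>f'\<rangle>) ?uA)"
    using coh_associative[OF t''(7) t'(7) t(9) t''(3,4) t'(3,4) t(3,4), of ?uA] by (simp add: ty)
  have 5: "ar (Fl\<langle>w\<rangle>) (coh V (g *[C] h) f A) *[D X2'] ar (Fl\<langle>w\<rangle>) (coh V h g ?fA) =
      ar (Fl\<langle>w\<rangle>) (coh V h (f *[C] g) A) *[D X2'] ar (Fl\<langle>w\<rangle>) (ar (V\<langle>h\<rangle>) (coh V g f A))"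
    using coh_associative[OF s''(2) s'(2) s(2) t''(1,2) t'(1,2) t(1,2) AY]
    by (simp add: functor_cmp[OF Fs(14), symmetric] ty Q1.cat_simps)
  have 6: "?p2 *[D X2'] ar (Fl\<langle>w\<rangle>) (coh V (g *[C] h) f A) =
      coh V (g' *[C] h') f' ?uA *[D X2'] (ar (V\<langle>g' *[C] h'\<rangle>) (a A) *[D X2'] ?bc ?fA)"
    using p2(2)[of A] AY by (simp add: all)
  have 7: "?bc ?fA *[D X2'] ar (Fl\<langle>w\<rangle>) (coh V h g ?fA) =
      coh V h' g' (ob (Fl\<langle>u'\<rangle>) ?fA) *[D X2'] (ar (V\<langle>h'\<rangle>) (b ?fA) *[D X2'] c (ob (V\<langle>g\<rangle>) ?fA))"
    using pgh(2)[of ?fA] by (simp add: all ty)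
  have 8: "ar (V\<langle>g' *[C] h'\<rangle>) (a A) *[D X2'] coh V h' g' (ob (Fl\<langle>u'\<rangle>) ?fA) =
      coh V h' g' (ob (V\<langle>f'\<rangle>) ?uA) *[D X2'] ar (V\<langle>h'\<rangle>) (ar (V\<langle>g'\<rangle>) (a A))"
    using nat_trans_natural[OF chn(4), of "a A"] by (simp add: ty)
  \<comment> \<open>The coherence of the triple base map \<open>f g h\<close>, in one of the two
    ways of writing it; the other way is 5. Since \<open>?e\<close> is invertible, the pastes may be
    compared after composition with it.\<close>
  let ?e = "ar (Fl\<langle>w\<rangle>) (coh V h (f *[C] g) A) *[D X2'] ar (Fl\<langle>w\<rangle>) (ar (V\<langle>h\<rangle>) (coh V g f A))"
  have "?p1 *[D X2'] ?e = coh V (g' *[C] h') f' ?uA *[D X2'] (coh V h' g' (ob (V\<langle>f'\<rangle>) ?uA) *[D X2']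
      (ar (V\<langle>h'\<rangle>) (ar (V\<langle>g'\<rangle>) (a A)) *[D X2'] (ar (V\<langle>h'\<rangle>) (b ?fA) *[D X2'] c (ob (V\<langle>g\<rangle>) ?fA))))"
    by (simp add: Q.cat_simps ty Q.reassoc[OF 1] 2 Q.reassoc[OF 3] Q.reassoc[OF 4] as')
  also have "\<dots> = ?p2 *[D X2'] ?e"
    unfolding 5[symmetric]
    by (simp add: Q.cat_simps ty Q.reassoc[OF 6] 7 Q.reassoc[OF 8])
  finally show ?thesis
  proof (rule Q.iso_right_cancel)
    have i: "iso_arr (D X2') (ar (Fl\<langle>w\<rangle>) (coh V h (f *[C] g) A))"
      "iso_arr (D X2') (ar (Fl\<langle>w\<rangle>) (ar (V\<langle>h\<rangle>) (coh V g f A)))"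
      by (rule functor_iso(1)[OF Fs(14)] functor_iso(1)[OF Fs(3)] nat_isoD(2)[OF ch(5) AY] nat_isoD(2)[OF ch(1) AY])+
    show "iso_arr (D X2') ?e" by (rule Q.iso_cmp[OF i(2,1)]) (simp add: ty)
  qed (simp_all add: Q.cat_simps ty)
qed

text \<open>The coherence maps that occur have an identity arrow as one argument and are identities,
  since pseudofunctors are normalised.\<close>

lemma paste_ide:
  assumes s: "cartesian C f u f' u'" "f \<in> R" "u \<in> Fc" and a: "bc f u f' u' a"
    and A: "A \<in> obj (D (tgt C f))"
  shows "(\<And>B. B \<in> obj (D (tgt C f)) \<Longrightarrow> e B = ide (D (src C u)) (ob (Fl\<langle>u\<rangle>) B)) \<Longrightarrow>
      paste (ide C (tgt C u)) (ide C (src C u)) u f f' u' e a A = a A"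
    and "(\<And>B. B \<in> obj (D (src C f)) \<Longrightarrow> e B = ide (D (src C u')) (ob (Fl\<langle>u'\<rangle>) B)) \<Longrightarrow>
      paste f f' u (ide C (tgt C u')) (ide C (src C u')) u' a e A = a A"
proof -
  obtain X Y X' Y' where t: "src C f = X" "tgt C f = Y" "src C f' = X'" "tgt C f' = Y'"
    "src C u = Y'" "tgt C u = Y" "src C u' = X'" "tgt C u' = X" "f' \<in> R" "u' \<in> Fc"
    "X \<in> obj C" "Y \<in> obj C" "X' \<in> obj C" "Y' \<in> obj C"
    by (rule square[OF s])
  interpret Q: category "D X'" using D_category t by simp
  interpret X: category "D X" using D_category t by simp
  have AY: "A \<in> obj (D Y)" using A t by simp
  note Fs = pull[OF s(2) t(1,2)] pull[OF t(9) t(3,4)] Fl.pull[OF s(3) t(5,6)] Fl.pull[OF t(10,7,8)]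
  note n = a[unfolded t, THEN nat_isoD(1)]
  note ty = AY comp_functor_simps Fs[THEN functor_typing] Fs[THEN functor_simps(5)] nat_transD(3-5)[OF n]
  have inv: "inv_arr (D X') (ide (D X') B) = ide (D X') B" if "B \<in> obj (D X')" for B
    by (rule Q.inv_arr_eq) (use that in \<open>simp add: inverse_arrows_def hom_def Q.cat_simps\<close>)
  note ci = coh_ide[OF s(2) t(1,2) AY] coh_ide[OF t(9) t(3,4), of "ob (Fl\<langle>u\<rangle>) A"]
  show "paste (ide C (tgt C u)) (ide C (src C u)) u f f' u' e a A = a A"
    if "\<And>B. B \<in> obj (D (tgt C f)) \<Longrightarrow> e B = ide (D (src C u)) (ob (Fl\<langle>u\<rangle>) B)"
    using that[of A] AY ci pull_ide(1)[OF t(12), of A]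
    by (simp add: paste_def t ty inv Q.cat_simps)
  show "paste f f' u (ide C (tgt C u')) (ide C (src C u')) u' a e A = a A"
    if "\<And>B. B \<in> obj (D (src C f)) \<Longrightarrow> e B = ide (D (src C u')) (ob (Fl\<langle>u'\<rangle>) B)"
    using that[of "ob (V\<langle>f\<rangle>) A"] ci pull_ide(2)[OF t(13), of "a A"]
    by (simp add: paste_def t ty inv Q.cat_simps ide_arr)
qed

end

section \<open>Generated subcategories\<close>

lemma (in category) generated_subcategory:
  assumes "G \<subseteq> arr C"
  shows "subcategory C (generated_subcategory C G)" "G \<subseteq> generated_subcategory C G"
proof -
  have "subcategory C (arr C)"
    unfolding subcategory_def by (auto simp: cat_simps)
  then have "generated_subcategory C G \<subseteq> arr C" using assms by (auto simp: generated_subcategory_def)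
  then show "subcategory C (generated_subcategory C G)"
    unfolding subcategory_def generated_subcategory_def by blast
qed (auto simp: generated_subcategory_def)

text \<open>The arrows of the generated subcategory that satisfy \<open>P\<close> form a subcategory
  containing \<open>G\<close>. Identities belong to \<open>G\<close> by hypothesis and need no case
  of their own; staying inside the generated subcategory gives the case \<open>cmp\<close> its
  membership hypotheses.\<close>

lemma (in category) generated_induct [consumes 1, case_names arr ide generator cmp]:
  assumes "f \<in> generated_subcategory C G"
    and "G \<subseteq> arr C"
    and "\<And>X. X \<in> obj C \<Longrightarrow> ide C X \<in> G"
    and "\<And>f. f \<in> G \<Longrightarrow> P f"
    and "\<And>f g. \<lbrakk>f \<in> generated_subcategory C G; P f; g \<in> generated_subcategory C G; P g;
      tgt C g = src C f\<rbrakk> \<Longrightarrow> P (f *[C] g)"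
  shows "P f"
proof -
  let ?S = "{f \<in> generated_subcategory C G. P f}"
  note gen = generated_subcategory[OF assms(2)]
  have "subcategory C ?S"
    unfolding subcategory_def
  proof (intro conjI ballI impI)
    show "?S \<subseteq> arr C" using subcategoryD(1)[OF gen(1)] by blast
    fix f assume "f \<in> ?S"
    then have f: "f \<in> arr C" using subcategoryD(1)[OF gen(1)] by blast
    then show "ide C (src C f) \<in> ?S" "ide C (tgt C f) \<in> ?S"
      using assms(3,4) gen(2) by (auto simp: cat_simps)
    fix g assume "g \<in> ?S" "tgt C f = src C g"
    then show "g *[C] f \<in> ?S" using \<open>f \<in> ?S\<close> assms(5) subcategoryD(2)[OF gen(1)] by blast
  qed
  moreover have "G \<subseteq> ?S" using gen(2) assms(4) by blast
  ultimately have "generated_subcategory C G \<subseteq> ?S" by (auto simp: generated_subcategory_def)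
  then show ?thesis using assms(1) by blast
qed

text \<open>The inverse of vertical pasting, with a prescribed square on the first factor. It makes
  induction over \<open>Q\<close> possible for statements about all squares over an arrow, including
  their projections.\<close>

lemma (in category) cartesian_split:
  assumes "cartesian C (f *[C] g) u h w" "cartesian C f u f' u'" "g \<in> arr C" "tgt C g = src C f"
  shows "\<exists>g'. cartesian C g u' g' w \<and> h = f' *[C] g'"
proof -
  note c = cartesianD[OF assms(1)] and d = cartesianD[OF assms(2)]
  have w: "tgt C w = src C g" using c(8) d(1) assms(3,4) by (simp add: cat_simps)
  have e: "f *[C] (g *[C] w) = u *[C] h"
    using cartesian_commute[OF assms(1)] c(4) d(1) w assms(3,4) by (simp add: cat_simps)
  have "\<exists>t. t \<in> arr C \<and> src C t = src C (g *[C] w) \<and> tgt C t = src C f' \<and>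
      u' *[C] t = g *[C] w \<and> f' *[C] t = h"
    by (rule cartesian_factor[OF assms(2) _ _ _ _ _ e])
      (simp_all add: cat_simps c(3,4,6,7) w assms(3,4))
  then obtain t where t: "t \<in> arr C" "tgt C t = src C f'" "g *[C] w = u' *[C] t" "h = f' *[C] t"
    by auto
  have "cartesian C g u' t w"
    by (rule cartesian_vertical_cancel[OF assms(2) assms(1)[unfolded t(4)] assms(3,4) t(1,2,3)])
  then show ?thesis using t(4) by blast
qed

text \<open>Existence and stability go through one induction: to see that the projections of a
  square over a composite lie in the right classes, a square over the first factor must exist along
  which to split it.\<close>

lemma (in category) generated_base_change:
  assumes "f \<in> generated_subcategory C G" "G \<subseteq> arr C" "\<And>X. X \<in> obj C \<Longrightarrow> ide C X \<in> G"
    and "\<And>f u. \<lbrakk>f \<in> G; u \<in> Fc; tgt C u = tgt C f\<rbrakk> \<Longrightarrow> \<exists>f' u'. cartesian C f u f' u'"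
    and "\<And>f u f' u'. \<lbrakk>cartesian C f u f' u'; f \<in> G; u \<in> Fc\<rbrakk> \<Longrightarrow> f' \<in> G \<and> u' \<in> Fc"
  shows "u \<in> Fc \<Longrightarrow> tgt C u = tgt C f \<Longrightarrow> \<exists>f' u'. cartesian C f u f' u'"
    and "cartesian C f u f' u' \<Longrightarrow> u \<in> Fc \<Longrightarrow> f' \<in> generated_subcategory C G \<and> u' \<in> Fc"
proof -
  note gen = generated_subcategory[OF assms(2)]
  have "(\<forall>u\<in>Fc. tgt C u = tgt C f \<longrightarrow> (\<exists>f' u'. cartesian C f u f' u')) \<and>
    (\<forall>u f' u'. cartesian C f u f' u' \<longrightarrow> u \<in> Fc \<longrightarrow> f' \<in> generated_subcategory C G \<and> u' \<in> Fc)"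
    using assms(1)
  proof (induction rule: generated_induct)
    case arr show ?case by fact
  next
    case (ide X) then show ?case by (rule assms(3))
  next
    case (generator f)
    show ?case using assms(4)[OF generator] assms(5)[OF _ generator] gen(2) by blast
  next
    case (cmp f g)
    have fa: "f \<in> arr C" and ga: "g \<in> arr C" using cmp.hyps subcategoryD(1)[OF gen(1)] by auto
    have fgt: "tgt C (f *[C] g) = tgt C f" using fa ga cmp.hyps(3) by (simp add: cat_simps)
    show ?case
    proof (intro conjI ballI allI impI)
      fix u assume "u \<in> Fc" "tgt C u = tgt C (f *[C] g)"
      with cmp.IH(1) fgt obtain f' u' where 1: "cartesian C f u f' u'" "u' \<in> Fc" by metis
      then have "tgt C u' = tgt C g" using cartesianD(8)[OF 1(1)] cmp.hyps(3) by simp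
      with cmp.IH(2) 1 obtain g' w where "cartesian C g u' g' w" by blast
      from cartesian_vertical[OF 1(1) this] show "\<exists>f' u'. cartesian C (f *[C] g) u f' u'" by blast
    next
      fix u h w assume h: "cartesian C (f *[C] g) u h w" "u \<in> Fc"
      have "tgt C u = tgt C f" using cartesianD(5)[OF h(1)] fgt by simp
      with cmp.IH(1) h(2) obtain f' u' where 1: "cartesian C f u f' u'" "u' \<in> Fc" "f' \<in> generated_subcategory C G" by metis
      from cartesian_split[OF h(1) 1(1) ga cmp.hyps(3)]
      obtain g' where 2: "cartesian C g u' g' w" "h = f' *[C] g'" by blast
      then have "g' \<in> generated_subcategory C G" "w \<in> Fc" using cmp.IH(2) 1(2) by blast+
      moreover have "tgt C g' = src C f'" using cartesianD(6)[OF 1(1)] cartesianD(7)[OF 2(1)] by simp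
      ultimately show "h \<in> generated_subcategory C G" "w \<in> Fc"
        using subcategoryD(2)[OF gen(1)] 1(3) 2(2) by blast+
    qed
  qed
  then show "u \<in> Fc \<Longrightarrow> tgt C u = tgt C f \<Longrightarrow> \<exists>f' u'. cartesian C f u f' u'"
    and "cartesian C f u f' u' \<Longrightarrow> u \<in> Fc \<Longrightarrow> f' \<in> generated_subcategory C G \<and> u' \<in> Fc" by blast+
qed

lemma (in category) subcat_category:
  assumes "subcategory C S" "\<And>X. X \<in> obj C \<Longrightarrow> ide C X \<in> S"
  shows "category (subcat C S)"
proof -
  have o: "obj (subcat C S) = obj C" using assms(2) by (auto simp: subcat_def)
  note s = subcategoryD[OF assms(1)]
  show ?thesis
    by unfold_locales (use assms(2) in \<open>auto simp: o subcat_simps hom_def cat_simps s\<close>)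
qed

text \<open>A cover lives on all of \<open>Q\<close>, whereas the given base change isomorphisms
  concern only \<open>P\<close> or \<open>O\<close>.\<close>

lemma (in pseudo_on) restrict:
  assumes "subcategory C S" "S \<subseteq> R" "\<And>X. X \<in> obj C \<Longrightarrow> ide C X \<in> S"
  shows "pseudo_on C S V D"
proof (rule pseudo_on.intro[OF category_axioms pseudo_on_axioms.intro])
  have o: "obj (subcat C S) = obj C" using assms(3) by (auto simp: subcat_def)
  have h: "f \<in> hom (subcat C R) X Y" if "f \<in> hom (subcat C S) X Y" for f X Y
    using that assms(2) by (auto simp: hom_def subcat_simps)
  interpret S: category "subcat C S" by (rule subcat_category[OF assms(1,3)])
  interpret P: pseudofunctor "subcat C R" V by (rule pseudo)
  have "pseudofunctor_axioms (subcat C S) V"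
    using P.pcat_category P.pfun_functor[OF h] P.coh_iso[OF h h] P.coh_assoc[OF h h h] P.pfun_ide
      P.coh_ide_left[OF h] P.coh_ide_right[OF h]
    unfolding pseudofunctor_axioms_def o obj_sub subcat_simps by simp
  then show "pseudofunctor (subcat C S) V" by (simp add: pseudofunctor_def S.category_axioms)
qed (use assms pcat_eq in auto)

section \<open>The category of cartesian squares over flat arrows\<close>

text \<open>The square over \<open>f\<close> is an arrow from the flat projection \<open>u'\<close>
  to the flat map \<open>u\<close>, so two squares compose exactly when they share a flat side.
  Quadruples that are not squares are harmless values outside \<open>arr\<close>.\<close>

definition sq_cat :: "('o, 'a) cat \<Rightarrow> 'a set \<Rightarrow> ('a, 'a \<times> 'a \<times> 'a \<times> 'a) cat" where
  "sq_cat C Fc = \<lparr>obj = Fc,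
     arr = {(f, u, f', u'). cartesian C f u f' u' \<and> u \<in> Fc \<and> u' \<in> Fc},
     src = (\<lambda>(f, u, f', u'). u'), tgt = (\<lambda>(f, u, f', u'). u),
     ide = (\<lambda>u. (ide C (tgt C u), u, ide C (src C u), u)),
     cmp = (\<lambda>(f, u, f', u') (g, v, g', v'). (f *[C] g, u, f' *[C] g', v'))\<rparr>"

lemma sq_cat_simps:
  "obj (sq_cat C Fc) = Fc"
  "(f, u, f', u') \<in> arr (sq_cat C Fc) \<longleftrightarrow> cartesian C f u f' u' \<and> u \<in> Fc \<and> u' \<in> Fc"
  "src (sq_cat C Fc) (f, u, f', u') = u'" "tgt (sq_cat C Fc) (f, u, f', u') = u"
  "ide (sq_cat C Fc) u = (ide C (tgt C u), u, ide C (src C u), u)"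
  "(f, u, f', u') *[sq_cat C Fc] (g, v, g', v') = (f *[C] g, u, f' *[C] g', v')"
  by (simp_all add: sq_cat_def)

context category
begin

lemma cartesian_composable:
  assumes "cartesian C f u f' u'" "cartesian C g u' g' u''"
  shows "f \<in> arr C" "g \<in> arr C" "f' \<in> arr C" "g' \<in> arr C" "tgt C g = src C f" "tgt C g' = src C f'"
  using cartesianD[OF assms(1)] cartesianD[OF assms(2)] by simp_all

lemma sq_category:
  assumes F: "Fc \<subseteq> arr C"
  shows "category (sq_cat C Fc)"
proof
  fix p assume "p \<in> arr (sq_cat C Fc)"
  then show "src (sq_cat C Fc) p \<in> obj (sq_cat C Fc)" "tgt (sq_cat C Fc) p \<in> obj (sq_cat C Fc)"
    by (cases p; simp add: sq_cat_simps)+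
next
  fix u assume "u \<in> obj (sq_cat C Fc)"
  then show "ide (sq_cat C Fc) u \<in> hom (sq_cat C Fc) u u"
    using F cartesian_ide by (auto simp: sq_cat_simps hom_def)
next
  fix p q u v w assume "p \<in> hom (sq_cat C Fc) u v" "q \<in> hom (sq_cat C Fc) v w"
  then show "q *[sq_cat C Fc] p \<in> hom (sq_cat C Fc) u w"
    by (cases p; cases q) (auto simp: hom_def sq_cat_simps intro: cartesian_vertical)
next
  fix p u v assume "p \<in> hom (sq_cat C Fc) u v"
  then obtain f f' where p: "p = (f, v, f', u)" "cartesian C f v f' u"
    by (cases p) (auto simp: hom_def sq_cat_simps)
  note c = cartesianD[OF p(2)]
  show "p *[sq_cat C Fc] ide (sq_cat C Fc) u = p" "ide (sq_cat C Fc) v *[sq_cat C Fc] p = p"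
    using c by (simp_all add: p sq_cat_simps cmp_ide)
next
  fix p q r u v w x
  assume "p \<in> hom (sq_cat C Fc) u v" "q \<in> hom (sq_cat C Fc) v w" "r \<in> hom (sq_cat C Fc) w x"
  then obtain f f' g g' h h' where p: "p = (f, v, f', u)" "cartesian C f v f' u"
      "q = (g, w, g', v)" "cartesian C g w g' v" "r = (h, x, h', w)" "cartesian C h x h' w"
    by (cases p; cases q; cases r) (auto simp: hom_def sq_cat_simps)
  show "r *[sq_cat C Fc] (q *[sq_cat C Fc] p) = (r *[sq_cat C Fc] q) *[sq_cat C Fc] p"
    using cartesian_composable[OF p(4,2)] cartesian_composable[OF p(6,4)]
    by (simp add: p sq_cat_simps cmp_assoc)
qed

text \<open>The outer square over \<open>f g2 = g f2\<close> is split along the face of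
  \<open>g\<close>, which yields \<open>f1\<close>; the last face then follows by horizontal
  cancellation.\<close>

lemma cube_exists:
  assumes "cartesian C f u f3 u2" "cartesian C g u g3 u3" "cartesian C f g f2 g2" "cartesian C g2 u2 g1 u1"
  shows "\<exists>f1. cartesian C f2 u3 f1 u1 \<and> cartesian C f3 g3 f1 g1"
proof -
  note a = cartesianD[OF assms(1)] and b = cartesianD[OF assms(2)] and c = cartesianD[OF assms(3)]
    and d = cartesianD[OF assms(4)]
  have 1: "cartesian C (g *[C] f2) u (f3 *[C] g1) u1"
    using cartesian_vertical[OF assms(1,4)] cartesian_commute[OF assms(3)] by simp
  have f2: "tgt C f2 = src C g" using c by simp
  obtain f1 where f1: "cartesian C f2 u3 f1 u1" "f3 *[C] g1 = g3 *[C] f1"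
    using cartesian_split[OF 1 assms(2) c(3) f2] by blast
  note e = cartesianD[OF f1(1)]
  have ug: "u *[C] g3 = g *[C] u3" using cartesian_commute[OF assms(2)] by simp
  have "cartesian C f (g *[C] u3) f1 (g2 *[C] u1)"
    by (rule cartesian_horizontal[OF assms(3) f1(1)])
  then have 2: "cartesian C f (u *[C] g3) f1 (u2 *[C] g1)"
    using ug cartesian_commute[OF assms(4)] by simp
  have "cartesian C f3 g3 f1 g1"
    by (rule cartesian_horizontal_cancel[OF assms(1) 2]) (use a b d f1(2) in simp_all)
  with f1 show ?thesis by blast
qed

text \<open>A cube all of whose faces are cartesian is a fibre product in the category of squares.
  The universal property is used in the face of \<open>f\<close>, \<open>g\<close> and in the
  opposite face of \<open>f3\<close>, \<open>g3\<close>.\<close>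

lemma sq_cartesian:
  assumes "cartesian C f u f3 u2" "cartesian C g u g3 u3" "cartesian C f g f2 g2"
    "cartesian C g2 u2 g1 u1" "cartesian C f2 u3 f1 u1" "cartesian C f3 g3 f1 g1"
    and Fc: "u \<in> Fc" "u1 \<in> Fc" "u2 \<in> Fc" "u3 \<in> Fc" and "Fc \<subseteq> arr C"
  shows "cartesian (sq_cat C Fc) (f, u, f3, u2) (g, u, g3, u3) (f2, u3, f1, u1) (g2, u2, g1, u1)"
proof -
  interpret S: category "sq_cat C Fc" by (rule sq_category) fact
  note c1 = cartesianD[OF assms(1)] and c2 = cartesianD[OF assms(2)] and c3 = cartesianD[OF assms(3)]
    and c4 = cartesianD[OF assms(4)] and c5 = cartesianD[OF assms(5)] and c6 = cartesianD[OF assms(6)]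
  show ?thesis
  proof (rule S.cartesianI)
    show "(f, u, f3, u2) *[sq_cat C Fc] (g2, u2, g1, u1) = (g, u, g3, u3) *[sq_cat C Fc] (f2, u3, f1, u1)"
      using cartesian_commute[OF assms(3)] cartesian_commute[OF assms(6)] by (simp add: sq_cat_simps)
  next
    fix p q
    assume "p \<in> arr (sq_cat C Fc)" "q \<in> arr (sq_cat C Fc)" "src (sq_cat C Fc) q = src (sq_cat C Fc) p"
      "tgt (sq_cat C Fc) p = src (sq_cat C Fc) (f, u, f3, u2)"
      "tgt (sq_cat C Fc) q = src (sq_cat C Fc) (g, u, g3, u3)"
      "(f, u, f3, u2) *[sq_cat C Fc] p = (g, u, g3, u3) *[sq_cat C Fc] q"
    then obtain a a' b b' w where pq: "p = (a, u2, a', w)" "q = (b, u3, b', w)" "w \<in> Fc"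
      "cartesian C a u2 a' w" "cartesian C b u3 b' w" "f *[C] a = g *[C] b" "f3 *[C] a' = g3 *[C] b'"
      by (cases p; cases q) (auto simp: sq_cat_simps)
    note ca = cartesianD[OF pq(4)] and cb = cartesianD[OF pq(5)]
    have ab: "src C a = src C b" "src C a' = src C b'"
      using ca(8) cb(8) ca(6) cb(6) by simp_all
    have ty: "tgt C a = src C f" "tgt C b = src C g" "tgt C a' = src C f3" "tgt C b' = src C g3"
      using c1(6,8) c2(6,8) ca(5,7) cb(5,7) by simp_all
    from cartesian_factor[OF assms(3) ca(1) cb(1) ab(1) ty(1,2) pq(6)] obtain t where
      t: "t \<in> arr C" "src C t = src C a" "tgt C t = src C f2" "g2 *[C] t = a" "f2 *[C] t = b" by blast
    from cartesian_factor[OF assms(6) ca(3) cb(3) ab(2) ty(3,4) pq(7)] obtain t' where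
      t': "t' \<in> arr C" "src C t' = src C a'" "tgt C t' = src C f1" "g1 *[C] t' = a'" "f1 *[C] t' = b'" by blast
    have tw: "tgt C w = src C t" "src C w = src C t'" using t t' ca by simp_all
    have tg: "tgt C t = src C g2" "tgt C t' = src C g1" using t(3) t'(3) c3(6) c6(6) by simp_all
    have u1: "src C u1 = src C f1" "tgt C u1 = src C f2" using c5 by simp_all
    \<comment> \<open>The two factorizations were found independently, in opposite faces. Uniqueness
      in the first face makes them sides of a commuting square, which is then cartesian by
      cancellation and so an arrow of \<open>sq_cat\<close>.\<close>
    have e: "t *[C] w = u1 *[C] t'"
    proof (rule cartesian_unique[OF assms(3)])
      have "g2 *[C] (t *[C] w) = a *[C] w"
        using reassoc[OF t(4)] t(1) tg(1) tw(1) c3(4) ca(4) by simp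
      also have "\<dots> = u2 *[C] (g1 *[C] t')" using cartesian_commute[OF pq(4)] t'(4) by simp
      also have "\<dots> = (u2 *[C] g1) *[C] t'" using c4 t'(1) tg(2) by (simp add: cmp_assoc)
      also have "\<dots> = g2 *[C] (u1 *[C] t')"
        unfolding cartesian_commute[OF assms(4), symmetric] using c4 t'(1) tg(2) by (simp add: cmp_assoc)
      finally show "g2 *[C] (t *[C] w) = g2 *[C] (u1 *[C] t')" .
      have "f2 *[C] (t *[C] w) = b *[C] w"
        using reassoc[OF t(5)] t(1,3) tw(1) c3(3) ca(4) by simp
      also have "\<dots> = u3 *[C] (f1 *[C] t')" using cartesian_commute[OF pq(5)] t'(5) by simp
      also have "\<dots> = (u3 *[C] f1) *[C] t'" using c5 t'(1,3) by (simp add: cmp_assoc)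
      also have "\<dots> = f2 *[C] (u1 *[C] t')"
        unfolding cartesian_commute[OF assms(5), symmetric] using c5 t'(1,3) by (simp add: cmp_assoc)
      finally show "f2 *[C] (t *[C] w) = f2 *[C] (u1 *[C] t')" .
    qed (simp_all add: cat_simps t t' tw u1 ca c5)
    have "cartesian C t u1 t' w"
      by (rule cartesian_vertical_cancel[OF assms(4)])
        (use pq(4) t(1,4) t'(1,4) tg e in simp_all)
    then show "\<exists>t. t \<in> arr (sq_cat C Fc) \<and> src (sq_cat C Fc) t = src (sq_cat C Fc) p \<and>
        tgt (sq_cat C Fc) t = src (sq_cat C Fc) (f2, u3, f1, u1) \<and>
        (g2, u2, g1, u1) *[sq_cat C Fc] t = p \<and> (f2, u3, f1, u1) *[sq_cat C Fc] t = q"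
      by (intro exI[of _ "(t, u1, t', w)"]) (simp add: sq_cat_simps pq(1-3) Fc t(4,5) t'(4,5))
  next
    fix p q
    assume h: "p \<in> arr (sq_cat C Fc)" "q \<in> arr (sq_cat C Fc)" "src (sq_cat C Fc) p = src (sq_cat C Fc) q"
      "tgt (sq_cat C Fc) p = src (sq_cat C Fc) (f2, u3, f1, u1)"
      "tgt (sq_cat C Fc) q = src (sq_cat C Fc) (f2, u3, f1, u1)"
      "(g2, u2, g1, u1) *[sq_cat C Fc] p = (g2, u2, g1, u1) *[sq_cat C Fc] q"
      "(f2, u3, f1, u1) *[sq_cat C Fc] p = (f2, u3, f1, u1) *[sq_cat C Fc] q"
    then obtain a a' b b' w where pq: "p = (a, u1, a', w)" "q = (b, u1, b', w)"
      "cartesian C a u1 a' w" "cartesian C b u1 b' w" "g2 *[C] a = g2 *[C] b" "g1 *[C] a' = g1 *[C] b'"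
      "f2 *[C] a = f2 *[C] b" "f1 *[C] a' = f1 *[C] b'"
      by (cases p; cases q) (auto simp: sq_cat_simps)
    note ca = cartesianD[OF pq(3)] and cb = cartesianD[OF pq(4)]
    have "a = b"
      by (rule cartesian_unique[OF assms(3) ca(1) cb(1) _ _ _ pq(5,7)])
        (use ca(5,8) cb(5,8) c5(8) in simp_all)
    moreover have "a' = b'"
      by (rule cartesian_unique[OF assms(6) ca(3) cb(3) _ _ _ pq(6,8)])
        (use ca(6,7) cb(6,7) c5(6) in simp_all)
    ultimately show "p = q" using pq by simp
  qed (simp_all add: sq_cat_simps assms Fc)
qed

end

section \<open>Horizontal transitivity along composites, and the category of base change
  isomorphisms\<close>

context flat_pseudo
begin

text \<open>Horizontal transitivity over one fixed \<open>f\<close>, isolated so that it can serve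
  as the predicate of an induction over \<open>Q\<close>.\<close>

definition hor where
  "hor \<gamma> f \<longleftrightarrow> (\<forall>i f' i' j f'' j'. cartesian C f i f' i' \<longrightarrow> i \<in> Fc \<longrightarrow> cartesian C f' j f'' j' \<longrightarrow> j \<in> Fc \<longrightarrow>
     (\<forall>A\<in>obj (D (tgt C f)).
        \<gamma> f (i *[C] j) f'' (i' *[C] j') A *[D (src C f'')] coh Fl j' i' (ob (V\<langle>f\<rangle>) A) =
          ar (V\<langle>f''\<rangle>) (coh Fl j i A) *[D (src C f'')]
            (\<gamma> f' j f'' j' (ob (Fl\<langle>i\<rangle>) A) *[D (src C f'')] ar (Fl\<langle>j'\<rangle>) (\<gamma> f i f' i' A))))"

text \<open>An interchange argument. The two adjacent squares over \<open>f g\<close> are cut into a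
  grid of four; vertical transitivity holds along both columns and for the outer square, so the
  claim reduces to the two rows, which are the hypotheses on \<open>f\<close> and
  \<open>g\<close>.\<close>

lemma hor_cmp:
  assumes \<gamma>: "\<And>f u f' u'. \<lbrakk>cartesian C f u f' u'; f \<in> R; u \<in> Fc\<rbrakk> \<Longrightarrow> bc f u f' u' (\<gamma> f u f' u')"
    and ver: "\<And>f i f' i' g g' i'' A. \<lbrakk>cartesian C f i f' i'; f \<in> R; i \<in> Fc;
        cartesian C g i' g' i''; g \<in> R; A \<in> obj (D (tgt C f))\<rbrakk>
      \<Longrightarrow> \<gamma> (f *[C] g) i (f' *[C] g') i'' A *[D (src C g')] ar (Fl\<langle>i''\<rangle>) (coh V g f A) =
          coh V g' f' (ob (Fl\<langle>i\<rangle>) A) *[D (src C g')]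
            (ar (V\<langle>g'\<rangle>) (\<gamma> f i f' i' A) *[D (src C g')] \<gamma> g i' g' i'' (ob (V\<langle>f\<rangle>) A))"
    and ex: "\<And>u. \<lbrakk>u \<in> Fc; tgt C u = tgt C f\<rbrakk> \<Longrightarrow> \<exists>f' u'. cartesian C f u f' u'"
    and f: "f \<in> R" "hor \<gamma> f" and g: "g \<in> R" "hor \<gamma> g" and fg: "tgt C g = src C f"
  shows "hor \<gamma> (f *[C] g)"
  unfolding hor_def
proof (intro allI impI ballI)
  fix i k i'' j l j'' A
  assume h: "cartesian C (f *[C] g) i k i''" "i \<in> Fc" "cartesian C k j l j''" "j \<in> Fc"
    and A0: "A \<in> obj (D (tgt C (f *[C] g)))"
  note fa = R_arr[OF f(1)] and ga = R_arr[OF g(1)]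
  have ti: "tgt C i = tgt C f" using cartesianD(5)[OF h(1)] fa ga fg by (simp add: cat_simps)
  obtain f' i' where s1: "cartesian C f i f' i'" using ex[OF h(2) ti] by blast
  obtain g' where s2: "cartesian C g i' g' i''" and k: "k = f' *[C] g'"
    using cartesian_split[OF h(1) s1 ga fg] by blast
  obtain X Y X' Y' where t: "src C f = X" "tgt C f = Y" "src C f' = X'" "tgt C f' = Y'"
    "src C i = Y'" "tgt C i = Y" "src C i' = X'" "tgt C i' = X" "f' \<in> R" "i' \<in> Fc"
    by (rule square[OF s1 f(1) h(2)])
  obtain X1 X1' where t1: "src C g = X1" "tgt C g = X" "src C g' = X1'" "tgt C g' = X'"
    "src C i'' = X1'" "tgt C i'' = X1" "g' \<in> R" "i'' \<in> Fc"
    using square[OF s2 g(1) t(10)] t by metis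
  have tj: "tgt C j = Y'"
    using cartesianD(5)[OF h(3)] cmp_arr[OF R_arr[OF t1(7)] R_arr[OF t(9)]] t t1 k by simp
  have ij: "i *[C] j \<in> Fc" "tgt C (i *[C] j) = Y"
    using Fl.R_cmp[OF h(4,2)] cmp_arr[OF Fl.R_arr[OF h(4)] Fl.R_arr[OF h(2)]] tj t by simp_all
  \<comment> \<open>Existence of squares is available over \<open>f\<close> only, so the square over
    \<open>f'\<close> and \<open>j\<close> is cut out of one over \<open>f\<close> and
    \<open>i j\<close>.\<close>
  obtain f'' w where s3': "cartesian C f (i *[C] j) f'' w" using ex[OF ij(1)] ij(2) t by auto
  have tji: "tgt C j = src C i" using tj t by simp
  obtain j' where s3: "cartesian C f' j f'' j'"
    using cartesian_split[OF cartesian_sym[OF s3'] cartesian_sym[OF s1] Fl.R_arr[OF h(4)] tji] cartesian_sym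
    by blast
  have tg': "tgt C g' = src C f'" using t t1 by simp
  obtain g'' where s4: "cartesian C g' j' g'' j''" and l: "l = f'' *[C] g''"
    using cartesian_split[OF h(3)[unfolded k] s3 R_arr[OF t1(7)] tg'] by blast
  obtain X2 Y2 where t2: "src C f'' = X2" "tgt C f'' = Y2" "src C j = Y2" "tgt C j = Y'"
    "src C j' = X2" "tgt C j' = X'" "f'' \<in> R" "j' \<in> Fc"
    using square[OF s3 t(9) h(4)] t by metis
  obtain X3 where t3: "src C g'' = X3" "tgt C g'' = X2" "src C j'' = X3" "tgt C j'' = X1'"
    "g'' \<in> R" "j'' \<in> Fc" "X3 \<in> obj C"
    using square[OF s4 t1(7) t2(8)] t1 t2 by metis
  have cc: "f *[C] g \<in> R" "src C (f *[C] g) = X1" "tgt C (f *[C] g) = Y"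
    "f' *[C] g' \<in> R" "src C (f' *[C] g') = X1'" "tgt C (f' *[C] g') = Y'"
    "f'' *[C] g'' \<in> R" "src C (f'' *[C] g'') = X3" "tgt C (f'' *[C] g'') = Y2"
    using cmp_arr[OF R_arr R_arr] R_cmp f(1) g(1) t(1-4,9) t1(1-4,7) t2(1,2,7) t3(1,2,5) by simp_all
  have dd: "src C (i *[C] j) = Y2" "i' *[C] j' \<in> Fc" "src C (i' *[C] j') = X2" "tgt C (i' *[C] j') = X"
    "i'' *[C] j'' \<in> Fc" "src C (i'' *[C] j'') = X3" "tgt C (i'' *[C] j'') = X1"
    using cmp_arr[OF Fl.R_arr Fl.R_arr] Fl.R_cmp h(2,4) t(5-8,10) t1(5,6,8) t2(3-6,8) t3(3,4,6) by simp_all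
  note all = t t1 t2 t3 cc dd ij
  note h12 = cartesian_horizontal[OF s1 s3] and h34 = cartesian_horizontal[OF s2 s4]
    and v12 = cartesian_vertical[OF s1 s2] and v34 = cartesian_vertical[OF s3 s4]
  note vv = cartesian_horizontal[OF v12 v34]
  have Fs: "is_functor (D Y) (D X) (V\<langle>f\<rangle>)" "is_functor (D X) (D X1) (V\<langle>g\<rangle>)" "is_functor (D Y) (D X1) (V\<langle>f *[C] g\<rangle>)"
    "is_functor (D Y') (D X') (V\<langle>f'\<rangle>)" "is_functor (D X') (D X1') (V\<langle>g'\<rangle>)" "is_functor (D Y') (D X1') (V\<langle>f' *[C] g'\<rangle>)"
    "is_functor (D Y2) (D X2) (V\<langle>f''\<rangle>)" "is_functor (D X2) (D X3) (V\<langle>g''\<rangle>)" "is_functor (D Y2) (D X3) (V\<langle>f'' *[C] g''\<rangle>)"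
    using pull all f(1) g(1) by simp_all
  have Us: "is_functor (D Y) (D Y') (Fl\<langle>i\<rangle>)" "is_functor (D X) (D X') (Fl\<langle>i'\<rangle>)" "is_functor (D X1) (D X1') (Fl\<langle>i''\<rangle>)"
    "is_functor (D Y') (D Y2) (Fl\<langle>j\<rangle>)" "is_functor (D X') (D X2) (Fl\<langle>j'\<rangle>)" "is_functor (D X1') (D X3) (Fl\<langle>j''\<rangle>)"
    "is_functor (D Y) (D Y2) (Fl\<langle>i *[C] j\<rangle>)" "is_functor (D X) (D X2) (Fl\<langle>i' *[C] j'\<rangle>)"
    "is_functor (D X1) (D X3) (Fl\<langle>i'' *[C] j''\<rangle>)"
    using Fl.pull all h(2,4) by simp_all
  have ch: "nat_iso (D Y) (D X1) (V\<langle>g\<rangle> \<circ>\<^sub>F V\<langle>f\<rangle>) (V\<langle>f *[C] g\<rangle>) (coh V g f)"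
    "nat_iso (D Y') (D X1') (V\<langle>g'\<rangle> \<circ>\<^sub>F V\<langle>f'\<rangle>) (V\<langle>f' *[C] g'\<rangle>) (coh V g' f')"
    "nat_iso (D Y2) (D X3) (V\<langle>g''\<rangle> \<circ>\<^sub>F V\<langle>f''\<rangle>) (V\<langle>f'' *[C] g''\<rangle>) (coh V g'' f'')"
    "nat_iso (D Y) (D Y2) (Fl\<langle>j\<rangle> \<circ>\<^sub>F Fl\<langle>i\<rangle>) (Fl\<langle>i *[C] j\<rangle>) (coh Fl j i)"
    "nat_iso (D X) (D X2) (Fl\<langle>j'\<rangle> \<circ>\<^sub>F Fl\<langle>i'\<rangle>) (Fl\<langle>i' *[C] j'\<rangle>) (coh Fl j' i')"
    "nat_iso (D X1) (D X3) (Fl\<langle>j''\<rangle> \<circ>\<^sub>F Fl\<langle>i''\<rangle>) (Fl\<langle>i'' *[C] j''\<rangle>) (coh Fl j'' i'')"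
    using coh_nat Fl.coh_nat all f(1) g(1) h(2,4) by simp_all
  note chn = ch[THEN nat_isoD(1)]
  note bs = \<gamma>[OF s1 f(1) h(2)] \<gamma>[OF s2 g(1) t(10)] \<gamma>[OF s3 t(9) h(4)] \<gamma>[OF s4 t1(7) t2(8)]
    \<gamma>[OF h12 f(1) ij(1)] \<gamma>[OF h34 g(1) dd(2)] \<gamma>[OF v12 cc(1) h(2)] \<gamma>[OF v34 cc(4) h(4)] \<gamma>[OF vv cc(1) ij(1)]
  note sqn = bs[unfolded all, THEN nat_isoD(1)]
  have A: "A \<in> obj (D Y)" using A0 by (simp add: all)
  note ty = A comp_functor_simps Fs[THEN functor_typing] Us[THEN functor_typing]
    sqn[THEN nat_trans_typing]
    chn[THEN nat_trans_typing]
  interpret Q: category "D X3" using D_category all by simp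
  interpret Q2: category "D X2" using functor_category[OF Us(8)] by simp
  interpret Q1: category "D X1'" using functor_category[OF Us(6)] by simp
  let ?iA = "ob (Fl\<langle>i\<rangle>) A" and ?fA = "ob (V\<langle>f\<rangle>) A"
  let ?gij = "\<gamma> (f *[C] g) (i *[C] j) (f'' *[C] g'') (i'' *[C] j'') A"
  have 1: "coh Fl j'' i'' (ob (V\<langle>f *[C] g\<rangle>) A) *[D X3] ar (Fl\<langle>j''\<rangle>) (ar (Fl\<langle>i''\<rangle>) (coh V g f A)) =
      ar (Fl\<langle>i'' *[C] j''\<rangle>) (coh V g f A) *[D X3] coh Fl j'' i'' (ob (V\<langle>g\<rangle>) ?fA)"
    using nat_trans_natural[OF chn(6), of "coh V g f A"] by (simp add: ty)
  have 2: "?gij *[D X3] ar (Fl\<langle>i'' *[C] j''\<rangle>) (coh V g f A) =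
      coh V g'' f'' (ob (Fl\<langle>i *[C] j\<rangle>) A) *[D X3]
        (ar (V\<langle>g''\<rangle>) (\<gamma> f (i *[C] j) f'' (i' *[C] j') A) *[D X3] \<gamma> g (i' *[C] j') g'' (i'' *[C] j'') ?fA)"
    using ver[OF h12 f(1) ij(1) h34 g(1), of A] by (simp add: ty all)
  have 3: "\<gamma> g (i' *[C] j') g'' (i'' *[C] j'') ?fA *[D X3] coh Fl j'' i'' (ob (V\<langle>g\<rangle>) ?fA) =
      ar (V\<langle>g''\<rangle>) (coh Fl j' i' ?fA) *[D X3]
        (\<gamma> g' j' g'' j'' (ob (Fl\<langle>i'\<rangle>) ?fA) *[D X3] ar (Fl\<langle>j''\<rangle>) (\<gamma> g i' g' i'' ?fA))"
    using g(2)[unfolded hor_def, rule_format, OF s2 t(10) s4 t2(8), of ?fA] by (simp add: ty all)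
  have 4: "ar (V\<langle>g''\<rangle>) (\<gamma> f (i *[C] j) f'' (i' *[C] j') A) *[D X3] ar (V\<langle>g''\<rangle>) (coh Fl j' i' ?fA) =
      ar (V\<langle>g''\<rangle>) (ar (V\<langle>f''\<rangle>) (coh Fl j i A)) *[D X3]
        (ar (V\<langle>g''\<rangle>) (\<gamma> f' j f'' j' ?iA) *[D X3] ar (V\<langle>g''\<rangle>) (ar (Fl\<langle>j'\<rangle>) (\<gamma> f i f' i' A)))"
    using f(2)[unfolded hor_def, rule_format, OF s1 h(2) s3 h(4), of A]
    by (simp add: functor_cmp[OF Fs(8), symmetric] ty all Q2.cat_simps)
  have 5: "ar (Fl\<langle>j''\<rangle>) (\<gamma> (f *[C] g) i (f' *[C] g') i'' A) *[D X3] ar (Fl\<langle>j''\<rangle>) (ar (Fl\<langle>i''\<rangle>) (coh V g f A)) =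
      ar (Fl\<langle>j''\<rangle>) (coh V g' f' ?iA) *[D X3]
        (ar (Fl\<langle>j''\<rangle>) (ar (V\<langle>g'\<rangle>) (\<gamma> f i f' i' A)) *[D X3] ar (Fl\<langle>j''\<rangle>) (\<gamma> g i' g' i'' ?fA))"
    using ver[OF s1 f(1) h(2) s2 g(1), of A]
    by (simp add: functor_cmp[OF Us(6), symmetric] ty all Q1.cat_simps)
  have 6: "\<gamma> (f' *[C] g') j (f'' *[C] g'') j'' ?iA *[D X3] ar (Fl\<langle>j''\<rangle>) (coh V g' f' ?iA) =
      coh V g'' f'' (ob (Fl\<langle>j\<rangle>) ?iA) *[D X3]
        (ar (V\<langle>g''\<rangle>) (\<gamma> f' j f'' j' ?iA) *[D X3] \<gamma> g' j' g'' j'' (ob (V\<langle>f'\<rangle>) ?iA))"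
    using ver[OF s3 t(9) h(4) s4 t1(7), of ?iA] by (simp add: ty all)
  have 7: "\<gamma> g' j' g'' j'' (ob (V\<langle>f'\<rangle>) ?iA) *[D X3] ar (Fl\<langle>j''\<rangle>) (ar (V\<langle>g'\<rangle>) (\<gamma> f i f' i' A)) =
      ar (V\<langle>g''\<rangle>) (ar (Fl\<langle>j'\<rangle>) (\<gamma> f i f' i' A)) *[D X3] \<gamma> g' j' g'' j'' (ob (Fl\<langle>i'\<rangle>) ?fA)"
    using nat_trans_natural[OF sqn(4), of "\<gamma> f i f' i' A"] by (simp add: ty)
  have 8: "ar (V\<langle>f'' *[C] g''\<rangle>) (coh Fl j i A) *[D X3] coh V g'' f'' (ob (Fl\<langle>j\<rangle>) ?iA) =
      coh V g'' f'' (ob (Fl\<langle>i *[C] j\<rangle>) A) *[D X3] ar (V\<langle>g''\<rangle>) (ar (V\<langle>f''\<rangle>) (coh Fl j i A))"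
    using nat_trans_natural[OF chn(3), of "coh Fl j i A"] by (simp add: ty)
  let ?e = "ar (Fl\<langle>j''\<rangle>) (ar (Fl\<langle>i''\<rangle>) (coh V g f A))"
  let ?x = "ar (V\<langle>f'' *[C] g''\<rangle>) (coh Fl j i A) *[D X3]
        (\<gamma> (f' *[C] g') j (f'' *[C] g'') j'' ?iA *[D X3] ar (Fl\<langle>j''\<rangle>) (\<gamma> (f *[C] g) i (f' *[C] g') i'' A))"
  have i: "iso_arr (D X3) ?e"
    by (rule functor_iso(1)[OF Us(6)] functor_iso(1)[OF Us(3)] nat_isoD(2)[OF ch(1) A])+
  have "(?gij *[D X3] coh Fl j'' i'' (ob (V\<langle>f *[C] g\<rangle>) A)) *[D X3] ?e = ?x *[D X3] ?e"
    by (simp add: Q.cat_simps ty 1 Q.reassoc[OF 2] 3 Q.reassoc[OF 4] 5 Q.reassoc[OF 6] Q.reassoc[OF 7] Q.reassoc[OF 8])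
  then have "?gij *[D X3] coh Fl j'' i'' (ob (V\<langle>f *[C] g\<rangle>) A) = ?x"
    by (rule Q.iso_right_cancel[OF _ i]) (simp_all add: Q.cat_simps ty)
  then show "\<gamma> (f *[C] g) (i *[C] j) l (i'' *[C] j'') A *[D (src C l)] coh Fl j'' i'' (ob (V\<langle>f *[C] g\<rangle>) A) =
      ar (V\<langle>l\<rangle>) (coh Fl j i A) *[D (src C l)]
        (\<gamma> k j l j'' ?iA *[D (src C l)] ar (Fl\<langle>j''\<rangle>) (\<gamma> (f *[C] g) i k i'' A))"
    unfolding k l cc .
qed

text \<open>Families are made \<open>undefined\<close> outside the carrier, so that equal transformations are equal
  as functions.\<close>

definition ext where
  "ext Y a = (\<lambda>A. if A \<in> obj (D Y) then a A else undefined)"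

text \<open>The square is kept as first component, so that \<open>fst\<close> projects to the
  category of squares. The category laws are equations between functions, whence \<open>ext\<close>
  in \<open>arr\<close>, \<open>ide\<close> and \<open>cmp\<close>.\<close>

definition bc_cat where
  "bc_cat = \<lparr>obj = Fc,
     arr = {((f, u, f', u'), a). cartesian C f u f' u' \<and> f \<in> R \<and> u \<in> Fc \<and> bc f u f' u' a \<and> ext (tgt C f) a = a},
     src = (\<lambda>((f, u, f', u'), a). u'), tgt = (\<lambda>((f, u, f', u'), a). u),
     ide = (\<lambda>u. ((ide C (tgt C u), u, ide C (src C u), u),
       ext (tgt C u) (\<lambda>A. ide (D (src C u)) (ob (Fl\<langle>u\<rangle>) A)))),
     cmp = (\<lambda>((f, u, f', u'), a) ((g, v, g', v'), b).
       ((f *[C] g, u, f' *[C] g', v'), ext (tgt C f) (paste f f' u g g' v' a b)))\<rparr>"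

lemma bc_cat_simps:
  "obj bc_cat = Fc"
  "((f, u, f', u'), a) \<in> arr bc_cat \<longleftrightarrow> cartesian C f u f' u' \<and> f \<in> R \<and> u \<in> Fc \<and> bc f u f' u' a \<and> ext (tgt C f) a = a"
  "src bc_cat ((f, u, f', u'), a) = u'" "tgt bc_cat ((f, u, f', u'), a) = u"
  "ide bc_cat u = ((ide C (tgt C u), u, ide C (src C u), u), ext (tgt C u) (\<lambda>A. ide (D (src C u)) (ob (Fl\<langle>u\<rangle>) A)))"
  "((f, u, f', u'), a) *[bc_cat] ((g, v, g', v'), b) =
     ((f *[C] g, u, f' *[C] g', v'), ext (tgt C f) (paste f f' u g g' v' a b))"
  by (simp_all add: bc_cat_def)

lemma ext_simps:
  "A \<in> obj (D Y) \<Longrightarrow> ext Y a A = a A" "ext Y (ext Y a) = ext Y a"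
  "ext Y a = ext Y b \<longleftrightarrow> (\<forall>A\<in>obj (D Y). a A = b A)"
  by (auto simp: ext_def fun_eq_iff)

lemma bc_ext: "bc f u f' u' a \<Longrightarrow> bc f u f' u' (ext (tgt C f) a)"
  by (erule nat_iso_cong) (simp add: ext_simps)

lemma bc_ide:
  assumes "u \<in> Fc"
  shows "bc (ide C (tgt C u)) u (ide C (src C u)) u (\<lambda>A. ide (D (src C u)) (ob (Fl\<langle>u\<rangle>) A))"
proof -
  note ua = Fl.R_arr[OF assms]
  have o: "src C u \<in> obj C" "tgt C u \<in> obj C" using ua by (simp_all add: cat_simps)
  note U = Fl.pull[OF assms refl refl]
  interpret Q: category "D (src C u)" using functor_category[OF U] by simp
  interpret Y: category "D (tgt C u)" using functor_category[OF U] by simp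
  note Vi = pull[OF ide_R[OF o(1)] ide_arr(2,3)[OF o(1)]] pull[OF ide_R[OF o(2)] ide_arr(2,3)[OF o(2)]]
  show ?thesis
    by (intro nat_isoI nat_transI)
      (use functor_comp[OF Vi(2) U] functor_comp[OF U Vi(1)] in
        \<open>simp_all add: ide_arr o comp_functor_simps functor_simps[OF U] pull_ide Q.cat_simps Y.cat_simps Q.iso_ide\<close>)
qed

lemma paste_cong:
  assumes "f \<in> R" "A \<in> obj (D (tgt C f))" "tgt C g = src C f"
    and "\<And>B. B \<in> obj (D (tgt C f)) \<Longrightarrow> a B = a' B" "\<And>B. B \<in> obj (D (tgt C g)) \<Longrightarrow> b B = b' B"
  shows "paste f f' u g g' v a b A = paste f f' u g g' v a' b' A"
  using assms functor_simps(1)[OF pull[OF assms(1) refl refl]] by (simp add: paste_def)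

lemma paste_ext:
  assumes "f \<in> R" "A \<in> obj (D (tgt C f))" "tgt C g = src C f"
  shows "paste f f' u g g' v (ext (tgt C f) a) b A = paste f f' u g g' v a b A"
    "paste f f' u g g' v a (ext (tgt C g) b) A = paste f f' u g g' v a b A"
  by (rule paste_cong[OF assms]; simp add: ext_simps)+

lemma bc_category: "category bc_cat"
proof
  fix p assume "p \<in> arr bc_cat"
  then show "src bc_cat p \<in> obj bc_cat" "tgt bc_cat p \<in> obj bc_cat"
    using stable by (cases p rule: prod.exhaust; auto simp: bc_cat_simps dest: stable)+
next
  fix u assume "u \<in> obj bc_cat"
  then have u: "u \<in> Fc" by (simp add: bc_cat_simps)
  note ua = Fl.R_arr[OF u]
  have "bc (ide C (tgt C u)) u (ide C (src C u)) u
      (ext (tgt C u) (\<lambda>A. ide (D (src C u)) (ob (Fl\<langle>u\<rangle>) A)))"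
    using bc_ext[OF bc_ide[OF u]] ua by (simp add: cat_simps)
  then show "ide bc_cat u \<in> hom bc_cat u u"
    using u ua cartesian_ide[OF ua] ide_R by (auto simp: bc_cat_simps hom_def cat_simps ext_simps)
next
  fix p q u v w assume "p \<in> hom bc_cat u v" "q \<in> hom bc_cat v w"
  then obtain f f' a g g' b where p: "p = ((g, v, g', u), b)" "q = ((f, w, f', v), a)"
    "cartesian C g v g' u" "g \<in> R" "v \<in> Fc" "bc g v g' u b"
    "cartesian C f w f' v" "f \<in> R" "w \<in> Fc" "bc f w f' v a"
    by (auto simp: hom_def bc_cat_def)
  note c = cartesian_composable[OF p(7,3)]
  have t: "tgt C (f *[C] g) = tgt C f" using c by (simp add: cat_simps)
  show "q *[bc_cat] p \<in> hom bc_cat u w"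
    using bc_ext[OF paste_iso(1)[OF p(7-9,3,4,10,6)]] R_cmp[OF p(4,8) c(5)] p(9) cartesian_vertical[OF p(7,3)]
    by (simp add: p(1,2) hom_def bc_cat_simps t ext_simps)
next
  fix p u v assume "p \<in> hom bc_cat u v"
  then obtain f f' a where p: "p = ((f, v, f', u), a)" "cartesian C f v f' u" "f \<in> R" "v \<in> Fc"
    "bc f v f' u a" "ext (tgt C f) a = a"
    by (auto simp: hom_def bc_cat_def)
  note c = cartesianD[OF p(2)]
  have tt: "tgt C u = src C f" "tgt C v = tgt C f" "src C u = src C f'" "src C v = tgt C f'" using c by simp_all
  have o: "tgt C f \<in> obj C" using c by (simp add: cat_simps)
  have "ext (tgt C f) (paste f f' v (ide C (tgt C u)) (ide C (src C u)) u a
      (ext (tgt C u) (\<lambda>A. ide (D (src C u)) (ob (Fl\<langle>u\<rangle>) A)))) = ext (tgt C f) a"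
    using paste_ide(2)[OF p(2-5)] by (simp add: ext_simps tt)
  then show "p *[bc_cat] ide bc_cat u = p"
    using c p(6) tt by (simp add: p(1) bc_cat_simps cmp_ide)
  have "ext (tgt C f) (paste (ide C (tgt C v)) (ide C (src C v)) v f f' u
      (ext (tgt C v) (\<lambda>A. ide (D (src C v)) (ob (Fl\<langle>v\<rangle>) A))) a) = ext (tgt C f) a"
    using paste_ide(1)[OF p(2-5)] by (simp add: ext_simps tt)
  then show "ide bc_cat v *[bc_cat] p = p"
    using c p(6) tt o by (simp add: p(1) bc_cat_simps cmp_ide ide_arr)
next
  fix p q r u v w x
  assume "p \<in> hom bc_cat u v" "q \<in> hom bc_cat v w" "r \<in> hom bc_cat w x"
  then obtain f f' a g g' b h h' c where
    p: "r = ((f, x, f', w), a)" "q = ((g, w, g', v), b)" "p = ((h, v, h', u), c)"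
    "cartesian C f x f' w" "f \<in> R" "x \<in> Fc" "cartesian C g w g' v" "g \<in> R" "cartesian C h v h' u" "h \<in> R"
    "bc f x f' w a" "bc g w g' v b" "bc h v h' u c"
    by (auto simp: hom_def bc_cat_def)
  note k = cartesian_composable[OF p(4,7)] cartesian_composable[OF p(7,9)]
  have t: "tgt C (f *[C] g) = tgt C f" "tgt C (g *[C] h) = tgt C g" "src C (f *[C] g) = src C g"
    using k by (simp_all add: cat_simps)
  have fgR: "f *[C] g \<in> R" using R_cmp[OF p(8,5)] k by simp
  have "paste f f' x (g *[C] h) (g' *[C] h') u a (ext (tgt C g) (paste g g' w h h' u b c)) A =
      paste (f *[C] g) (f' *[C] g') x h h' u (ext (tgt C f) (paste f f' x g g' v a b)) c A"
    if A: "A \<in> obj (D (tgt C f))" for A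
    using paste_assoc[OF p(4-10) p(11-13) A] paste_ext(2)[OF p(5) A, of "g *[C] h"]
      paste_ext(1)[OF fgR, of A h] A k t by simp
  then show "r *[bc_cat] (q *[bc_cat] p) = (r *[bc_cat] q) *[bc_cat] p"
    using k by (simp add: p(1-3) bc_cat_simps t ext_simps cmp_assoc)
qed

end

section \<open>Gluing base change isomorphisms\<close>

text \<open>\<open>cls True\<close> and \<open>cls False\<close> are \<open>P\<close> and \<open>O\<close>.\<close>

locale flat_gluing = flat_pseudo C "generated_subcategory C (cls False \<union> cls True)" V Fc Fl D
  for C :: "('o, 'a) cat" and cls :: "bool \<Rightarrow> 'a set" and V :: "('o, 'a, 'p, 'q) pseudo"
    and Fc Fl and D :: "'o \<Rightarrow> ('p, 'q) cat" +
  fixes \<gamma> :: "bool \<Rightarrow> 'a \<Rightarrow> 'a \<Rightarrow> 'a \<Rightarrow> 'a \<Rightarrow> 'p \<Rightarrow> 'q"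
  assumes cls_sub: "subcategory C (cls l)"
    and cls_ide: "X \<in> obj C \<Longrightarrow> ide C X \<in> cls l"
    and cls_stable: "stable_under_base_change C (cls l) (arr C)"
    and cls_cancel: "\<lbrakk>f \<in> hom C X Y; g \<in> hom C Y Z; g *[C] f \<in> cls True; g \<in> cls l\<rbrakk> \<Longrightarrow> f \<in> cls True"
    and Fc_stable: "stable_under_base_change C Fc (cls False \<union> cls True)"
    and \<gamma>_bc: "base_change C (cls l) Fc V Fl (\<gamma> l)"
    and cube: "\<lbrakk>f \<in> cls True; g \<in> cls False; u \<in> Fc; cartesian C f g f2 g2;
      cartesian C f u f3 u2; cartesian C g u g3 u3; cartesian C g2 u2 g1 u1;
      cartesian C f2 u3 f1 u1; cartesian C f3 g3 f1 g1; A \<in> obj (D (tgt C f))\<rbrakk> \<Longrightarrow>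
      paste f f3 u g2 g1 u1 (\<gamma> True f u f3 u2) (\<gamma> False g2 u2 g1 u1) A =
      paste g g3 u f2 f1 u1 (\<gamma> False g u g3 u3) (\<gamma> True f2 u3 f1 u1) A"
    and retract: "\<lbrakk>f \<in> cls True; g \<in> cls False; u \<in> Fc; retract_pair C f g; retract_pair C f' g';
      cartesian C g u g' u'; cartesian C f u' f' u; A \<in> obj (D (tgt C g))\<rbrakk> \<Longrightarrow>
      paste g g' u f f' u (\<gamma> False g u g' u') (\<gamma> True f u' f' u) A = ide (D (src C u)) (ob (Fl\<langle>u\<rangle>) A)"
begin

abbreviation "Q \<equiv> generated_subcategory C (cls False \<union> cls True)"

lemma cls_arr: "cls False \<union> cls True \<subseteq> arr C"
  using subcategoryD(1)[OF cls_sub] by blast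

lemma cls_Q: "f \<in> cls l \<Longrightarrow> f \<in> Q"
  using generated_subcategory(2)[OF cls_arr] by (cases l) auto

lemma cls_square:
  assumes "cartesian C f u f' u'" "f \<in> cls l"
  shows "f' \<in> cls l"
proof -
  have "u \<in> arr C" "tgt C f = tgt C u" using cartesianD[OF assms(1)] by simp_all
  then show ?thesis using assms cls_stable[of l] unfolding stable_under_base_change_def by blast
qed

lemma cls_flat_pseudo: "flat_pseudo C (cls l) V Fc Fl D"
proof -
  interpret P: pseudo_on C "cls l" V D
    by (rule restrict) (use cls_sub cls_Q cls_ide in auto)
  show ?thesis
    by unfold_locales (use cls_square stable cls_Q in blast)
qed

lemma \<gamma>_square:
  assumes "cartesian C f u f' u'" "f \<in> cls l" "u \<in> Fc"
  shows "bc f u f' u' (\<gamma> l f u f' u')"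
  using flat_pseudo.base_changeD(1)[OF cls_flat_pseudo \<gamma>_bc assms] .

lemma cls_exists:
  assumes "f \<in> cls l" "u \<in> Fc" "tgt C u = tgt C f"
  shows "\<exists>f' u'. cartesian C f u f' u'"
  using Fc_stable assms unfolding stable_under_base_change_def
  by (cases l) (metis UnI1 UnI2 cartesian_sym)+

lemma Q_exists:
  assumes "f \<in> Q" "u \<in> Fc" "tgt C u = tgt C f"
  shows "\<exists>f' u'. cartesian C f u f' u'"
proof (rule generated_base_change(1)[OF assms(1) cls_arr _ _ _ assms(2,3)])
  show "\<exists>f' u'. cartesian C f u f' u'" if "f \<in> cls False \<union> cls True" "u \<in> Fc" "tgt C u = tgt C f" for f u
    using that cls_exists by blast
  show "f' \<in> cls False \<union> cls True \<and> u' \<in> Fc"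
    if "cartesian C f u f' u'" "f \<in> cls False \<union> cls True" "u \<in> Fc" for f u f' u'
    using that cls_square cls_Q stable[OF that(1) _ that(3)] by blast
qed (simp add: cls_ide)

text \<open>Vertical transitivity is the equation that characterises the paste; hence the section on
  one class is multiplicative.\<close>

lemma \<gamma>_paste:
  assumes s: "cartesian C f u f' u'" "f \<in> cls l" "u \<in> Fc" and s': "cartesian C g u' g' u''" "g \<in> cls l"
    and A: "A \<in> obj (D (tgt C f))"
  shows "paste f f' u g g' u'' (\<gamma> l f u f' u') (\<gamma> l g u' g' u'') A = \<gamma> l (f *[C] g) u (f' *[C] g') u'' A"
proof (rule paste_eqI[OF s(1) cls_Q[OF s(2)] s(3) s'(1) cls_Q[OF s'(2)] \<gamma>_square[OF s] _ A])
  have u': "u' \<in> Fc" using stable[OF s(1) cls_Q[OF s(2)] s(3)] by simp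
  then show "bc g u' g' u'' (\<gamma> l g u' g' u'')" by (rule \<gamma>_square[OF s'])
  note c = cartesian_composable[OF s(1) s'(1)]
  have fg: "f *[C] g \<in> cls l" using subcategoryD(2)[OF cls_sub s'(2) s(2) c(5)] .
  have ty: "tgt C (f *[C] g) = tgt C f" "src C (f' *[C] g') = src C g'"
    using c by (simp_all add: cat_simps)
  note n = nat_isoD(1)[OF \<gamma>_square[OF cartesian_vertical[OF s(1) s'(1)] fg s(3)], unfolded ty]
  show "\<gamma> l (f *[C] g) u (f' *[C] g') u'' A \<in> arr (D (src C g'))"
    "src (D (src C g')) (\<gamma> l (f *[C] g) u (f' *[C] g') u'' A) = ob (Fl\<langle>u''\<rangle>) (ob (V\<langle>f *[C] g\<rangle>) A)"
    using nat_transD(3,4)[OF n A] by (simp_all add: comp_functor_simps)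
  show "\<gamma> l (f *[C] g) u (f' *[C] g') u'' A *[D (src C g')] ar (Fl\<langle>u''\<rangle>) (coh V g f A) =
      coh V g' f' (ob (Fl\<langle>u\<rangle>) A) *[D (src C g')]
        (ar (V\<langle>g'\<rangle>) (\<gamma> l f u f' u' A) *[D (src C g')] \<gamma> l g u' g' u'' (ob (V\<langle>f\<rangle>) A))"
    by (rule flat_pseudo.base_changeD(3)[OF cls_flat_pseudo \<gamma>_bc s s' A])
qed

text \<open>\<open>\<gamma>\<close> of an identity square is idempotent, by vertical transitivity, and invertible.\<close>

lemma \<gamma>_ide:
  assumes u: "u \<in> Fc" and A: "A \<in> obj (D (tgt C u))"
  shows "\<gamma> l (ide C (tgt C u)) u (ide C (src C u)) u A = ide (D (src C u)) (ob (Fl\<langle>u\<rangle>) A)"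
proof -
  note ua = Fl.R_arr[OF u]
  have o: "tgt C u \<in> obj C" "src C u \<in> obj C" using ua by (simp_all add: cat_simps)
  note c = cartesian_ide[OF ua]
  let ?g = "\<gamma> l (ide C (tgt C u)) u (ide C (src C u)) u"
  note U = Fl.pull[OF u refl refl]
  interpret Y: category "D (tgt C u)" using functor_category[OF U] by simp
  interpret X: category "D (src C u)" using functor_category[OF U] by simp
  note s = \<gamma>_square[OF c cls_ide[OF o(1)] u]
  note n = nat_isoD(1)[OF s]
  have ty: "?g A \<in> arr (D (src C u))" "src (D (src C u)) (?g A) = ob (Fl\<langle>u\<rangle>) A"
    "tgt (D (src C u)) (?g A) = ob (Fl\<langle>u\<rangle>) A"
    using nat_transD(3-5)[OF n, of A] A
    by (simp_all add: ide_arr o comp_functor_simps pull_ide functor_simps[OF U])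
  have i: "iso_arr (D (src C u)) (?g A)"
    using nat_isoD(2)[OF s, of A] A by (simp add: ide_arr o)
  have "?g A *[D (src C u)] ?g A = ?g A *[D (src C u)] ide (D (src C u)) (ob (Fl\<langle>u\<rangle>) A)"
    using flat_pseudo.base_changeD(3)[OF cls_flat_pseudo \<gamma>_bc c cls_ide[OF o(1)] u c cls_ide[OF o(1)], of A]
      A coh_ide(1)[OF ide_R[OF o(1)] ide_arr(2,3)[OF o(1)] A]
      coh_ide(1)[OF ide_R[OF o(2)] ide_arr(2,3)[OF o(2)], of "ob (Fl\<langle>u\<rangle>) A"]
    by (simp add: ide_arr o cmp_ide pull_ide functor_simps[OF U] X.cat_simps ty)
  then show ?thesis
    by (rule X.iso_left_cancel[OF _ i]) (simp_all add: ty X.cat_simps A functor_simps[OF U])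
qed

definition K where "K l = {(f, u, f', u'). cartesian C f u f' u' \<and> f \<in> cls l \<and> u \<in> Fc}"

fun s where "s l (f, u, f', u') = ((f, u, f', u'), ext (tgt C f) (\<gamma> l f u f' u'))"

lemma K_iff: "(f, u, f', u') \<in> K l \<longleftrightarrow> cartesian C f u f' u' \<and> f \<in> cls l \<and> u \<in> Fc"
  by (simp add: K_def)

text \<open>The classes \<open>l\<close> and \<open>k\<close> may differ. The normalisation of the
  two factors disappears because a paste evaluates them only at objects of the carrier.\<close>

lemma s_paste:
  assumes "cartesian C f u f' u'" "f \<in> cls l" and that: "tgt C g = src C f"
  shows "s l (f, u, f', u') *[bc_cat] s k (g, u', g', u'') =
    ((f *[C] g, u, f' *[C] g', u''),
      ext (tgt C f) (paste f f' u g g' u'' (\<gamma> l f u f' u') (\<gamma> k g u' g' u'')))"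
  using paste_ext(2)[OF cls_Q[OF assms(2)] _ that] paste_ext(1)[OF cls_Q[OF assms(2)] _ that]
  by (simp add: bc_cat_simps ext_simps)

text \<open>For equal classes both sides are the value of \<gamma> on the same composite square,
  because \<open>f g2 = g f2\<close> and \<open>f3 g1 = g3 f1\<close>. For different classes it is
  the cube condition, read directly or with the two maps interchanged.\<close>

lemma exchange:
  assumes "cartesian C f u f3 u2" "f \<in> cls l" "u \<in> Fc" "cartesian C g u g3 u3" "g \<in> cls k"
    and "cartesian C f g f2 g2" "cartesian C g2 u2 g1 u1" "cartesian C f2 u3 f1 u1" "cartesian C f3 g3 f1 g1"
    and A: "A \<in> obj (D (tgt C f))"
  shows "paste f f3 u g2 g1 u1 (\<gamma> l f u f3 u2) (\<gamma> k g2 u2 g1 u1) A =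
      paste g g3 u f2 f1 u1 (\<gamma> k g u g3 u3) (\<gamma> l f2 u3 f1 u1) A"
proof -
  have A': "A \<in> obj (D (tgt C g))" using A cartesianD[OF assms(6)] by simp
  have f2: "f2 \<in> cls l" and g2: "g2 \<in> cls k"
    using cls_square[OF assms(6,2)] cls_square[OF cartesian_sym[OF assms(6)] assms(5)] by auto
  consider "l = k" | "l" "\<not> k" | "\<not> l" "k" by auto
  then show ?thesis
  proof cases
    case 1
    then show ?thesis
      using \<gamma>_paste[OF assms(1-3,7) _ A] \<gamma>_paste[OF assms(4,5,3,8) _ A'] f2 g2
        cartesian_commute[OF assms(6)] cartesian_commute[OF assms(9)] by simp
  next
    case 2
    then show ?thesis using cube[OF _ _ assms(3,6,1,4,7,8,9) A] assms(2,5) by simp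
  next
    case 3
    then show ?thesis
      using cube[OF _ _ assms(3) cartesian_sym[OF assms(6)] assms(4,1,8,7) cartesian_sym[OF assms(9)] A']
        assms(2,5) by simp
  qed
qed

sublocale glue: gluing "sq_cat C Fc" bc_cat K s
proof -
  have FcC: "Fc \<subseteq> arr C" using Fl.R_arr by blast
  interpret S: category "sq_cat C Fc" by (rule sq_category[OF FcC])
  interpret M: category bc_cat by (rule bc_category)
  have K_Fc: "u' \<in> Fc" if "(f, u, f', u') \<in> K l" for f u f' u' l
    using that stable cls_Q by (auto simp: K_iff)
  show "gluing (sq_cat C Fc) bc_cat K s"
  proof unfold_locales
    fix p l assume "p \<in> K l"
    then show "p \<in> arr (sq_cat C Fc)"
      using K_Fc by (cases p) (auto simp: sq_cat_simps K_iff)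
  next
    show "obj bc_cat = obj (sq_cat C Fc)" by (simp add: sq_cat_simps bc_cat_simps)
  next
    fix p l assume "p \<in> K l"
    then show "s l p \<in> arr bc_cat \<and> src bc_cat (s l p) = src (sq_cat C Fc) p \<and>
        tgt bc_cat (s l p) = tgt (sq_cat C Fc) p"
      by (cases p) (auto simp: sq_cat_simps bc_cat_simps K_iff ext_simps intro: \<gamma>_square bc_ext cls_Q)
  next
    fix u assume "u \<in> obj (sq_cat C Fc)"
    then have u: "u \<in> Fc" by (simp add: sq_cat_simps)
    note ua = Fl.R_arr[OF u]
    have o: "tgt C u \<in> obj C" using ua by (simp add: cat_simps)
    show "ide (sq_cat C Fc) u \<in> K True \<and> s True (ide (sq_cat C Fc) u) = ide bc_cat u"
      using cartesian_ide[OF ua] cls_ide[OF o] u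
      by (simp add: sq_cat_simps bc_cat_simps K_iff ide_arr o ext_simps \<gamma>_ide)
  next
    fix p q assume "p \<in> K True" "q \<in> K True" "tgt (sq_cat C Fc) p = src (sq_cat C Fc) q"
    then obtain f u f' u' g g' u'' where h: "q = (f, u, f', u')" "p = (g, u', g', u'')"
      "cartesian C f u f' u'" "f \<in> cls True" "u \<in> Fc" "cartesian C g u' g' u''" "g \<in> cls True"
      by (cases p; cases q) (auto simp: K_iff sq_cat_simps)
    note c = cartesian_composable[OF h(3,6)]
    have t: "tgt C (f *[C] g) = tgt C f" using c by (simp add: cat_simps)
    have "s True (q *[sq_cat C Fc] p) = s True q *[bc_cat] s True p"
      unfolding h(1,2) s_paste[OF h(3,4) c(5)]
      using \<gamma>_paste[OF h(3-7)] by (simp add: sq_cat_simps t ext_simps)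
    then show "q *[sq_cat C Fc] p \<in> K True \<and> s True (q *[sq_cat C Fc] p) = s True q *[bc_cat] s True p"
      using h(1-5) cartesian_vertical[OF h(3,6)] subcategoryD(2)[OF cls_sub h(7,4) c(5)]
      by (simp add: sq_cat_simps K_iff)
  next
    fix p q l k assume "p \<in> K l" "q \<in> K k" "tgt (sq_cat C Fc) q = tgt (sq_cat C Fc) p"
    then obtain f u f3 u2 g g3 u3 where h: "p = (f, u, f3, u2)" "q = (g, u, g3, u3)"
      "cartesian C f u f3 u2" "f \<in> cls l" "u \<in> Fc" "cartesian C g u g3 u3" "g \<in> cls k"
      by (cases p; cases q) (auto simp: K_iff sq_cat_simps)
    have Fc: "u2 \<in> Fc" "u3 \<in> Fc" using K_Fc h by (auto simp: K_iff)
    \<comment> \<open>The cube is built face by face: the fibre product of \<open>f\<close> and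
      \<open>g\<close>, then that of \<open>g2\<close> and the flat map \<open>u2\<close>; the other
      two faces are forced.\<close>
    have "tgt C f = tgt C g" using cartesianD(5)[OF h(3)] cartesianD(5)[OF h(6)] by simp
    then obtain f2 g2 where b: "cartesian C f g f2 g2"
      using cls_stable[of l] h(4) cartesianD(1)[OF h(6)] unfolding stable_under_base_change_def by blast
    have f2: "f2 \<in> cls l" and g2: "g2 \<in> cls k"
      using cls_square[OF b h(4)] cls_square[OF cartesian_sym[OF b] h(7)] by auto
    have "tgt C u2 = tgt C g2" using cartesianD(8)[OF b] cartesianD(8)[OF h(3)] by simp
    then obtain g1 u1 where b2: "cartesian C g2 u2 g1 u1" using cls_exists[OF g2 Fc(1)] by blast
    obtain f1 where b3: "cartesian C f2 u3 f1 u1" "cartesian C f3 g3 f1 g1"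
      using cube_exists[OF h(3,6) b b2] by blast
    have u1: "u1 \<in> Fc" using stable[OF b2 cls_Q[OF g2] Fc(1)] by simp
    have tg: "tgt C g2 = src C f" "tgt C f2 = src C g" using cartesianD[OF b] by simp_all
    have tfg: "tgt C g = tgt C f" using cartesianD[OF b] by simp
    have "s l p *[bc_cat] s k (g2, u2, g1, u1) = s k q *[bc_cat] s l (f2, u3, f1, u1)"
      unfolding h(1,2) s_paste[OF h(3,4) tg(1)] s_paste[OF h(6,7) tg(2)] tfg
      using exchange[OF h(3-7) b b2 b3] cartesian_commute[OF b] cartesian_commute[OF b3(2)]
      by (simp add: ext_simps)
    moreover have "cartesian (sq_cat C Fc) p q (f2, u3, f1, u1) (g2, u2, g1, u1)"
      unfolding h(1,2) by (rule sq_cartesian[OF h(3,6) b b2 b3 h(5) u1 Fc FcC])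
    ultimately show "\<exists>f' g'. cartesian (sq_cat C Fc) p q f' g' \<and> f' \<in> K l \<and> g' \<in> K k \<and>
        s l p *[bc_cat] s k g' = s k q *[bc_cat] s l f'"
      using b2 b3(1) f2 g2 Fc
      by (intro exI[of _ "(f2, u3, f1, u1)"] exI[of _ "(g2, u2, g1, u1)"]) (simp add: K_iff)
  next
    fix q l p assume "q \<in> K l" "p \<in> arr (sq_cat C Fc)" "tgt (sq_cat C Fc) p = src (sq_cat C Fc) q"
      "src (sq_cat C Fc) p = tgt (sq_cat C Fc) q" "q *[sq_cat C Fc] p = ide (sq_cat C Fc) (src (sq_cat C Fc) p)"
    then obtain g u g' u' f f' where h: "q = (g, u, g', u')" "p = (f, u', f', u)"
      "cartesian C g u g' u'" "g \<in> cls l" "u \<in> Fc" "cartesian C f u' f' u" "u' \<in> Fc"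
      "g *[C] f = ide C (tgt C u)" "g' *[C] f' = ide C (src C u)"
      by (cases q; cases p) (auto simp: K_iff sq_cat_simps)
    note cg = cartesianD[OF h(3)] and cf = cartesianD[OF h(6)]
    have ty: "src C f = tgt C u" "src C f' = src C u" "tgt C f = src C g" "tgt C f' = src C g'"
      "tgt C g = tgt C u" "tgt C g' = src C u"
      using cg cf by simp_all
    have "tgt C u \<in> obj C" using cg(2) by (rule tgt_obj)
    then have gf: "g *[C] f \<in> cls True" unfolding h(8) by (rule cls_ide)
    \<comment> \<open>Cancellation against an identity, which lies in \<open>P\<close>: the section
      is in \<open>P\<close> whatever the class of \<open>g\<close>.\<close>
    have f: "f \<in> cls True"
      by (rule cls_cancel[OF homI[OF cf(1) refl ty(3)] homI[OF cg(1) refl refl] gf h(4)])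
    have r: "retract_pair C f g" "retract_pair C f' g'"
      using h(8,9) cg(1,3) cf(1,3) ty by (simp_all add: retract_pair_def hom_def)
    have "paste g g' u f f' u (\<gamma> l g u g' u') (\<gamma> True f u' f' u) A = ide (D (src C u)) (ob (Fl\<langle>u\<rangle>) A)"
      if A: "A \<in> obj (D (tgt C g))" for A
    \<comment> \<open>For \<open>P\<close> the values multiply and are trivial on identity squares.
      For \<open>O\<close> this is the hypothesis \<open>retract\<close>.\<close>
    proof (cases l)
      case True
      then show ?thesis
        using \<gamma>_paste[OF h(3-6), of A] f A \<gamma>_ide[OF h(5)] h(8,9) ty by simp
    next
      case False
      then show ?thesis using retract[OF f _ h(5) r h(3,6) A] h(4) by simp
    qed
    then have "s l q *[bc_cat] s True p = ide bc_cat u"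
      unfolding h(1,2) s_paste[OF h(3,4) ty(3)]
      by (simp add: bc_cat_simps ext_simps ty h(8,9))
    then show "p \<in> K True \<and> s l q *[bc_cat] s True p = ide bc_cat (src (sq_cat C Fc) p)"
      using f h by (simp add: K_iff sq_cat_simps)
  qed
qed

text \<open>Composition in \<open>bc_cat\<close> respects the underlying squares, so a value of a
  square is a base change isomorphism on that very square.\<close>

lemma G_over: "glue.G q m \<Longrightarrow> fst m = q"
proof (induction rule: glue.G.induct)
  case (G_ide u)
  then show ?case by (simp add: bc_cat_simps sq_cat_simps)
next
  case (G_step q m p l)
  then show ?case by (cases q; cases p; cases m) (auto simp: bc_cat_simps sq_cat_simps)
qed

text \<open>Existence is needed for every choice of projections. A square over a composite is split
  into squares over the factors, and their strings are joined by \<open>G_cmp\<close>.\<close>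

lemma G_exists: "f \<in> Q \<Longrightarrow> cartesian C f u f' u' \<Longrightarrow> u \<in> Fc \<Longrightarrow> \<exists>m. glue.G (f, u, f', u') m"
proof (induction arbitrary: u f' u' rule: generated_induct)
  case arr show ?case by (rule cls_arr)
next
  case (ide X) then show ?case using cls_ide by blast
next
  case (generator f)
  then obtain l where "f \<in> cls l" by auto
  with generator have "(f, u, f', u') \<in> K l" by (simp add: K_iff)
  then show ?case using glue.G_generator by blast
next
  case (cmp f g)
  note fa = R_arr[OF cmp.hyps(1)] and ga = R_arr[OF cmp.hyps(2)]
  have "tgt C u = tgt C f"
    using cartesianD(5)[OF cmp.prems(1)] fa ga cmp.hyps(3) by (simp add: cat_simps)
  then obtain h w where 1: "cartesian C f u h w" using Q_exists[OF cmp.hyps(1) cmp.prems(2)] by blast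
  obtain g' where 2: "cartesian C g w g' u'" "f' = h *[C] g'"
    using cartesian_split[OF cmp.prems(1) 1 ga cmp.hyps(3)] by blast
  have "w \<in> Fc" using stable[OF 1 cmp.hyps(1) cmp.prems(2)] by simp
  with cmp.IH(1)[OF 1 cmp.prems(2)] cmp.IH(2)[OF 2(1)] obtain m n
    where "glue.G (f, u, h, w) m" "glue.G (g, w, g', u') n" by blast
  from glue.G_cmp[OF this(2,1)] have "glue.G (f *[C] g, u, f', u') (m *[bc_cat] n)"
    by (simp add: sq_cat_simps 2(2))
  then show ?case by blast
qed

text \<open>The common value of all factorizations of the square; \<open>G_unique\<close> makes the
  description meaningful.\<close>

definition \<Gamma> where "\<Gamma> f u f' u' = snd (THE m. glue.G (f, u, f', u') m)"

lemma G_\<Gamma>: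
  assumes "cartesian C f u f' u'" "f \<in> Q" "u \<in> Fc"
  shows "glue.G (f, u, f', u') ((f, u, f', u'), \<Gamma> f u f' u')"
proof -
  obtain m where m: "glue.G (f, u, f', u') m" using G_exists assms by blast
  then have "(THE m. glue.G (f, u, f', u') m) = m" using glue.G_unique by blast
  with m G_over[OF m] show ?thesis by (cases m) (simp add: \<Gamma>_def)
qed

lemma \<Gamma>_eq: "glue.G (f, u, f', u') ((f, u, f', u'), a) \<Longrightarrow> \<Gamma> f u f' u' = a"
  using glue.G_unique by (auto simp: \<Gamma>_def intro!: the_equality arg_cong[where f = snd, of _ "(_, a)", simplified])

lemma \<Gamma>_generator:
  assumes "cartesian C f u f' u'" "f \<in> cls l" "u \<in> Fc" "A \<in> obj (D (tgt C f))"
  shows "\<Gamma> f u f' u' A = \<gamma> l f u f' u' A"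
proof -
  have "glue.G (f, u, f', u') (s l (f, u, f', u'))"
    using assms by (intro glue.G_generator) (simp add: K_iff)
  from \<Gamma>_eq[OF this[simplified]] show ?thesis using assms(4) by (simp add: ext_simps)
qed

lemma \<Gamma>_bc: "cartesian C f u f' u' \<Longrightarrow> f \<in> Q \<Longrightarrow> u \<in> Fc \<Longrightarrow> bc f u f' u' (\<Gamma> f u f' u')"
  using glue.G_arr[OF G_\<Gamma>] by (simp add: bc_cat_simps)

text \<open>The paste of the values on two squares is a value of the composite square, hence its
  only one.\<close>

lemma \<Gamma>_vertical:
  assumes s: "cartesian C f i f' i'" "f \<in> Q" "i \<in> Fc" and s': "cartesian C g i' g' i''" "g \<in> Q"
    and A: "A \<in> obj (D (tgt C f))"
  shows "\<Gamma> (f *[C] g) i (f' *[C] g') i'' A *[D (src C g')] ar (Fl\<langle>i''\<rangle>) (coh V g f A) =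
          coh V g' f' (ob (Fl\<langle>i\<rangle>) A) *[D (src C g')]
            (ar (V\<langle>g'\<rangle>) (\<Gamma> f i f' i' A) *[D (src C g')] \<Gamma> g i' g' i'' (ob (V\<langle>f\<rangle>) A))"
proof -
  have i': "i' \<in> Fc" using stable[OF s] by simp
  have "\<Gamma> (f *[C] g) i (f' *[C] g') i'' = ext (tgt C f) (paste f f' i g g' i'' (\<Gamma> f i f' i') (\<Gamma> g i' g' i''))"
    using glue.G_cmp[OF G_\<Gamma>[OF s' i'] G_\<Gamma>[OF s]] by (intro \<Gamma>_eq) (simp add: sq_cat_simps bc_cat_simps)
  then show ?thesis
    using paste_iso(2)[OF s s' \<Gamma>_bc[OF s] \<Gamma>_bc[OF s' i'] A] A by (simp add: ext_simps)
qed

text \<open>On a generator the base change \<open>f'\<close> lies in the same class, so all three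
  values come from one \<open>\<gamma> l\<close> and its own transitivity applies; composites are
  handled by \<open>hor_cmp\<close>.\<close>

lemma hor_\<Gamma>: "f \<in> Q \<Longrightarrow> hor \<Gamma> f"
proof (induction rule: generated_induct)
  case arr show ?case by (rule cls_arr)
next
  case (ide X) then show ?case using cls_ide by blast
next
  case (generator f)
  then obtain l where f: "f \<in> cls l" by auto
  interpret P: flat_pseudo C "cls l" V Fc Fl D by (rule cls_flat_pseudo)
  show ?case
    unfolding hor_def
  proof (intro allI impI ballI)
    fix i f' i' j f'' j' A
    assume h: "cartesian C f i f' i'" "i \<in> Fc" "cartesian C f' j f'' j'" "j \<in> Fc" and A: "A \<in> obj (D (tgt C f))"
    have f': "f' \<in> cls l" by (rule cls_square[OF h(1) f])
    have ij: "i *[C] j \<in> Fc"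
      using Fl.R_cmp[OF h(4,2)] cartesianD[OF h(1)] cartesianD[OF h(3)] by simp
    have t: "tgt C f' = src C i" "tgt C i = tgt C f" using cartesianD[OF h(1)] by simp_all
    have iA: "ob (Fl\<langle>i\<rangle>) A \<in> obj (D (tgt C f'))"
      using functor_simps(1)[OF Fl.pull[OF h(2) refl t(2)] A] t by simp
    show "\<Gamma> f (i *[C] j) f'' (i' *[C] j') A *[D (src C f'')] coh Fl j' i' (ob (V\<langle>f\<rangle>) A) =
          ar (V\<langle>f''\<rangle>) (coh Fl j i A) *[D (src C f'')]
            (\<Gamma> f' j f'' j' (ob (Fl\<langle>i\<rangle>) A) *[D (src C f'')] ar (Fl\<langle>j'\<rangle>) (\<Gamma> f i f' i' A))"
      unfolding \<Gamma>_generator[OF h(1) f h(2) A] \<Gamma>_generator[OF h(3) f' h(4) iA]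
        \<Gamma>_generator[OF cartesian_horizontal[OF h(1,3)] f ij A]
      by (rule P.base_changeD(2)[OF \<gamma>_bc h(1) f h(2-4) A])
  qed
next
  case (cmp f g)
  show ?case
    by (rule hor_cmp[OF \<Gamma>_bc \<Gamma>_vertical Q_exists[OF cmp.hyps(1)] cmp.hyps(1) cmp.IH(1) cmp.hyps(2) cmp.IH(2)
          cmp.hyps(3)])
qed

theorem \<Gamma>_base_change: "base_change C Q Fc V Fl \<Gamma>"
  by (rule base_changeI) (use \<Gamma>_bc \<Gamma>_vertical hor_\<Gamma> in \<open>auto simp: hor_def\<close>)

end

section \<open>Transport along isomorphisms of categories\<close>

lemma is_functor_cong:
  assumes "is_functor A B F" "functor_eq A F G"
  shows "is_functor A B G"
proof -
  interpret A: category A using functor_category[OF assms(1)] by simp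
  show ?thesis
    using assms A.cmp_hom by (auto simp: is_functor_def functor_eq_def hom_def A.cat_simps)
qed

lemma nat_iso_functor_cong:
  assumes "nat_iso A B F G \<tau>" "functor_eq A F F'" "functor_eq A G G'"
  shows "nat_iso A B F' G' \<tau>"
proof -
  note t = nat_isoD(1)[OF assms(1)]
  interpret A: category A using functor_category nat_transD(1)[OF t] by blast
  show ?thesis
  proof (intro nat_isoI nat_transI)
    fix m assume m: "m \<in> arr A"
    then show "\<tau> (tgt A m) *[B] ar F' m = ar G' m *[B] \<tau> (src A m)"
      using nat_trans_natural[OF t m refl refl] assms(2,3) by (simp add: functor_eq_def)
  qed (use is_functor_cong[OF nat_transD(1)[OF t] assms(2)] is_functor_cong[OF nat_transD(2)[OF t] assms(3)]
      nat_transD(3-5)[OF t] nat_isoD(2)[OF assms(1)] assms(2,3) in \<open>auto simp: functor_eq_def\<close>)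
qed

definition inverse_functors where
  "inverse_functors A B S S' \<longleftrightarrow> is_functor A B S \<and> is_functor B A S' \<and>
     functor_eq A (S' \<circ>\<^sub>F S) id_functor \<and> functor_eq B (S \<circ>\<^sub>F S') id_functor"

lemma inverse_functorsD:
  assumes "inverse_functors A B S S'"
  shows "is_functor A B S" "is_functor B A S'"
    "x \<in> obj A \<Longrightarrow> ob S' (ob S x) = x" "m \<in> arr A \<Longrightarrow> ar S' (ar S m) = m"
    "y \<in> obj B \<Longrightarrow> ob S (ob S' y) = y" "n \<in> arr B \<Longrightarrow> ar S (ar S' n) = n"
  using assms by (auto simp: inverse_functors_def functor_eq_def comp_functor_simps id_functor_simps)

text \<open>\<open>cover_Sinv\<close> is built from \<open>inv_into\<close>. A functor with an
  inverse is injective on the carriers, so every inverse agrees there with the chosen one.\<close>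

lemma inverse_functors_inv:
  assumes "inverse_functors A B S S'"
  shows "inverse_functors A B S (inv_functor A S)"
proof -
  note d = inverse_functorsD[OF assms]
  have o: "inv_into (obj A) (ob S) y = ob S' y" if "y \<in> obj B" for y
    using d(3,5) functor_simps(1)[OF d(2) that] that inv_into_f_eq[of "ob S" "obj A"]
    by (metis inj_on_def)
  have a: "inv_into (arr A) (ar S) n = ar S' n" if "n \<in> arr B" for n
    using d(4,6) functor_simps(2)[OF d(2) that] that inv_into_f_eq[of "ar S" "arr A"]
    by (metis inj_on_def)
  have e: "functor_eq B S' (inv_functor A S)"
    by (simp add: functor_eq_def inv_functor_def o a)
  then show ?thesis
    using assms is_functor_cong[OF d(2) e] functor_simps(1,2)[OF d(1)]
    unfolding inverse_functors_def functor_eq_def comp_functor_simps id_functor_simps by simp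
qed

lemma inverse_functors_id: "category A \<Longrightarrow> inverse_functors A A id_functor id_functor"
  by (simp add: inverse_functors_def functor_id functor_eq_def comp_functor_simps id_functor_simps)

text \<open>The inverse morphism \<open>t\<close> inverts the components as well: the inverse of
  \<open>mar s f A\<close> is \<open>mob s X\<close> applied to the component of \<open>t\<close> at
  \<open>ob (mob s Y) A\<close>.\<close>

lemma pseudo_iso_functors:
  fixes s :: "('o, 'a, 'p, 'q, 'r, 's) pmor"
  assumes "pseudo_iso K U V s"
  shows "\<exists>t. \<forall>X\<in>obj K. inverse_functors (pcat U X) (pcat V X) (mob s X) (t X)"
    and "f \<in> hom K X Y \<Longrightarrow> A \<in> obj (pcat U Y) \<Longrightarrow> iso_arr (pcat V X) (mar s f A)"
proof -
  obtain t where t: "pseudo_morphism K U V s" "pseudo_morphism K V U t"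
    "pmor_eq K U (pmor_comp K U t s) (pmor_id K U)" "pmor_eq K V (pmor_comp K V s t) (pmor_id K V)"
    using assms by (auto simp: pseudo_iso_def)
  interpret category K using t(1) by (simp add: pseudo_morphism_def pseudofunctor_def)
  have inv: "inverse_functors (pcat U X) (pcat V X) (mob s X) (mob t X)" if "X \<in> obj K" for X
    using t that by (simp add: inverse_functors_def pseudo_morphism_def pmor_eq_def pmor_comp_def pmor_id_def)
  then show "\<exists>t. \<forall>X\<in>obj K. inverse_functors (pcat U X) (pcat V X) (mob s X) (t X)" by blast
  show "iso_arr (pcat V X) (mar s f A)" if f: "f \<in> hom K X Y" and A: "A \<in> obj (pcat U Y)"
  proof -
    note fh = homD[OF f]
    have o: "X \<in> obj K" "Y \<in> obj K" using fh src_obj tgt_obj by auto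
    note iX = inverse_functorsD[OF inv[OF o(1)]] and iY = inverse_functorsD[OF inv[OF o(2)]]
    interpret VX: category "pcat V X" using functor_category[OF iX(1)] by simp
    have n: "nat_trans (pcat U Y) (pcat V X) (mob s X \<circ>\<^sub>F U\<langle>f\<rangle>) (V\<langle>f\<rangle> \<circ>\<^sub>F mob s Y) (mar s f)"
      "nat_trans (pcat V Y) (pcat U X) (mob t X \<circ>\<^sub>F V\<langle>f\<rangle>) (U\<langle>f\<rangle> \<circ>\<^sub>F mob t Y) (mar t f)"
      using t(1,2) f by (auto simp: pseudo_morphism_def)
    have sA: "ob (mob s Y) A \<in> obj (pcat V Y)" using functor_simps(1)[OF iY(1) A] .
    note ty = nat_transD(3-5)[OF n(1) A] nat_transD(3-5)[OF n(2) sA] comp_functor_simps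
      functor_simps[OF iX(1)] functor_simps[OF iX(2)]
    interpret UX: category "pcat U X" using functor_category[OF iX(1)] by simp
    have UfA: "ob (U\<langle>f\<rangle>) A \<in> obj (pcat U X)"
      using pseudofunctor.pfun_functor[OF _ f, of U] t(1) A by (auto simp: pseudo_morphism_def dest: functor_simps(1))
    have VfA: "ob (V\<langle>f\<rangle>) (ob (mob s Y) A) \<in> obj (pcat V X)"
      using pseudofunctor.pfun_functor[OF _ f, of V] t(1) sA by (auto simp: pseudo_morphism_def dest: functor_simps(1))
    have 1: "mar t f (ob (mob s Y) A) *[pcat U X] ar (mob t X) (mar s f A) = ide (pcat U X) (ob (U\<langle>f\<rangle>) A)"
    proof -
      have "\<forall>f\<in>arr K. \<forall>A\<in>obj (pcat U (tgt K f)). mar t f (ob (mob s (tgt K f)) A) *[pcat U (src K f)]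
          ar (mob t (src K f)) (mar s f A) = ide (pcat U (src K f)) (ob (U\<langle>f\<rangle>) A)"
        using t(3) by (simp add: pmor_eq_def pmor_comp_def pmor_id_def)
      then show ?thesis using fh A by blast
    qed
    have 2: "mar s f A *[pcat V X] ar (mob s X) (mar t f (ob (mob s Y) A)) = ide (pcat V X) (ob (V\<langle>f\<rangle>) (ob (mob s Y) A))"
    proof -
      have "\<forall>f\<in>arr K. \<forall>A\<in>obj (pcat V (tgt K f)). mar s f (ob (mob t (tgt K f)) A) *[pcat V (src K f)]
          ar (mob s (src K f)) (mar t f A) = ide (pcat V (src K f)) (ob (V\<langle>f\<rangle>) A)"
        using t(4) by (simp add: pmor_eq_def pmor_comp_def pmor_id_def)
      then show ?thesis using fh sA iY(3)[OF A] by metis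
    qed
    \<comment> \<open>The identity for \<open>t\<close> after \<open>s\<close> holds in
      \<open>U\<close>. Applying \<open>mob s X\<close> moves it to \<open>V\<close>, where
      \<open>mob s X\<close> and \<open>mob t X\<close> cancel.\<close>
    have 3: "ar (mob s X) (mar t f (ob (mob s Y) A)) *[pcat V X] mar s f A = ide (pcat V X) (ob (mob s X) (ob (U\<langle>f\<rangle>) A))"
    proof -
      have "ar (mob s X) (mar t f (ob (mob s Y) A) *[pcat U X] ar (mob t X) (mar s f A)) =
          ar (mob s X) (mar t f (ob (mob s Y) A)) *[pcat V X] mar s f A"
        using VfA by (subst functor_cmp[OF iX(1)]) (simp_all add: ty iX(6))
      then show ?thesis unfolding 1 using functor_simps(5)[OF iX(1) UfA] by simp
    qed
    show ?thesis
      by (rule VX.iso_arrI[where g = "ar (mob s X) (mar t f (ob (mob s Y) A))"])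
        (simp_all add: ty 2 3 UfA VfA iX iY(3)[OF A])
  qed
qed

text \<open>The pseudofunctor part of \<open>identified\<close>, for arbitrary functors
  \<open>S\<close>, \<open>S'\<close>. With identity functors it returns the pulled-back functors
  and coherence maps unchanged, so that covers and the given pseudofunctors are treated
  alike.\<close>

definition transport where
  "transport C D S S' F =
     \<lparr>pcat = D,
      pfun = (\<lambda>f. S (src C f) \<circ>\<^sub>F F\<langle>f\<rangle> \<circ>\<^sub>F S' (tgt C f)),
      coh = (\<lambda>f g A. ar (S (src C f)) (coh F f g (ob (S' (tgt C g)) A)))\<rparr>"

lemma transport_simps:
  "pcat (transport C D S S' F) = D"
  "ob ((transport C D S S' F)\<langle>f\<rangle>) A = ob (S (src C f)) (ob (F\<langle>f\<rangle>) (ob (S' (tgt C f)) A))"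
  "ar ((transport C D S S' F)\<langle>f\<rangle>) m = ar (S (src C f)) (ar (F\<langle>f\<rangle>) (ar (S' (tgt C f)) m))"
  "(transport C D S S' F)\<langle>f\<rangle> = S (src C f) \<circ>\<^sub>F F\<langle>f\<rangle> \<circ>\<^sub>F S' (tgt C f)"
  "coh (transport C D S S' F) f g A = ar (S (src C f)) (coh F f g (ob (S' (tgt C g)) A))"
  by (simp_all add: transport_def comp_functor_simps)

locale transporting = pseudo_on C R F E
  for C :: "('o, 'a) cat" and R and F :: "('o, 'a, 'r, 's) pseudo" and E +
  fixes D :: "'o \<Rightarrow> ('p, 'q) cat" and S S'
  assumes iso: "X \<in> obj C \<Longrightarrow> inverse_functors (E X) (D X) (S X) (S' X)"
begin

abbreviation "V \<equiv> transport C D S S' F"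

lemma S_fun: "X \<in> obj C \<Longrightarrow> is_functor (E X) (D X) (S X)"
  and S'_fun: "X \<in> obj C \<Longrightarrow> is_functor (D X) (E X) (S' X)"
  using inverse_functorsD[OF iso] by auto

lemma SS':
  assumes "X \<in> obj C"
  shows "x \<in> obj (E X) \<Longrightarrow> ob (S' X) (ob (S X) x) = x" "m \<in> arr (E X) \<Longrightarrow> ar (S' X) (ar (S X) m) = m"
    "y \<in> obj (D X) \<Longrightarrow> ob (S X) (ob (S' X) y) = y" "n \<in> arr (D X) \<Longrightarrow> ar (S X) (ar (S' X) n) = n"
  using inverse_functorsD(3-6)[OF iso[OF assms]] by blast+

lemma V_fun:
  assumes "f \<in> R" "src C f = X" "tgt C f = Y"
  shows "is_functor (D Y) (D X) (V\<langle>f\<rangle>)"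
  using functor_comp[OF S'_fun functor_comp[OF pull[OF assms] S_fun]] R_arr[OF assms(1)] assms
  by (auto simp: transport_simps comp_functor_assoc cat_simps)

lemma R_objs: "f \<in> R \<Longrightarrow> src C f \<in> obj C \<and> tgt C f \<in> obj C"
  using R_arr by (simp add: cat_simps)

lemma V_coh:
  assumes "f \<in> R" "g \<in> R" "src C f = X" "tgt C f = Y" "src C g = Y" "tgt C g = Z"
  shows "nat_iso (D Z) (D X) (V\<langle>f\<rangle> \<circ>\<^sub>F V\<langle>g\<rangle>) (V\<langle>g *[C] f\<rangle>) (coh V f g)"
proof -
  have o: "X \<in> obj C" "Y \<in> obj C" "Z \<in> obj C" using R_objs assms by auto
  have gf: "src C (g *[C] f) = X" "tgt C (g *[C] f) = Z"
    using cmp_arr[OF R_arr R_arr] assms by simp_all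
  note n = nat_iso_whisker_right[OF nat_iso_whisker_left[OF coh_nat[OF assms] S_fun[OF o(1)]] S'_fun[OF o(3)]]
  note fs = functor_simps(1,2)[OF pull[OF assms(2,5,6)]] functor_simps(1,2)[OF S'_fun[OF o(3)]]
  show ?thesis
    by (rule nat_iso_cong, rule nat_iso_functor_cong[OF n])
      (simp_all add: functor_eq_def comp_functor_simps transport_simps assms gf SS'[OF o(2)] fs)
qed

lemma transport_pseudo: "pseudo_on C R V D"
proof (rule pseudo_on.intro[OF category_axioms pseudo_on_axioms.intro])
  interpret P: category "subcat C R" using pseudo by (simp add: pseudofunctor_def)
  have hom: "f \<in> R" "src C f = X" "tgt C f = Y" if "f \<in> hom (subcat C R) X Y" for f X Y
    using that by (auto simp: hom_def subcat_simps)
  show "pseudofunctor (subcat C R) V"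
  proof (rule pseudofunctor.intro[OF P.category_axioms pseudofunctor_axioms.intro])
    show "category (pcat V X)" if "X \<in> obj (subcat C R)" for X
      using that functor_category[OF S_fun] by (simp add: obj_sub transport_simps)
  next
    fix f X Y assume f: "f \<in> hom (subcat C R) X Y"
    show "is_functor (pcat V Y) (pcat V X) (V\<langle>f\<rangle>)"
      using V_fun[OF hom[OF f]] by (simp add: transport_simps(1))
    note h = hom[OF f]
    have o: "X \<in> obj C" "Y \<in> obj C" using R_objs h by auto
    fix A assume "A \<in> obj (pcat V Y)"
    then have A: "A \<in> obj (D Y)" by (simp add: transport_simps)
    note fs = functor_simps[OF S_fun[OF o(1)]] functor_simps[OF S'_fun[OF o(2)] ] functor_simps[OF pull[OF h]]
    show "coh V (ide (subcat C R) X) f A = ide (pcat V X) (ob (V\<langle>f\<rangle>) A)"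
      "coh V f (ide (subcat C R) Y) A = ide (pcat V X) (ob (V\<langle>f\<rangle>) A)"
      using coh_ide[OF h, of "ob (S' Y) A"] A
      by (simp_all add: subcat_simps transport_simps comp_functor_simps h ide_arr o fs)
  next
    fix f g X Y Z assume fg: "f \<in> hom (subcat C R) X Y" "g \<in> hom (subcat C R) Y Z"
    note h = hom[OF fg(1)] hom[OF fg(2)]
    show "nat_iso (pcat V Z) (pcat V X) (V\<langle>f\<rangle> \<circ>\<^sub>F V\<langle>g\<rangle>) (V\<langle>g *[subcat C R] f\<rangle>) (coh V f g)"
      using V_coh[OF h(1,4) h(2,3,5,6)] by (simp add: transport_simps(1) subcat_simps)
    fix k W A assume "k \<in> hom (subcat C R) Z W" and A: "A \<in> obj (pcat V W)"
    note l = h hom[OF this(1)]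
    have o: "X \<in> obj C" "Y \<in> obj C" "Z \<in> obj C" "W \<in> obj C" using R_objs l by auto
    have cc: "g *[C] f \<in> R" "src C (g *[C] f) = X" "tgt C (g *[C] f) = Z"
      "k *[C] g \<in> R" "src C (k *[C] g) = Y" "tgt C (k *[C] g) = W"
      "src C (k *[C] (g *[C] f)) = X"
      using cmp_arr[OF R_arr R_arr] R_cmp l by simp_all
    have A': "ob (S' W) A \<in> obj (E W)"
      using functor_simps(1)[OF S'_fun[OF o(4)]] A by (simp add: transport_simps)
    note ns = coh_nat[OF l(1,4) l(2,3,5,6), THEN nat_isoD(1)] coh_nat[OF l(4,7) l(5,6,8,9), THEN nat_isoD(1)]
      coh_nat[OF cc(1) l(7) cc(2,3) l(8,9), THEN nat_isoD(1)] coh_nat[OF l(1) cc(4) l(2,3) cc(5,6), THEN nat_isoD(1)]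
    note ty = A' ns[THEN nat_trans_typing] comp_functor_simps
      functor_simps[OF pull[OF l(1-3)]] functor_simps[OF pull[OF l(4-6)]] functor_simps[OF pull[OF l(7-9)]]
    show "coh V (g *[subcat C R] f) k A *[pcat V X] coh V f g (ob (V\<langle>k\<rangle>) A) =
        coh V f (k *[subcat C R] g) A *[pcat V X] ar (V\<langle>f\<rangle>) (coh V g k A)"
      using coh_associative[OF l(1,4,7) l(2,3,5,6,8,9) A']
      by (simp add: transport_simps subcat_simps l cc SS'[OF o(3)] SS'[OF o(2)] ty
          functor_cmp[OF S_fun[OF o(1)], symmetric])
  next
    fix X assume "X \<in> obj (subcat C R)"
    then have o: "X \<in> obj C" by (simp add: obj_sub)
    show "functor_eq (pcat V X) (V\<langle>ide (subcat C R) X\<rangle>) id_functor"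
      by (simp add: functor_eq_def transport_simps comp_functor_simps subcat_simps ide_arr o pull_ide SS'[OF o]
          functor_simps(1,2)[OF S'_fun[OF o]] id_functor_simps)
  qed
qed (simp_all add: sub ide_R transport_simps)

end

lemma transport_id:
  "(transport C D (\<lambda>_. id_functor) (\<lambda>_. id_functor) F)\<langle>f\<rangle> = F\<langle>f\<rangle>"
  "coh (transport C D (\<lambda>_. id_functor) (\<lambda>_. id_functor) F) = coh F"
  by (simp_all add: transport_def comp_functor_def id_functor_def)

text \<open>Since \<open>Z\<close> after \<open>m\<close> is \<open>S\<close>, the functors of
  \<open>m\<close> become identities after both transports and only its components remain. Applied
  with identity functors \<open>Z\<close> to the comparison maps of a cover, and with the functors
  of the second cover to an isomorphism of covers.\<close>

lemma strict_iso_transport: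
  assumes "transporting C R F E D S S'" "transporting C R G E' D Z Z'"
    and m: "pseudo_iso (subcat C R) F G m"
    and Zm: "\<And>X. X \<in> obj C \<Longrightarrow> functor_eq (E X) (Z X \<circ>\<^sub>F mob m X) (S X)"
  shows "strict_iso C R D (transport C D S S' F) (transport C D Z Z' G)
    (\<lambda>f A. ar (Z (src C f)) (mar m f (ob (S' (tgt C f)) A)))"
proof -
  interpret F: transporting C R F E D S S' by fact
  interpret G: transporting C R G E' D Z Z' by fact
  obtain m' where m': "\<And>X. X \<in> obj (subcat C R) \<Longrightarrow>
      inverse_functors (pcat F X) (pcat G X) (mob m X) (m' X)"
    using pseudo_iso_functors(1)[OF m] by blast
  note isos = pseudo_iso_functors(2)[OF m]
  note pm = m[unfolded pseudo_iso_def, THEN conjunct1, unfolded pseudo_morphism_def]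
  have mf: "is_functor (E X) (E' X) (mob m X)" if "X \<in> obj C" for X
    using inverse_functorsD(1)[OF m'] that by (simp add: F.obj_sub F.pcat_eq G.pcat_eq)
  have Zm': "ob (Z X) (ob (mob m X) x) = ob (S X) x" "n \<in> arr (E X) \<Longrightarrow> ar (Z X) (ar (mob m X) n) = ar (S X) n"
    if "X \<in> obj C" "x \<in> obj (E X)" for X x n
    using Zm[OF that(1)] that(2) by (auto simp: functor_eq_def comp_functor_simps)
  have Zm_ar: "ar (Z X) (ar (mob m X) n) = ar (S X) n"
    if "X \<in> obj C" "n \<in> arr (E X)" for X n
    using Zm[OF that(1)] that(2) by (auto simp: functor_eq_def comp_functor_simps)
  \<comment> \<open>From \<open>Z m = S\<close> follows \<open>m S' = Z'\<close>, on objects here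
    and on arrows below: apply \<open>Z\<close>, where both sides agree, and undo it by
    \<open>Z'\<close>.\<close>
  have mS: "ob (mob m X) (ob (S' X) y) = ob (Z' X) y" if "X \<in> obj C" "y \<in> obj (D X)" for X y
    using Zm'(1)[OF that(1), of "ob (S' X) y"] functor_simps(1)[OF F.S'_fun[OF that(1)] that(2)]
      functor_simps(1)[OF mf[OF that(1)]] F.SS'(3)[OF that] G.SS'(1)[OF that(1)] by metis
  have mS_ar: "ar (mob m X) (ar (S' X) n) = ar (Z' X) n" if "X \<in> obj C" "n \<in> arr (D X)" for X n
    using Zm_ar[OF that(1), of "ar (S' X) n"] functor_simps(2)[OF F.S'_fun[OF that(1)] that(2)]
      functor_simps(2)[OF mf[OF that(1)]] F.SS'(4)[OF that] G.SS'(2)[OF that(1)] by metis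
  have n: "nat_iso (E Y) (E' X) (mob m X \<circ>\<^sub>F F\<langle>f\<rangle>) (G\<langle>f\<rangle> \<circ>\<^sub>F mob m Y) (mar m f)"
    if "f \<in> R" "src C f = X" "tgt C f = Y" for f X Y
  proof -
    have o: "X \<in> obj C" "Y \<in> obj C" using F.R_objs that by auto
    have "nat_trans (pcat F Y) (pcat G X) (mob m X \<circ>\<^sub>F F\<langle>f\<rangle>) (G\<langle>f\<rangle> \<circ>\<^sub>F mob m Y) (mar m f)"
      using pm F.R_hom[OF that] by blast
    then have "nat_iso (pcat F Y) (pcat G X) (mob m X \<circ>\<^sub>F F\<langle>f\<rangle>) (G\<langle>f\<rangle> \<circ>\<^sub>F mob m Y) (mar m f)"
      by (rule nat_isoI) (rule isos[OF F.R_hom[OF that]])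
    then show ?thesis by (simp add: F.pcat_eq o G.pcat_eq)
  qed
  show ?thesis
    unfolding strict_iso_def
  proof (intro conjI ballI impI)
    fix f assume f: "f \<in> R"
    have o: "src C f \<in> obj C" "tgt C f \<in> obj C" using F.R_objs f by auto
    note w = nat_iso_whisker_right[OF nat_iso_whisker_left[OF n[OF f refl refl] G.S_fun[OF o(1)]] F.S'_fun[OF o(2)]]
    note fs = functor_simps(1,2)[OF F.pull[OF f refl refl]] functor_simps(1,2)[OF F.S'_fun[OF o(2)]]
    show "nat_iso (D (tgt C f)) (D (src C f)) (F.V\<langle>f\<rangle>) (G.V\<langle>f\<rangle>)
        (\<lambda>A. ar (Z (src C f)) (mar m f (ob (S' (tgt C f)) A)))"
      by (rule nat_iso_functor_cong[OF w])
        (simp_all add: functor_eq_def comp_functor_simps transport_simps(2,3) fs Zm'(1)[OF o(1)] Zm_ar[OF o(1)]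
          mS[OF o(2)] mS_ar[OF o(2)])
  next
    fix f g A assume h: "f \<in> R" "g \<in> R" "tgt C f = src C g" and A: "A \<in> obj (D (tgt C g))"
    define X Y W where "X = src C f" and "Y = tgt C f" and "W = tgt C g"
    have t: "src C f = X" "tgt C f = Y" "src C g = Y" "tgt C g = W" using h by (simp_all add: X_def Y_def W_def)
    have o: "X \<in> obj C" "Y \<in> obj C" "W \<in> obj C" using F.R_objs[OF h(1)] F.R_objs[OF h(2)] t by auto
    let ?A = "ob (S' W) A"
    have A': "?A \<in> obj (E W)" using functor_simps(1)[OF F.S'_fun[OF o(3)]] A t by simp
    have gf: "src C (g *[C] f) = X" "tgt C (g *[C] f) = W" "g *[C] f \<in> R"
      using F.cmp_arr[OF F.R_arr[OF h(1)] F.R_arr[OF h(2)]] F.R_cmp[OF h(1,2)] t by simp_all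
    have rel: "coh G f g (ob (mob m W) ?A) *[E' X] (ar (G\<langle>f\<rangle>) (mar m g ?A) *[E' X] mar m f (ob (F\<langle>g\<rangle>) ?A)) =
        mar m (g *[C] f) ?A *[E' X] ar (mob m X) (coh F f g ?A)"
      using pm[THEN conjunct2, THEN conjunct2, THEN conjunct2, THEN conjunct2, THEN conjunct1, rule_format,
          OF F.R_hom[OF h(1) t(1,2)] F.R_hom[OF h(2) t(3,4)], of ?A] A'
      by (simp add: F.pcat_eq o G.pcat_eq subcat_simps)
    interpret EX: category "E' X" using functor_category[OF G.S_fun[OF o(1)]] by simp
    note ns = n[OF h(1) t(1,2), THEN nat_isoD(1)] n[OF h(2) t(3,4), THEN nat_isoD(1)] n[OF gf(3,1,2), THEN nat_isoD(1)]
      F.coh_nat[OF h(1,2) t, THEN nat_isoD(1)] G.coh_nat[OF h(1,2) t, THEN nat_isoD(1)]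
    note ty = A' ns[THEN nat_trans_typing] comp_functor_simps
      functor_simps[OF F.pull[OF h(1) t(1,2)]] functor_simps[OF F.pull[OF h(2) t(3,4)]]
      functor_simps[OF G.pull[OF h(1) t(1,2)]] functor_simps[OF G.pull[OF h(2) t(3,4)]]
      functor_simps[OF mf[OF o(1)]] functor_simps[OF mf[OF o(3)]] functor_simps[OF mf[OF o(2)]]
    show "coh G.V f g A *[D (src C f)] (ar (G.V\<langle>f\<rangle>) (ar (Z (src C g)) (mar m g (ob (S' (tgt C g)) A))) *[D (src C f)]
          ar (Z (src C f)) (mar m f (ob (S' (tgt C f)) (ob (F.V\<langle>g\<rangle>) A)))) =
        ar (Z (src C (g *[C] f))) (mar m (g *[C] f) (ob (S' (tgt C (g *[C] f))) A)) *[D (src C f)] coh F.V f g A"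
      using rel A mS[OF o(3), of A]
      by (simp add: transport_simps t gf F.SS'[OF o(2)] G.SS'[OF o(2)] ty Zm_ar[OF o(1), symmetric]
          functor_simps(1)[OF G.S'_fun[OF o(3)]]
          functor_cmp[OF G.S_fun[OF o(1)], symmetric] EX.cat_simps)
  qed
qed

section \<open>Flat base change for a cover with values in the given categories\<close>

text \<open>The situation after identification: \<open>V\<close> is the pseudofunctor of the cover
  with values in \<open>pcat T X\<close>, the comparison maps are strict isomorphisms, and the last
  two assumptions are the cover conditions on squares and on sections with every
  \<open>S\<^sub>X\<close> an identity.\<close>

locale transported = flat_data C Oc Pc T B \<beta> \<phi> Fc Fl \<gamma>T \<gamma>B
  for C :: "('o, 'a) cat" and Oc Pc and T B :: "('o, 'a, 'p, 'q) pseudo" and \<beta> \<phi> Fc Fl \<gamma>T \<gamma>B +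
  fixes V :: "('o, 'a, 'p, 'q) pseudo" and \<mu>T \<mu>B
  assumes V_pseudo: "pseudo_on C (generated_subcategory C (Oc \<union> Pc)) V (pcat T)"
    and \<mu>T: "strict_iso C Pc (pcat T) V T \<mu>T"
    and \<mu>B: "strict_iso C Oc (pcat T) V B \<mu>B"
    and \<beta>_compat: "\<lbrakk>cartesian C f i f' i'; f \<in> Pc; i \<in> Oc; A \<in> obj (pcat T (tgt C f))\<rbrakk> \<Longrightarrow>
      \<beta> f i f' i' A *[pcat T (src C f')]
        (ar (B\<langle>i'\<rangle>) (\<mu>T f A) *[pcat T (src C f')] \<mu>B i' (ob (V\<langle>f\<rangle>) A)) =
      ar (T\<langle>f'\<rangle>) (\<mu>B i A) *[pcat T (src C f')] (\<mu>T f' (ob (V\<langle>i\<rangle>) A) *[pcat T (src C f')]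
        (inv_arr (pcat T (src C f')) (coh V f' i A) *[pcat T (src C f')] coh V i' f A))"
    and \<phi>_compat: "\<lbrakk>retract_pair C i h; i \<in> Pc; h \<in> Oc; A \<in> obj (pcat T (src C i))\<rbrakk> \<Longrightarrow>
      \<phi> i h A *[pcat T (src C i)] (ar (T\<langle>i\<rangle>) (\<mu>B h A) *[pcat T (src C i)] \<mu>T i (ob (V\<langle>h\<rangle>) A)) =
      coh V i h A"
begin

abbreviation "Q \<equiv> generated_subcategory C (Oc \<union> Pc)"
abbreviation "D \<equiv> pcat T"

lemma ide_mem:
  assumes "X \<in> obj C"
  shows "ide C X \<in> Oc" "ide C X \<in> Pc" "ide C X \<in> Fc"
  using iso_Oc iso_Pc iso_Fc iso_ide[OF assms] by blast+

lemma OP_arr: "Oc \<union> Pc \<subseteq> arr C"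
  using subcategoryD(1)[OF Oc_subcategory] subcategoryD(1)[OF Pc_subcategory] by blast

lemma OP_Q: "f \<in> Oc \<Longrightarrow> f \<in> Q" "f \<in> Pc \<Longrightarrow> f \<in> Q"
  using generated_subcategory(2)[OF OP_arr] by blast+

lemma OP_exists: "f \<in> Oc \<union> Pc \<Longrightarrow> u \<in> Fc \<Longrightarrow> tgt C u = tgt C f \<Longrightarrow> \<exists>f' u'. cartesian C f u f' u'"
  using Fc_stable cartesian_sym unfolding stable_under_base_change_def by blast

lemma OP_square:
  assumes "cartesian C f u f' u'" "u \<in> Fc"
  shows "f \<in> Oc \<Longrightarrow> f' \<in> Oc \<and> u' \<in> Fc" "f \<in> Pc \<Longrightarrow> f' \<in> Pc \<and> u' \<in> Fc"
  using assms cartesianD(1,2,5)[OF assms(1)] cartesian_sym[OF assms(1)] Fc_stable Oc_stable Pc_stable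
  unfolding stable_under_base_change_def by (metis UnI1 UnI2)+

lemma base_stable:
  assumes "cartesian C f g f' g'" "g \<in> arr C"
  shows "f \<in> Oc \<Longrightarrow> f' \<in> Oc" "f \<in> Pc \<Longrightarrow> f' \<in> Pc"
  using assms cartesianD(5)[OF assms(1)] Oc_stable Pc_stable
  unfolding stable_under_base_change_def by metis+

lemma Q_square: "cartesian C f u f' u' \<Longrightarrow> f \<in> Q \<Longrightarrow> u \<in> Fc \<Longrightarrow> f' \<in> Q \<and> u' \<in> Fc"
  using generated_base_change(2)[OF _ OP_arr _ OP_exists, of f Fc u f' u'] ide_mem OP_square by blast

lemma Q_exists: "f \<in> Q \<Longrightarrow> u \<in> Fc \<Longrightarrow> tgt C u = tgt C f \<Longrightarrow> \<exists>f' u'. cartesian C f u f' u'"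
  using generated_base_change(1)[OF _ OP_arr _ OP_exists, of f Fc u] ide_mem OP_square by blast

lemma T_pseudo: "pseudo_on C Pc T D"
  by (rule pseudo_on.intro[OF category_axioms pseudo_on_axioms.intro])
    (simp_all add: Pc_subcategory ide_mem T_pseudofunctor)

lemma B_pseudo: "pseudo_on C Oc B D"
  by (rule pseudo_on.intro[OF category_axioms pseudo_on_axioms.intro])
    (simp_all add: Oc_subcategory ide_mem B_pseudofunctor same_cat)

lemma Fl_pseudo: "pseudo_on C Fc Fl D"
  by (rule pseudo_on.intro[OF category_axioms pseudo_on_axioms.intro])
    (simp_all add: Fc_subcategory ide_mem Fl_pseudofunctor Fl_same_cat)

sublocale V: flat_pseudo C Q V Fc Fl D
  by (rule flat_pseudo.intro[OF V_pseudo Fl_pseudo flat_pseudo_axioms.intro]) (rule Q_square)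

sublocale T: flat_pseudo C Pc T Fc Fl D
  by (rule flat_pseudo.intro[OF T_pseudo Fl_pseudo flat_pseudo_axioms.intro]) (rule OP_square(2))

sublocale B: flat_pseudo C Oc B Fc Fl D
  by (rule flat_pseudo.intro[OF B_pseudo Fl_pseudo flat_pseudo_axioms.intro]) (rule OP_square(1))

text \<open>\<open>cT.\<delta>\<close> is \<open>\<gamma>T\<close> carried over to the restriction
  of \<open>V\<close> to \<open>P\<close>; \<open>cB.\<delta>\<close> plays the same part for
  \<open>O\<close>. These are the two sections to be glued.\<close>

sublocale cT: conjugation C Pc V T Fc Fl D \<mu>T \<gamma>T
proof (rule conjugation.intro[OF _ T.flat_pseudo_axioms conjugation_axioms.intro[OF \<mu>T \<gamma>T_base_change]])
  show "flat_pseudo C Pc V Fc Fl D"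
    by (rule flat_pseudo.intro[OF V.restrict Fl_pseudo flat_pseudo_axioms.intro])
      (use Pc_subcategory OP_Q ide_mem OP_square in auto)
qed

sublocale cB: conjugation C Oc V B Fc Fl D \<mu>B \<gamma>B
proof (rule conjugation.intro[OF _ B.flat_pseudo_axioms conjugation_axioms.intro[OF \<mu>B \<gamma>B_base_change]])
  show "flat_pseudo C Oc V Fc Fl D"
    by (rule flat_pseudo.intro[OF V.restrict Fl_pseudo flat_pseudo_axioms.intro])
      (use Oc_subcategory OP_Q ide_mem OP_square in auto)
qed

section \<open>The cube condition and the condition on sections as statements about pastes in
  \<open>V\<close>\<close>

lemma \<beta>_nat:
  assumes "cartesian C f i f' i'" "f \<in> Pc" "i \<in> Oc"
  shows "nat_iso (D (tgt C f)) (D (src C f')) (B\<langle>i'\<rangle> \<circ>\<^sub>F T\<langle>f\<rangle>) (T\<langle>f'\<rangle> \<circ>\<^sub>F B\<langle>i\<rangle>) (\<beta> f i f' i')"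
  by (rule base_change.bc_iso[OF \<beta>_base_change assms])

text \<open>The cube condition concerns \<open>T\<close>, \<open>B\<close> and \<beta>, the
  conclusion only \<open>V\<close>. Conjugation turns \<beta> into the comparison of two coherence
  maps of \<open>V\<close>, and exactly this comparison separates the equations characterising the
  two pastes.\<close>

lemma cube_exchange:
  assumes f: "f \<in> Pc" and g: "g \<in> Oc" and u: "u \<in> Fc"
    and s: "cartesian C f g f2 g2" "cartesian C f u f3 u2" "cartesian C g u g3 u3"
      "cartesian C g2 u2 g1 u1" "cartesian C f2 u3 f1 u1" "cartesian C f3 g3 f1 g1"
    and A0: "A \<in> obj (D (tgt C f))"
  shows "V.paste f f3 u g2 g1 u1 (cT.\<delta> f u f3 u2) (cB.\<delta> g2 u2 g1 u1) A =
      V.paste g g3 u f2 f1 u1 (cB.\<delta> g u g3 u3) (cT.\<delta> f2 u3 f1 u1) A"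
proof -
  obtain X Y X' Y' where t: "src C f = X" "tgt C f = Y" "src C f3 = X'" "tgt C f3 = Y'"
    "src C u = Y'" "tgt C u = Y" "src C u2 = X'" "tgt C u2 = X" "f3 \<in> Pc" "u2 \<in> Fc"
    by (rule T.square[OF s(2) f u])
  obtain Z Z' where t1: "src C g = Z" "tgt C g = Y" "src C g3 = Z'" "tgt C g3 = Y'"
    "src C u3 = Z'" "tgt C u3 = Z" "g3 \<in> Oc" "u3 \<in> Fc"
    using B.square[OF s(3) g u] t by metis
  have f2: "f2 \<in> Pc" "g2 \<in> Oc"
    using base_stable(2)[OF s(1) _ f] base_stable(1)[OF cartesian_sym[OF s(1)] _ g] cartesianD(1,2)[OF s(1)] by auto
  obtain P P' where t2: "src C f2 = P" "tgt C f2 = Z" "src C f1 = P'" "tgt C f1 = Z'"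
    "src C u1 = P'" "tgt C u1 = P" "f1 \<in> Pc" "u1 \<in> Fc" "P \<in> obj C" "P' \<in> obj C"
    using T.square[OF s(5) f2(1) t1(8)] t1 by metis
  have t3: "src C g2 = P" "tgt C g2 = X" "src C g1 = P'" "tgt C g1 = X'" "g1 \<in> Oc"
    using cartesianD[OF s(1)] cartesianD[OF s(6)] OP_square(1)[OF s(4) t(10) f2(2)] t t2 by simp_all
  note all = t t1 t2 t3
  have A: "A \<in> obj (D Y)" using A0 t by simp
  have Fs: "is_functor (D Y) (D X) (V\<langle>f\<rangle>)" "is_functor (D Y) (D Z) (V\<langle>g\<rangle>)" "is_functor (D Z) (D P) (V\<langle>f2\<rangle>)"
    "is_functor (D X) (D P) (V\<langle>g2\<rangle>)" "is_functor (D Y') (D X') (V\<langle>f3\<rangle>)" "is_functor (D Y') (D Z') (V\<langle>g3\<rangle>)"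
    "is_functor (D Z') (D P') (V\<langle>f1\<rangle>)" "is_functor (D X') (D P') (V\<langle>g1\<rangle>)"
    "is_functor (D Y) (D X) (T\<langle>f\<rangle>)" "is_functor (D Y) (D Z) (B\<langle>g\<rangle>)" "is_functor (D Z) (D P) (T\<langle>f2\<rangle>)"
    "is_functor (D X) (D P) (B\<langle>g2\<rangle>)" "is_functor (D Y') (D X') (T\<langle>f3\<rangle>)" "is_functor (D Y') (D Z') (B\<langle>g3\<rangle>)"
    "is_functor (D Z') (D P') (T\<langle>f1\<rangle>)" "is_functor (D X') (D P') (B\<langle>g1\<rangle>)"
    using V.pull T.pull B.pull OP_Q f g f2 all by simp_all
  have Us: "is_functor (D Y) (D Y') (Fl\<langle>u\<rangle>)" "is_functor (D X) (D X') (Fl\<langle>u2\<rangle>)" "is_functor (D Z) (D Z') (Fl\<langle>u3\<rangle>)"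
    "is_functor (D P) (D P') (Fl\<langle>u1\<rangle>)"
    using V.Fl.pull u all by simp_all
  have \<mu>i: "nat_iso (D Y) (D X) (V\<langle>f\<rangle>) (T\<langle>f\<rangle>) (\<mu>T f)" "nat_iso (D Y) (D Z) (V\<langle>g\<rangle>) (B\<langle>g\<rangle>) (\<mu>B g)"
    "nat_iso (D Z) (D P) (V\<langle>f2\<rangle>) (T\<langle>f2\<rangle>) (\<mu>T f2)" "nat_iso (D X) (D P) (V\<langle>g2\<rangle>) (B\<langle>g2\<rangle>) (\<mu>B g2)"
    "nat_iso (D Y') (D X') (V\<langle>f3\<rangle>) (T\<langle>f3\<rangle>) (\<mu>T f3)" "nat_iso (D Y') (D Z') (V\<langle>g3\<rangle>) (B\<langle>g3\<rangle>) (\<mu>B g3)"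
    "nat_iso (D Z') (D P') (V\<langle>f1\<rangle>) (T\<langle>f1\<rangle>) (\<mu>T f1)" "nat_iso (D X') (D P') (V\<langle>g1\<rangle>) (B\<langle>g1\<rangle>) (\<mu>B g1)"
    using strict_isoD(1)[OF \<mu>T] strict_isoD(1)[OF \<mu>B] f g f2 all by simp_all
  note qf = cT.conjugate_square[OF s(2) f u] and qf2 = cT.conjugate_square[OF s(5) f2(1) t1(8)]
    and qg = cB.conjugate_square[OF s(3) g u] and qg2 = cB.conjugate_square[OF s(4) f2(2) t(10)]
  note \<delta>s = qf(1)[unfolded all] qf2(1)[unfolded all] qg(1)[unfolded all] qg2(1)[unfolded all]
  note \<gamma>s = T.base_changeD(1)[OF \<gamma>T_base_change s(2) f u, unfolded all]
    T.base_changeD(1)[OF \<gamma>T_base_change s(5) f2(1) t1(8), unfolded all]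
    B.base_changeD(1)[OF \<gamma>B_base_change s(3) g u, unfolded all]
    B.base_changeD(1)[OF \<gamma>B_base_change s(4) f2(2) t(10), unfolded all]
  note \<beta>s = \<beta>_nat[OF s(1) f g, unfolded all] \<beta>_nat[OF s(6) t(9) t1(7), unfolded all]
  have ch: "nat_iso (D Y) (D P) (V\<langle>g2\<rangle> \<circ>\<^sub>F V\<langle>f\<rangle>) (V\<langle>f *[C] g2\<rangle>) (coh V g2 f)"
    "nat_iso (D Y) (D P) (V\<langle>f2\<rangle> \<circ>\<^sub>F V\<langle>g\<rangle>) (V\<langle>f *[C] g2\<rangle>) (coh V f2 g)"
    "nat_iso (D Y') (D P') (V\<langle>g1\<rangle> \<circ>\<^sub>F V\<langle>f3\<rangle>) (V\<langle>f3 *[C] g1\<rangle>) (coh V g1 f3)"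
    "nat_iso (D Y') (D P') (V\<langle>f1\<rangle> \<circ>\<^sub>F V\<langle>g3\<rangle>) (V\<langle>f3 *[C] g1\<rangle>) (coh V f1 g3)"
    using V.coh_nat[OF OP_Q(1)[OF f2(2)] OP_Q(2)[OF f] t3(1,2) t(1,2)]
      V.coh_nat[OF OP_Q(2)[OF f2(1)] OP_Q(1)[OF g] t2(1,2) t1(1,2)]
      V.coh_nat[OF OP_Q(1)[OF t3(5)] OP_Q(2)[OF t(9)] t3(3,4) t(3,4)]
      V.coh_nat[OF OP_Q(2)[OF t2(7)] OP_Q(1)[OF t1(7)] t2(3,4) t1(3,4)]
    unfolding cartesian_commute[OF s(1)] cartesian_commute[OF s(6)] by simp_all
  let ?x = "V.paste g g3 u f2 f1 u1 (cB.\<delta> g u g3 u3) (cT.\<delta> f2 u3 f1 u1)"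
  note px = V.paste_iso[OF s(3) OP_Q(1)[OF g] u s(5) OP_Q(2)[OF f2(1)] qg(1) qf2(1)]
  have pt: "tgt C (f *[C] g2) = Y" "src C (f3 *[C] g1) = P'"
    using cmp_arr(2,3) V.R_arr OP_Q f f2 all by simp_all
  have xn: "nat_iso (D Y) (D P') (Fl\<langle>u1\<rangle> \<circ>\<^sub>F V\<langle>f *[C] g2\<rangle>) (V\<langle>f3 *[C] g1\<rangle> \<circ>\<^sub>F Fl\<langle>u\<rangle>) ?x"
    using px(1) unfolding cartesian_commute[OF s(1), symmetric] cartesian_commute[OF s(6), symmetric] pt .
  note ni = \<mu>i \<delta>s \<gamma>s \<beta>s ch xn
  note ns = ni[THEN nat_isoD(1)]
  note ty = A comp_functor_simps Fs[THEN functor_typing] Us[THEN functor_typing]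
    ns[THEN nat_trans_typing]
  interpret Q: category "D P'" using functor_category[OF Us(4)] by simp
  interpret P: category "D P" using functor_category[OF Us(4)] by simp
  interpret Z: category "D Z'" using functor_category[OF Us(3)] by simp
  define uA where "uA = ob (Fl\<langle>u\<rangle>) A"
  have uA: "uA \<in> obj (D Y')" by (simp add: uA_def ty)
  note isos = nat_isoD(2)[OF ch(2) A] nat_isoD(2)[OF ch(4) uA] nat_isoD(2)[OF \<gamma>s(3) A]
    nat_isoD(2)[OF \<gamma>s(4) functor_simps(1)[OF Fs(9) A]]
  note i1 = P.iso_simps[OF isos(1)] P.iso_cancel[OF isos(1)] Q.iso_simps[OF isos(2)] Q.iso_cancel[OF isos(2)]
    Z.iso_simps[OF isos(3)] Q.iso_simps[OF isos(4)] Q.iso_cancel[OF isos(4)]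
  \<comment> \<open>\<open>?b\<close> compares the two coherence maps over the face of
    \<open>f\<close> and \<open>g\<close>, \<open>?b'\<close> those over the opposite face. By
    \<open>\<beta>_compat\<close> they are what \<beta> becomes after conjugation; \<open>b1\<close>
    and \<open>b2\<close> below say so.\<close>
  let ?b = "inv_arr (D P) (coh V f2 g A) *[D P] coh V g2 f A"
  let ?b' = "inv_arr (D P') (coh V f1 g3 uA) *[D P'] coh V g1 f3 uA"
  have bty: "?b \<in> arr (D P)" "src (D P) ?b = ob (V\<langle>g2\<rangle>) (ob (V\<langle>f\<rangle>) A)" "tgt (D P) ?b = ob (V\<langle>f2\<rangle>) (ob (V\<langle>g\<rangle>) A)"
    "?b' \<in> arr (D P')" "src (D P') ?b' = ob (V\<langle>g1\<rangle>) (ob (V\<langle>f3\<rangle>) uA)" "tgt (D P') ?b' = ob (V\<langle>f1\<rangle>) (ob (V\<langle>g3\<rangle>) uA)"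
    by (simp_all add: ty P.cat_simps Q.cat_simps i1 uA)
  have b: "coh V g2 f A = coh V f2 g A *[D P] ?b" "coh V g1 f3 uA = coh V f1 g3 uA *[D P'] ?b'"
    by (simp_all add: ty i1 uA)
  have b1: "ar (Fl\<langle>u1\<rangle>) (\<beta> f g f2 g2 A) *[D P']
        (ar (Fl\<langle>u1\<rangle>) (ar (B\<langle>g2\<rangle>) (\<mu>T f A)) *[D P'] ar (Fl\<langle>u1\<rangle>) (\<mu>B g2 (ob (V\<langle>f\<rangle>) A))) =
      ar (Fl\<langle>u1\<rangle>) (ar (T\<langle>f2\<rangle>) (\<mu>B g A)) *[D P']
        (ar (Fl\<langle>u1\<rangle>) (\<mu>T f2 (ob (V\<langle>g\<rangle>) A)) *[D P'] ar (Fl\<langle>u1\<rangle>) ?b)"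
    using \<beta>_compat[OF s(1) f g, of A] A bty
    by (simp add: functor_cmp[OF Us(4), symmetric] ty all P.cmp_arr)
  have b2: "\<beta> f3 g3 f1 g1 uA *[D P'] (ar (B\<langle>g1\<rangle>) (\<mu>T f3 uA) *[D P'] \<mu>B g1 (ob (V\<langle>f3\<rangle>) uA)) =
      ar (T\<langle>f1\<rangle>) (\<mu>B g3 uA) *[D P'] (\<mu>T f1 (ob (V\<langle>g3\<rangle>) uA) *[D P'] ?b')"
    using \<beta>_compat[OF s(6) t(9) t1(7), of uA] uA by (simp add: all)
  let ?gP = "ar (V\<langle>g1\<rangle>) (cT.\<delta> f u f3 u2 A)" and ?gO = "cB.\<delta> g2 u2 g1 u1 (ob (V\<langle>f\<rangle>) A)"
  let ?hO = "ar (V\<langle>f1\<rangle>) (cB.\<delta> g u g3 u3 A)" and ?hP = "cT.\<delta> f2 u3 f1 u1 (ob (V\<langle>g\<rangle>) A)"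
  have c1: "ar (B\<langle>g1\<rangle>) (\<mu>T f3 uA) *[D P'] (\<mu>B g1 (ob (V\<langle>f3\<rangle>) uA) *[D P'] (?gP *[D P'] ?gO)) =
      ar (B\<langle>g1\<rangle>) (\<gamma>T f u f3 u2 A) *[D P'] (\<gamma>B g2 u2 g1 u1 (ob (T\<langle>f\<rangle>) A) *[D P']
        (ar (Fl\<langle>u1\<rangle>) (ar (B\<langle>g2\<rangle>) (\<mu>T f A)) *[D P'] ar (Fl\<langle>u1\<rangle>) (\<mu>B g2 (ob (V\<langle>f\<rangle>) A))))"
    unfolding uA_def
    by (rule paste_conjugate[OF Us(1,2,4) ns(1,4,5,8) ns(9,13,12,16) qf(2)[unfolded all] qg2(2)[unfolded all] A])
  have c2: "ar (T\<langle>f1\<rangle>) (\<mu>B g3 uA) *[D P'] (\<mu>T f1 (ob (V\<langle>g3\<rangle>) uA) *[D P'] (?hO *[D P'] ?hP)) =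
      ar (T\<langle>f1\<rangle>) (\<gamma>B g u g3 u3 A) *[D P'] (\<gamma>T f2 u3 f1 u1 (ob (B\<langle>g\<rangle>) A) *[D P']
        (ar (Fl\<langle>u1\<rangle>) (ar (T\<langle>f2\<rangle>) (\<mu>B g A)) *[D P'] ar (Fl\<langle>u1\<rangle>) (\<mu>T f2 (ob (V\<langle>g\<rangle>) A))))"
    unfolding uA_def
    by (rule paste_conjugate[OF Us(1,3,4) ns(2,3,6,7) ns(11,15,10,14) qg(2)[unfolded all] qf2(2)[unfolded all] A])
  \<comment> \<open>The cube condition with both inverses of \<open>\<gamma>B\<close> moved to the
    other side.\<close>
  have cube': "ar (T\<langle>f1\<rangle>) (\<gamma>B g u g3 u3 A) *[D P'] (\<gamma>T f2 u3 f1 u1 (ob (B\<langle>g\<rangle>) A) *[D P'] ar (Fl\<langle>u1\<rangle>) (\<beta> f g f2 g2 A)) =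
      \<beta> f3 g3 f1 g1 uA *[D P'] (ar (B\<langle>g1\<rangle>) (\<gamma>T f u f3 u2 A) *[D P'] \<gamma>B g2 u2 g1 u1 (ob (T\<langle>f\<rangle>) A))"
      (is "?l1 *[D P'] (?l2 *[D P'] ?l3) = ?r1 *[D P'] (?r2 *[D P'] ?r3)")
  proof -
    have k: "?l1 *[D P'] ar (T\<langle>f1\<rangle>) (inv_arr (D Z') (\<gamma>B g u g3 u3 A)) = ide (D P') (ob (T\<langle>f1\<rangle>) (ob (B\<langle>g3\<rangle>) uA))"
      using functor_simps(5)[OF Fs(15), of "ob (B\<langle>g3\<rangle>) uA"] uA
      by (simp add: functor_cmp[OF Fs(15), symmetric] i1 ty uA_def)
    have c: "?l2 *[D P'] (?l3 *[D P'] inv_arr (D P') ?r3) =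
        ar (T\<langle>f1\<rangle>) (inv_arr (D Z') (\<gamma>B g u g3 u3 A)) *[D P'] (?r1 *[D P'] ?r2)"
      using cube[OF f g u s, of A] A by (simp add: all uA_def)
    have "?l1 *[D P'] (?l2 *[D P'] ?l3) =
        (?l1 *[D P'] (?l2 *[D P'] (?l3 *[D P'] inv_arr (D P') ?r3))) *[D P'] ?r3"
      by (simp add: Q.cat_simps ty i1)
    also have "\<dots> = ?r1 *[D P'] (?r2 *[D P'] ?r3)"
      unfolding c by (simp add: Q.cat_simps ty i1 Q.reassoc[OF k] uA_def)
    finally show ?thesis .
  qed
  \<comment> \<open>The conjugated cube condition. Both sides are composed with the invertible
    \<open>?n1\<close> and \<open>?n2\<close>; then \<open>c2\<close>, \<open>b1\<close>,
    \<open>cube'\<close>, \<open>c1\<close> and \<open>b2\<close> are applied in turn.\<close>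
  have key: "?hO *[D P'] (?hP *[D P'] ar (Fl\<langle>u1\<rangle>) ?b) = ?b' *[D P'] (?gP *[D P'] ?gO)"
  proof -
    let ?n1 = "ar (T\<langle>f1\<rangle>) (\<mu>B g3 uA)" and ?n2 = "\<mu>T f1 (ob (V\<langle>g3\<rangle>) uA)"
    let ?c1 = "ar (Fl\<langle>u1\<rangle>) (ar (B\<langle>g2\<rangle>) (\<mu>T f A)) *[D P'] ar (Fl\<langle>u1\<rangle>) (\<mu>B g2 (ob (V\<langle>f\<rangle>) A))"
    have uAe: "ob (Fl\<langle>u\<rangle>) A = uA" by (simp add: uA_def)
    note ty' = ty uA uAe Q.cat_simps bty functor_simps(2-4)[OF Us(4) bty(1)]
    have "?n1 *[D P'] (?n2 *[D P'] (?hO *[D P'] (?hP *[D P'] ar (Fl\<langle>u1\<rangle>) ?b))) =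
        (?n1 *[D P'] (?n2 *[D P'] (?hO *[D P'] ?hP))) *[D P'] ar (Fl\<langle>u1\<rangle>) ?b"
      by (simp add: ty')
    also have "\<dots> = (ar (T\<langle>f1\<rangle>) (\<gamma>B g u g3 u3 A) *[D P'] \<gamma>T f2 u3 f1 u1 (ob (B\<langle>g\<rangle>) A)) *[D P']
        (ar (Fl\<langle>u1\<rangle>) (ar (T\<langle>f2\<rangle>) (\<mu>B g A)) *[D P']
        (ar (Fl\<langle>u1\<rangle>) (\<mu>T f2 (ob (V\<langle>g\<rangle>) A)) *[D P'] ar (Fl\<langle>u1\<rangle>) ?b))"
      unfolding c2 by (simp add: ty')
    also have "\<dots> = (ar (T\<langle>f1\<rangle>) (\<gamma>B g u g3 u3 A) *[D P'] (\<gamma>T f2 u3 f1 u1 (ob (B\<langle>g\<rangle>) A) *[D P']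
        ar (Fl\<langle>u1\<rangle>) (\<beta> f g f2 g2 A))) *[D P'] ?c1"
      unfolding b1[symmetric] by (simp add: ty')
    also have "\<dots> = \<beta> f3 g3 f1 g1 uA *[D P'] (ar (B\<langle>g1\<rangle>) (\<gamma>T f u f3 u2 A) *[D P']
        (\<gamma>B g2 u2 g1 u1 (ob (T\<langle>f\<rangle>) A) *[D P'] ?c1))"
      unfolding cube' by (simp add: ty')
    also have "\<dots> = (\<beta> f3 g3 f1 g1 uA *[D P'] (ar (B\<langle>g1\<rangle>) (\<mu>T f3 uA) *[D P'] \<mu>B g1 (ob (V\<langle>f3\<rangle>) uA))) *[D P']
        (?gP *[D P'] ?gO)"
      unfolding c1[symmetric] by (simp add: ty')
    also have "\<dots> = ?n1 *[D P'] (?n2 *[D P'] (?b' *[D P'] (?gP *[D P'] ?gO)))"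
      unfolding b2 by (simp add: ty' i1)
    finally have e: "?n1 *[D P'] (?n2 *[D P'] (?hO *[D P'] (?hP *[D P'] ar (Fl\<langle>u1\<rangle>) ?b))) =
      ?n1 *[D P'] (?n2 *[D P'] (?b' *[D P'] (?gP *[D P'] ?gO)))" .
    have i: "iso_arr (D P') ?n1" "iso_arr (D P') ?n2"
      using functor_iso(1)[OF Fs(15) nat_isoD(2)[OF \<mu>i(6) uA]] nat_isoD(2)[OF \<mu>i(7)] by (simp_all add: ty uA)
    have "?n2 *[D P'] (?hO *[D P'] (?hP *[D P'] ar (Fl\<langle>u1\<rangle>) ?b)) =
        ?n2 *[D P'] (?b' *[D P'] (?gP *[D P'] ?gO))"
      by (rule Q.iso_left_cancel[OF e i(1)]) (simp_all add: ty')
    then show ?thesis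
      by (rule Q.iso_left_cancel[OF _ i(2)]) (simp_all add: ty')
  qed
  show ?thesis
  proof (rule V.paste_eqI[OF s(2) OP_Q(2)[OF f] u s(4) OP_Q(1)[OF f2(2)] qf(1) qg2(1) A0])
    show "?x A \<in> arr (D (src C g1))" "src (D (src C g1)) (?x A) = ob (Fl\<langle>u1\<rangle>) (ob (V\<langle>f *[C] g2\<rangle>) A)"
      by (simp_all add: ty all)
    \<comment> \<open>The paste \<open>?x\<close> is characterised through the coherence map of
      \<open>f2\<close>, \<open>g\<close>. Passing to that of \<open>g2\<close>, \<open>f\<close>
      costs \<open>Fl\<langle>u1\<rangle>\<close> of \<open>?b\<close>, which \<open>key\<close>
      turns into \<open>?b'\<close> on the other side.\<close>
    have ux: "?x A *[D P'] ar (Fl\<langle>u1\<rangle>) (coh V f2 g A) = coh V f1 g3 uA *[D P'] (?hO *[D P'] ?hP)"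
      using px(2)[of A] by (simp add: all A uA_def)
    have "?x A *[D P'] ar (Fl\<langle>u1\<rangle>) (coh V g2 f A) =
        (?x A *[D P'] ar (Fl\<langle>u1\<rangle>) (coh V f2 g A)) *[D P'] ar (Fl\<langle>u1\<rangle>) ?b"
      by (subst b(1), subst functor_cmp[OF Us(4)])
        (simp_all add: ty bty Q.cat_simps functor_simps(2-4)[OF Us(4) bty(1)])
    also have "\<dots> = coh V f1 g3 uA *[D P'] (?hO *[D P'] (?hP *[D P'] ar (Fl\<langle>u1\<rangle>) ?b))"
      unfolding ux by (simp add: ty uA bty Q.cat_simps functor_simps(2-4)[OF Us(4) bty(1)] uA_def)
    also have "\<dots> = (coh V f1 g3 uA *[D P'] ?b') *[D P'] (?gP *[D P'] ?gO)"
      unfolding key by (rule Q.cmp_assoc[symmetric]) (simp_all add: ty uA bty Q.cmp_arr, simp_all add: uA_def)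
    also have "\<dots> = coh V g1 f3 uA *[D P'] (?gP *[D P'] ?gO)" unfolding b(2)[symmetric] ..
    finally show "?x A *[D (src C g1)] ar (Fl\<langle>u1\<rangle>) (coh V g2 f A) = coh V g1 f3 (ob (Fl\<langle>u\<rangle>) A) *[D (src C g1)]
        (?gP *[D (src C g1)] ?gO)"
      unfolding t3 uA_def .
  qed
qed

text \<open>By \<open>\<phi>_compat\<close> the coherence map of a section and its retraction is
  \<phi> composed with the comparison maps, for the given pair as well as for its base change. The
  flatness condition on \<phi> relates the two, and the result is the equation characterising the
  paste with an identity in place of the paste.\<close>

lemma retract_paste:
  assumes f: "f \<in> Pc" and g: "g \<in> Oc" and u: "u \<in> Fc"
    and r: "retract_pair C f g" "retract_pair C f' g'"
    and s: "cartesian C g u g' u'" "cartesian C f u' f' u"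
    and A0: "A \<in> obj (D (tgt C g))"
  shows "V.paste g g' u f f' u (cB.\<delta> g u g' u') (cT.\<delta> f u' f' u) A = ide (D (src C u)) (ob (Fl\<langle>u\<rangle>) A)"
proof -
  obtain X Y X' Y' where t: "src C g = Y" "tgt C g = X" "src C g' = Y'" "tgt C g' = X'"
    "src C u = X'" "tgt C u = X" "src C u' = Y'" "tgt C u' = Y" "g' \<in> Oc" "u' \<in> Fc"
    "X \<in> obj C" "X' \<in> obj C"
    by (rule B.square[OF s(1) g u])
  have t1: "src C f = X" "tgt C f = Y" "src C f' = X'" "tgt C f' = Y'" "f' \<in> Pc"
    using cartesianD[OF s(2)] OP_square(2)[OF s(2) t(10) f] t by simp_all
  note all = t t1
  have A: "A \<in> obj (D X)" using A0 t by simp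
  have gf: "g *[C] f = ide C X" "g' *[C] f' = ide C X'" using r t1 by (simp_all add: retract_pair_def)
  have Fs: "is_functor (D Y) (D X) (V\<langle>f\<rangle>)" "is_functor (D X) (D Y) (V\<langle>g\<rangle>)"
    "is_functor (D Y') (D X') (V\<langle>f'\<rangle>)" "is_functor (D X') (D Y') (V\<langle>g'\<rangle>)"
    "is_functor (D Y) (D X) (T\<langle>f\<rangle>)" "is_functor (D X) (D Y) (B\<langle>g\<rangle>)"
    "is_functor (D Y') (D X') (T\<langle>f'\<rangle>)" "is_functor (D X') (D Y') (B\<langle>g'\<rangle>)"
    using V.pull T.pull B.pull OP_Q f g all by simp_all
  have Us: "is_functor (D X) (D X') (Fl\<langle>u\<rangle>)" "is_functor (D Y) (D Y') (Fl\<langle>u'\<rangle>)"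
    using V.Fl.pull u all by simp_all
  have \<mu>i: "nat_iso (D Y) (D X) (V\<langle>f\<rangle>) (T\<langle>f\<rangle>) (\<mu>T f)" "nat_iso (D X) (D Y) (V\<langle>g\<rangle>) (B\<langle>g\<rangle>) (\<mu>B g)"
    "nat_iso (D Y') (D X') (V\<langle>f'\<rangle>) (T\<langle>f'\<rangle>) (\<mu>T f')" "nat_iso (D X') (D Y') (V\<langle>g'\<rangle>) (B\<langle>g'\<rangle>) (\<mu>B g')"
    using strict_isoD(1)[OF \<mu>T] strict_isoD(1)[OF \<mu>B] f g all by simp_all
  note qf = cT.conjugate_square[OF s(2) f t(10)] and qg = cB.conjugate_square[OF s(1) g u]
  note \<delta>s = qf(1)[unfolded all] qg(1)[unfolded all]
  note \<gamma>s = T.base_changeD(1)[OF \<gamma>T_base_change s(2) f t(10), unfolded all]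
    B.base_changeD(1)[OF \<gamma>B_base_change s(1) g u, unfolded all]
  note \<phi>s = \<phi>_iso[OF r(1) g, unfolded all] \<phi>_iso[OF r(2) t(9), unfolded all]
  have ch: "nat_iso (D X) (D X) (V\<langle>f\<rangle> \<circ>\<^sub>F V\<langle>g\<rangle>) (V\<langle>ide C X\<rangle>) (coh V f g)"
    "nat_iso (D X') (D X') (V\<langle>f'\<rangle> \<circ>\<^sub>F V\<langle>g'\<rangle>) (V\<langle>ide C X'\<rangle>) (coh V f' g')"
    using V.coh_nat[OF OP_Q(2)[OF f] OP_Q(1)[OF g] t1(1,2) t(1,2)]
      V.coh_nat[OF OP_Q(2)[OF t1(5)] OP_Q(1)[OF t(9)] t1(3,4) t(3,4)] gf by simp_all
  note ni = \<mu>i \<delta>s \<gamma>s \<phi>s ch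
  note ns = ni[THEN nat_isoD(1)]
  note ty = A comp_functor_simps id_functor_simps Fs[THEN functor_typing] Us[THEN functor_typing]
    ns[THEN nat_trans_typing]
    V.pull_ide[OF t(11)] V.pull_ide[OF t(12)]
  interpret X': category "D X'" using functor_category[OF Us(1)] by simp
  interpret X: category "D X" using functor_category[OF Us(1)] by simp
  interpret Y': category "D Y'" using functor_category[OF Us(2)] by simp
  have uA: "ob (Fl\<langle>u\<rangle>) A \<in> obj (D X')" by (simp add: ty)
  note isos = nat_isoD(2)[OF \<gamma>s(2) A] nat_isoD(2)[OF \<gamma>s(1) functor_simps(1)[OF Fs(6) A]]
  note i1 = Y'.iso_simps[OF isos(1)] X'.iso_simps[OF isos(2)] X'.iso_cancel[OF isos(2)]
  let ?hO = "ar (V\<langle>f'\<rangle>) (cB.\<delta> g u g' u' A)" and ?hP = "cT.\<delta> f u' f' u (ob (V\<langle>g\<rangle>) A)"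
  let ?m1 = "ar (Fl\<langle>u\<rangle>) (ar (T\<langle>f\<rangle>) (\<mu>B g A))" and ?m2 = "ar (Fl\<langle>u\<rangle>) (\<mu>T f (ob (V\<langle>g\<rangle>) A))"
  let ?n1 = "ar (T\<langle>f'\<rangle>) (\<mu>B g' (ob (Fl\<langle>u\<rangle>) A))" and ?n2 = "\<mu>T f' (ob (V\<langle>g'\<rangle>) (ob (Fl\<langle>u\<rangle>) A))"
  have c: "?n1 *[D X'] (?n2 *[D X'] (?hO *[D X'] ?hP)) =
      ar (T\<langle>f'\<rangle>) (\<gamma>B g u g' u' A) *[D X'] (\<gamma>T f u' f' u (ob (B\<langle>g\<rangle>) A) *[D X'] (?m1 *[D X'] ?m2))"
    by (rule paste_conjugate[OF Us(1,2,1) ns(2,1,4,3) ns(6,8,5,7) qg(2)[unfolded all] qf(2)[unfolded all] A])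
  have \<phi>1: "coh V f' g' (ob (Fl\<langle>u\<rangle>) A) = \<phi> f' g' (ob (Fl\<langle>u\<rangle>) A) *[D X'] (?n1 *[D X'] ?n2)"
    using \<phi>_compat[OF r(2) t1(5) t(9), of "ob (Fl\<langle>u\<rangle>) A"] uA by (simp add: all)
  have \<phi>2: "ar (Fl\<langle>u\<rangle>) (coh V f g A) = ar (Fl\<langle>u\<rangle>) (\<phi> f g A) *[D X'] (?m1 *[D X'] ?m2)"
    using \<phi>_compat[OF r(1) f g, of A] A
    by (simp add: all functor_cmp[OF Us(1), symmetric] ty X.cat_simps)
  have \<phi>3: "\<phi> f' g' (ob (Fl\<langle>u\<rangle>) A) = ar (Fl\<langle>u\<rangle>) (\<phi> f g A) *[D X']
      (inv_arr (D X') (\<gamma>T f u' f' u (ob (B\<langle>g\<rangle>) A)) *[D X'] ar (T\<langle>f'\<rangle>) (inv_arr (D Y') (\<gamma>B g u g' u' A)))"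
    using \<phi>_flat[OF r(1) f g u r(2) s, of A] A by (simp add: all)
  have k: "ar (T\<langle>f'\<rangle>) (inv_arr (D Y') (\<gamma>B g u g' u' A)) *[D X'] ar (T\<langle>f'\<rangle>) (\<gamma>B g u g' u' A) =
      ide (D X') (ob (T\<langle>f'\<rangle>) (ob (Fl\<langle>u'\<rangle>) (ob (B\<langle>g\<rangle>) A)))"
    using functor_simps(5)[OF Fs(7), of "ob (Fl\<langle>u'\<rangle>) (ob (B\<langle>g\<rangle>) A)"]
    by (simp add: functor_cmp[OF Fs(7), symmetric] i1 ty)
  \<comment> \<open>\<open>c\<close> turns the conjugated families back into
    \<open>\<gamma>T\<close> and \<open>\<gamma>B\<close>, which cancel against the inverses brought
    in by \<open>\<phi>3\<close>.\<close>
  have "coh V f' g' (ob (Fl\<langle>u\<rangle>) A) *[D X'] (?hO *[D X'] ?hP) =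
      \<phi> f' g' (ob (Fl\<langle>u\<rangle>) A) *[D X'] (?n1 *[D X'] (?n2 *[D X'] (?hO *[D X'] ?hP)))"
    unfolding \<phi>1 by (simp add: ty X'.cat_simps)
  also have "\<dots> = ar (Fl\<langle>u\<rangle>) (coh V f g A)"
    unfolding c \<phi>2 \<phi>3 by (simp add: ty i1 X'.cat_simps X'.reassoc[OF k])
  finally have e: "coh V f' g' (ob (Fl\<langle>u\<rangle>) A) *[D X'] (?hO *[D X'] ?hP) = ar (Fl\<langle>u\<rangle>) (coh V f g A)" .
  show ?thesis
    by (rule V.paste_eqI[OF s(1) OP_Q(1)[OF g] u s(2) OP_Q(2)[OF f] qg(1) qf(1) A0])
      (simp_all add: all gf e ty X'.cat_simps)
qed

lemma is_flat_gluing: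
  "flat_gluing C (\<lambda>l. if l then Pc else Oc) V Fc Fl D (\<lambda>l. if l then cT.\<delta> else cB.\<delta>)"
proof (rule flat_gluing.intro)
  show "flat_pseudo C (generated_subcategory C ((if False then Pc else Oc) \<union> (if True then Pc else Oc))) V Fc Fl D"
    using V.flat_pseudo_axioms by simp
  show "flat_gluing_axioms C (\<lambda>l. if l then Pc else Oc) V Fc Fl D (\<lambda>l. if l then cT.\<delta> else cB.\<delta>)"
  proof (rule flat_gluing_axioms.intro, unfold if_True if_False)
    show "subcategory C (if l then Pc else Oc)" "stable_under_base_change C (if l then Pc else Oc) (arr C)" for l
      using Oc_subcategory Pc_subcategory Oc_stable Pc_stable by simp_all
    show "ide C X \<in> (if l then Pc else Oc)" if "X \<in> obj C" for X l using ide_mem[OF that] by simp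
    show "f \<in> Pc" if "f \<in> hom C X Y" "g \<in> hom C Y Z" "g *[C] f \<in> Pc" "g \<in> (if l then Pc else Oc)" for f g X Y Z l
      using Pc_cancel[OF that(1-3)] that(4) by (cases l) auto
    show "stable_under_base_change C Fc (Oc \<union> Pc)" by (rule Fc_stable)
    show "base_change C (if l then Pc else Oc) Fc V Fl (if l then cT.\<delta> else cB.\<delta>)" for l
      using cT.conjugate_base_change cB.conjugate_base_change by simp
  qed (rule cube_exchange retract_paste; assumption)+
qed

text \<open>The conditions of \<open>flat_base_change\<close> expressed by the transported data;
  \<open>flat_base_change_iff\<close> matches the two.\<close>

definition compatible where
  "compatible \<gamma> \<longleftrightarrow> base_change C Q Fc V Fl \<gamma> \<and>
     (\<forall>f u f' u'. cartesian C f u f' u' \<longrightarrow> f \<in> Pc \<longrightarrow> u \<in> Fc \<longrightarrow> (\<forall>A\<in>obj (D (tgt C f)).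
        \<mu>T f' (ob (Fl\<langle>u\<rangle>) A) *[D (src C f')] \<gamma> f u f' u' A =
        \<gamma>T f u f' u' A *[D (src C f')] ar (Fl\<langle>u'\<rangle>) (\<mu>T f A))) \<and>
     (\<forall>f u f' u'. cartesian C f u f' u' \<longrightarrow> f \<in> Oc \<longrightarrow> u \<in> Fc \<longrightarrow> (\<forall>A\<in>obj (D (tgt C f)).
        \<mu>B f' (ob (Fl\<langle>u\<rangle>) A) *[D (src C f')] \<gamma> f u f' u' A =
        \<gamma>B f u f' u' A *[D (src C f')] ar (Fl\<langle>u'\<rangle>) (\<mu>B f A)))"

lemma compatible_exists: "\<exists>\<gamma>. compatible \<gamma>"
proof -
  interpret G: flat_gluing C "\<lambda>l. if l then Pc else Oc" V Fc Fl D "\<lambda>l. if l then cT.\<delta> else cB.\<delta>"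
    by (rule is_flat_gluing)
  show ?thesis
    unfolding compatible_def
    by (rule exI[of _ G.\<Gamma>]) (use G.\<Gamma>_base_change G.\<Gamma>_generator[where l = True] G.\<Gamma>_generator[where l = False]
      cT.conjugate_square(2) cB.conjugate_square(2) in simp)
qed

text \<open>Over a composite the square is split. Vertical transitivity expresses both families by
  their values on the factors, after composition with \<open>Fl\<langle>u'\<rangle>\<close> of a
  coherence map, which can be cancelled.\<close>

lemma compatible_unique:
  assumes "compatible \<gamma>" "compatible \<gamma>'" "f \<in> Q"
  shows "cartesian C f u f' u' \<Longrightarrow> u \<in> Fc \<Longrightarrow> A \<in> obj (D (tgt C f)) \<Longrightarrow> \<gamma> f u f' u' A = \<gamma>' f u f' u' A"
  using assms(3)
proof (induction arbitrary: u f' u' A rule: generated_induct)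
  case arr show ?case by (rule OP_arr)
next
  case (ide X) then show ?case using ide_mem by blast
next
  case (generator f)
  have b: "base_change C Q Fc V Fl \<gamma>" "base_change C Q Fc V Fl \<gamma>'"
    using assms(1,2) by (auto simp: compatible_def)
  note s = generator(2) and u = generator(3) and A = generator(4)
  have fQ: "f \<in> Q" using OP_Q generator(1) by blast
  note n = V.base_changeD(1)[OF b(1) s fQ u] V.base_changeD(1)[OF b(2) s fQ u]
  note c = cartesianD[OF s]
  have o: "src C f' \<in> obj C" using c by (simp add: cat_simps)
  interpret X': category "D (src C f')" by (rule V.D_category[OF o])
  have uA: "ob (Fl\<langle>u\<rangle>) A \<in> obj (D (tgt C f'))"
    using functor_simps(1)[OF V.Fl.pull[OF u refl c(5)] A] c(7) by simp
  consider "f \<in> Pc" | "f \<in> Oc" using generator(1) by blast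
  \<comment> \<open>Only an isomorphism after which the two families agree is kept, so that the
    cases \<open>P\<close> and \<open>O\<close> end in the same cancellation.\<close>
  then obtain \<mu> G where \<mu>: "nat_iso (D (tgt C f')) (D (src C f')) (V\<langle>f'\<rangle>) G \<mu>"
    and e: "\<mu> (ob (Fl\<langle>u\<rangle>) A) *[D (src C f')] \<gamma> f u f' u' A = \<mu> (ob (Fl\<langle>u\<rangle>) A) *[D (src C f')] \<gamma>' f u f' u' A"
  proof cases
    case 1
    have f': "f' \<in> Pc" using 1 OP_square(2)[OF s u] by simp
    show thesis
      by (rule that[OF strict_isoD(1)[OF \<mu>T f' refl refl]])
        (use assms(1,2) s u A 1 in \<open>simp add: compatible_def\<close>)
  next
    case 2
    have f': "f' \<in> Oc" using 2 OP_square(1)[OF s u] by simp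
    show thesis
      by (rule that[OF strict_isoD(1)[OF \<mu>B f' refl refl]])
        (use assms(1,2) s u A 2 in \<open>simp add: compatible_def\<close>)
  qed
  show ?case
    by (rule X'.iso_left_cancel[OF e nat_isoD(2)[OF \<mu> uA]])
      (use n[THEN nat_isoD(1), THEN nat_transD(3)] n[THEN nat_isoD(1), THEN nat_transD(5)]
        nat_isoD(1)[OF \<mu>, THEN nat_transD(4)] A uA in \<open>simp_all add: comp_functor_simps\<close>)
next
  case (cmp f g)
  have b: "base_change C Q Fc V Fl \<gamma>" "base_change C Q Fc V Fl \<gamma>'"
    using assms(1,2) by (auto simp: compatible_def)
  note fQ = cmp.hyps(1) and gQ = cmp.hyps(2)
  note fa = V.R_arr[OF fQ] and ga = V.R_arr[OF gQ]
  have tfg: "tgt C (f *[C] g) = tgt C f" using fa ga cmp.hyps(3) by (simp add: cat_simps)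
  have "tgt C u = tgt C f" using cartesianD(5)[OF cmp.prems(1)] tfg by simp
  then obtain h w where 1: "cartesian C f u h w" using Q_exists[OF fQ cmp.prems(2)] by blast
  obtain g' where 2: "cartesian C g w g' u'" "f' = h *[C] g'"
    using cartesian_split[OF cmp.prems(1) 1 ga cmp.hyps(3)] by blast
  have w: "w \<in> Fc" and hQ: "h \<in> Q" using Q_square[OF 1 fQ cmp.prems(2)] by auto
  have g'Q: "g' \<in> Q" and u': "u' \<in> Fc" using Q_square[OF 2(1) gQ w] by auto
  have A: "A \<in> obj (D (tgt C f))" using cmp.prems(3) tfg by simp
  have fA: "ob (V\<langle>f\<rangle>) A \<in> obj (D (tgt C g))"
    using functor_simps(1)[OF V.pull[OF fQ refl refl] A] cmp.hyps(3) by simp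
  note v = V.base_changeD(3)[OF b(1) 1 fQ cmp.prems(2) 2(1) gQ A] V.base_changeD(3)[OF b(2) 1 fQ cmp.prems(2) 2(1) gQ A]
  have fgQ: "f *[C] g \<in> Q" using V.R_cmp[OF gQ fQ cmp.hyps(3)] .
  have tg': "tgt C g' = src C h" using cartesian_composable(6)[OF 1 2(1)] .
  have sf': "src C (h *[C] g') = src C g'"
    using cartesian_composable(3,4)[OF 1 2(1)] tg' by (simp add: cat_simps)
  note n = V.base_changeD(1)[OF b(1) cmp.prems(1) fgQ cmp.prems(2), unfolded tfg 2(2) sf']
    V.base_changeD(1)[OF b(2) cmp.prems(1) fgQ cmp.prems(2), unfolded tfg 2(2) sf']
  have o: "src C g' \<in> obj C" using cartesianD(3)[OF 2(1)] by (simp add: cat_simps)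
  interpret X': category "D (src C g')" by (rule V.D_category[OF o])
  have u'g: "src C u' = src C g'" "tgt C u' = src C g" using cartesianD[OF 2(1)] by simp_all
  note c = V.coh_nat[OF gQ fQ refl cmp.hyps(3) refl refl]
  note U = V.Fl.pull[OF u' u'g]
  have e: "\<gamma> (f *[C] g) u (h *[C] g') u' A *[D (src C g')] ar (Fl\<langle>u'\<rangle>) (coh V g f A) =
      \<gamma>' (f *[C] g) u (h *[C] g') u' A *[D (src C g')] ar (Fl\<langle>u'\<rangle>) (coh V g f A)"
    unfolding v cmp.IH(1)[OF 1 cmp.prems(2) A] cmp.IH(2)[OF 2(1) w fA] ..
  show ?case unfolding 2(2)
    by (rule X'.iso_right_cancel[OF e functor_iso(1)[OF U nat_isoD(2)[OF c A]]])
      (simp_all add: n[THEN nat_isoD(1), THEN nat_transD(3)] n[THEN nat_isoD(1), THEN nat_transD(4)]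
        A functor_simps[OF U] nat_transD[OF nat_isoD(1)[OF c]] comp_functor_simps)
qed

end

section \<open>Perfect covers\<close>

lemma strict_iso_cong:
  assumes "strict_iso C R D V (transport C D (\<lambda>_. id_functor) (\<lambda>_. id_functor) W) \<mu>"
  shows "strict_iso C R D V W \<mu>"
  using assms by (simp add: strict_iso_def transport_id)

text \<open>The inverse of \<open>cover_S K X\<close> comes from the inverse of \<open>muT K\<close>
  and is then replaced by \<open>cover_Sinv\<close>. The given pseudofunctors are included with
  identity functors, as targets for \<open>strict_iso_transport\<close>.\<close>

lemma (in flat_data) perfect_transporting:
  assumes "perfect_cover C Oc Pc T B \<beta> \<phi> K"
  shows "transporting C (generated_subcategory C (Oc \<union> Pc)) (pse K) (pcat (pse K)) (pcat T)
      (cover_S K) (cover_Sinv K)"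
    and "transporting C Pc (pse K) (pcat (pse K)) (pcat T) (cover_S K) (cover_Sinv K)"
    and "transporting C Oc (pse K) (pcat (pse K)) (pcat T) (cover_S K) (cover_Sinv K)"
    and "transporting C Pc T (pcat T) (pcat T) (\<lambda>_. id_functor) (\<lambda>_. id_functor)"
    and "transporting C Oc B (pcat T) (pcat T) (\<lambda>_. id_functor) (\<lambda>_. id_functor)"
proof -
  let ?Q = "generated_subcategory C (Oc \<union> Pc)"
  have ide: "ide C X \<in> Oc" "ide C X \<in> Pc" if "X \<in> obj C" for X
    using iso_Oc iso_Pc iso_ide[OF that] by blast+
  have OP: "Oc \<union> Pc \<subseteq> arr C"
    using subcategoryD(1)[OF Oc_subcategory] subcategoryD(1)[OF Pc_subcategory] by blast
  note gen = generated_subcategory[OF OP]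
  have "pseudofunctor (subcat C ?Q) (pse K)" and pi: "pseudo_iso (subcat C Pc) (pse K) T (muT K)"
    using assms by (auto simp: perfect_cover_def is_cover_def)
  then interpret K: pseudo_on C ?Q "pse K" "pcat (pse K)"
    by (intro pseudo_on.intro[OF category_axioms pseudo_on_axioms.intro]) (use gen ide in auto)
  have T: "pseudo_on C Pc T (pcat T)"
    by (rule pseudo_on.intro[OF category_axioms pseudo_on_axioms.intro])
      (simp_all add: Pc_subcategory ide T_pseudofunctor)
  have B: "pseudo_on C Oc B (pcat T)"
    by (rule pseudo_on.intro[OF category_axioms pseudo_on_axioms.intro])
      (simp_all add: Oc_subcategory ide B_pseudofunctor same_cat)
  have inv: "inverse_functors (pcat (pse K) X) (pcat T X) (cover_S K X) (cover_Sinv K X)" if "X \<in> obj C" for X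
    using pseudo_iso_functors(1)[OF pi] inverse_functors_inv that pseudo_on.obj_sub[OF T]
    unfolding cover_Sinv_def by blast
  have id: "inverse_functors (pcat T X) (pcat T X) id_functor id_functor" if "X \<in> obj C" for X
    using inverse_functors_id pseudo_on.D_category[OF T that] by blast
  show "transporting C ?Q (pse K) (pcat (pse K)) (pcat T) (cover_S K) (cover_Sinv K)"
    by (rule transporting.intro[OF K.pseudo_on_axioms transporting_axioms.intro]) (rule inv)
  show "transporting C Pc (pse K) (pcat (pse K)) (pcat T) (cover_S K) (cover_Sinv K)"
    by (rule transporting.intro[OF K.restrict transporting_axioms.intro])
      (use Pc_subcategory gen ide inv in auto)
  show "transporting C Oc (pse K) (pcat (pse K)) (pcat T) (cover_S K) (cover_Sinv K)"
    by (rule transporting.intro[OF K.restrict transporting_axioms.intro])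
      (use Oc_subcategory gen ide inv in auto)
  show "transporting C Pc T (pcat T) (pcat T) (\<lambda>_. id_functor) (\<lambda>_. id_functor)"
    by (rule transporting.intro[OF T transporting_axioms.intro]) (rule id)
  show "transporting C Oc B (pcat T) (pcat T) (\<lambda>_. id_functor) (\<lambda>_. id_functor)"
    by (rule transporting.intro[OF B transporting_axioms.intro]) (rule id)
qed

lemma identified_simps:
  "pse (identified C T K) = transport C (pcat T) (cover_S K) (cover_Sinv K) (pse K)"
  "mar (muT (identified C T K)) = (\<lambda>f A. mar (muT K) f (ob (cover_Sinv K (tgt C f)) A))"
  "mar (muB (identified C T K)) = (\<lambda>f A. mar (muB K) f (ob (cover_Sinv K (tgt C f)) A))"
  by (simp_all add: identified_def transport_def)

lemma (in flat_data) perfect_transported: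
  assumes K: "perfect_cover C Oc Pc T B \<beta> \<phi> K"
  shows "transported C Oc Pc T B \<beta> \<phi> Fc Fl \<gamma>T \<gamma>B (pse (identified C T K))
    (mar (muT (identified C T K))) (mar (muB (identified C T K)))"
proof (rule transported.intro[OF flat_data_axioms transported_axioms.intro])
  note tr = perfect_transporting[OF K]
  interpret Q: transporting C "generated_subcategory C (Oc \<union> Pc)" "pse K" "pcat (pse K)" "pcat T"
    "cover_S K" "cover_Sinv K" by (rule tr(1))
  have OPQ: "Oc \<subseteq> generated_subcategory C (Oc \<union> Pc)" "Pc \<subseteq> generated_subcategory C (Oc \<union> Pc)"
    by (auto simp: generated_subcategory_def)
  have muB: "functor_eq (pcat (pse K) X) (cover_S K X) (mob (muB K) X)" if "X \<in> obj C" for X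
    using K that by (simp add: perfect_cover_def is_cover_def)
  show "pseudo_on C (generated_subcategory C (Oc \<union> Pc)) (pse (identified C T K)) (pcat T)"
    unfolding identified_simps by (rule Q.transport_pseudo)
  have piT: "pseudo_iso (subcat C Pc) (pse K) T (muT K)" and piB: "pseudo_iso (subcat C Oc) (pse K) B (muB K)"
    using K by (simp_all add: perfect_cover_def)
  \<comment> \<open>The functors of \<open>muB K\<close> agree with \<open>cover_S K\<close> on the
    carriers only, so these relations are stated with \<open>functor_eq\<close>.\<close>
  have ZT: "functor_eq (pcat (pse K) X) (id_functor \<circ>\<^sub>F mob (muT K) X) (cover_S K X)"
    and ZB: "X \<in> obj C \<Longrightarrow> functor_eq (pcat (pse K) X) (id_functor \<circ>\<^sub>F mob (muB K) X) (cover_S K X)" for X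
    using muB by (simp_all add: functor_eq_def comp_functor_simps id_functor_simps)
  show "strict_iso C Pc (pcat T) (pse (identified C T K)) T (mar (muT (identified C T K)))"
    using strict_iso_cong[OF strict_iso_transport[OF tr(2,4) piT ZT]]
    by (simp only: identified_simps id_functor_simps)
  show "strict_iso C Oc (pcat T) (pse (identified C T K)) B (mar (muB (identified C T K)))"
    using strict_iso_cong[OF strict_iso_transport[OF tr(3,5) piB ZB]]
    by (simp only: identified_simps id_functor_simps)
  fix f i f' i' A
  assume s: "cartesian C f i f' i'" "f \<in> Pc" "i \<in> Oc" and A: "A \<in> obj (pcat T (tgt C f))"
  note c = cartesianD[OF s(1)]
  define X Y U W where "X = src C f" and "Y = tgt C f" and "U = src C f'" and "W = tgt C f'"
  have t: "src C f = X" "tgt C f = Y" "src C f' = U" "tgt C f' = W" "src C i = W" "tgt C i = Y"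
    "src C i' = U" "tgt C i' = X"
    using c by (simp_all add: X_def Y_def U_def W_def)
  have o: "X \<in> obj C" "Y \<in> obj C" "U \<in> obj C" "W \<in> obj C" using c t src_obj tgt_obj by metis+
  have f': "f' \<in> Pc" and i': "i' \<in> Oc"
    using s c cartesian_sym[OF s(1)] Oc_stable Pc_stable unfolding stable_under_base_change_def by metis+
  let ?A = "ob (cover_Sinv K Y) A"
  have A': "?A \<in> obj (pcat (pse K) Y)" using functor_simps(1)[OF Q.S'_fun[OF o(2)]] A t by simp
  have Qs: "f \<in> generated_subcategory C (Oc \<union> Pc)" "i \<in> generated_subcategory C (Oc \<union> Pc)"
    "f' \<in> generated_subcategory C (Oc \<union> Pc)" "i' \<in> generated_subcategory C (Oc \<union> Pc)"
    using OPQ s f' i' by auto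
  note n = Q.coh_nat[OF Qs(3,2) t(3,4) t(5,6)] Q.coh_nat[OF Qs(4,1) t(7,8) t(1,2)]
  note fs = functor_simps[OF Q.pull[OF Qs(1) t(1,2)]] functor_simps[OF Q.pull[OF Qs(2) t(5,6)]]
  interpret U: category "pcat (pse K) U" by (rule Q.D_category[OF o(3)])
  note isos = nat_isoD(2)[OF n(1) A']
  note ns = n[THEN nat_isoD(1)]
  \<comment> \<open>The cover condition inverts a coherence map before applying
    \<open>cover_S\<close>, the transported condition inverts its image. Functors preserve
    inverses.\<close>
  have e: "ar (cover_S K U) (inv_arr (pcat (pse K) U) (coh (pse K) f' i ?A) *[pcat (pse K) U] coh (pse K) i' f ?A) =
      inv_arr (pcat T U) (ar (cover_S K U) (coh (pse K) f' i ?A)) *[pcat T U] ar (cover_S K U) (coh (pse K) i' f ?A)"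
    using ns[THEN nat_transD(3)] ns[THEN nat_transD(5)] A' cartesian_commute[OF s(1)] isos
    by (subst functor_cmp[OF Q.S_fun[OF o(3)]]) (simp_all add: U.iso_simps functor_iso(2)[OF Q.S_fun[OF o(3)]])
  have "\<beta> f i f' i' (ob (cover_S K Y) ?A) *[pcat T U]
      (ar (B\<langle>i'\<rangle>) (mar (muT K) f ?A) *[pcat T U] mar (muB K) i' (ob ((pse K)\<langle>f\<rangle>) ?A)) =
    ar (T\<langle>f'\<rangle>) (mar (muB K) i ?A) *[pcat T U] (mar (muT K) f' (ob ((pse K)\<langle>i\<rangle>) ?A) *[pcat T U]
      ar (cover_S K U) (inv_arr (pcat (pse K) U) (coh (pse K) f' i ?A) *[pcat (pse K) U] coh (pse K) i' f ?A))"
  proof -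
    have "\<forall>f i f' i'. cartesian C f i f' i' \<longrightarrow> f \<in> Pc \<longrightarrow> i \<in> Oc \<longrightarrow>
        (\<forall>A\<in>obj (pcat (pse K) (tgt C f)).
           \<beta> f i f' i' (ob (cover_S K (tgt C f)) A) *[pcat T (src C f')]
             (ar (B\<langle>i'\<rangle>) (mar (muT K) f A) *[pcat T (src C f')]
               mar (muB K) i' (ob ((pse K)\<langle>f\<rangle>) A)) =
           ar (T\<langle>f'\<rangle>) (mar (muB K) i A) *[pcat T (src C f')]
             (mar (muT K) f' (ob ((pse K)\<langle>i\<rangle>) A) *[pcat T (src C f')]
               ar (cover_S K (src C f'))
                 (inv_arr (pcat (pse K) (src C f')) (coh (pse K) f' i A)
                   *[pcat (pse K) (src C f')] coh (pse K) i' f A)))"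
      using K unfolding perfect_cover_def is_cover_def by blast
    from this[rule_format, OF s, of ?A] A' show ?thesis unfolding t by blast
  qed
  then show "\<beta> f i f' i' A *[pcat T (src C f')]
        (ar (B\<langle>i'\<rangle>) (mar (muT (identified C T K)) f A) *[pcat T (src C f')]
          mar (muB (identified C T K)) i' (ob ((pse (identified C T K))\<langle>f\<rangle>) A)) =
      ar (T\<langle>f'\<rangle>) (mar (muB (identified C T K)) i A) *[pcat T (src C f')]
        (mar (muT (identified C T K)) f' (ob ((pse (identified C T K))\<langle>i\<rangle>) A) *[pcat T (src C f')]
        (inv_arr (pcat T (src C f')) (coh (pse (identified C T K)) f' i A) *[pcat T (src C f')]
          coh (pse (identified C T K)) i' f A))"
    unfolding e using A A' by (simp add: identified_simps transport_simps(2,5) t Q.SS' o fs)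
next
  note tr = perfect_transporting[OF K]
  interpret Q: transporting C "generated_subcategory C (Oc \<union> Pc)" "pse K" "pcat (pse K)" "pcat T"
    "cover_S K" "cover_Sinv K" by (rule tr(1))
  fix i h A
  assume r: "retract_pair C i h" "i \<in> Pc" "h \<in> Oc" and A: "A \<in> obj (pcat T (src C i))"
  have t: "src C h = tgt C i" "tgt C h = src C i" "i \<in> arr C" using r(1) by (simp_all add: retract_pair_def hom_def)
  have o: "src C i \<in> obj C" "tgt C i \<in> obj C" using t src_obj tgt_obj by auto
  let ?A = "ob (cover_Sinv K (src C i)) A"
  have A': "?A \<in> obj (pcat (pse K) (src C i))" using functor_simps(1)[OF Q.S'_fun[OF o(1)] A] .
  have "h \<in> generated_subcategory C (Oc \<union> Pc)" using r(3) by (auto simp: generated_subcategory_def)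
  note fs = functor_simps[OF Q.pull[OF this t(1,2)]]
  have "\<forall>i h. retract_pair C i h \<longrightarrow> i \<in> Pc \<longrightarrow> h \<in> Oc \<longrightarrow>
        (\<forall>A\<in>obj (pcat (pse K) (src C i)).
           \<phi> i h (ob (cover_S K (src C i)) A) *[pcat T (src C i)]
             (ar (T\<langle>i\<rangle>) (mar (muB K) h A) *[pcat T (src C i)]
               mar (muT K) i (ob ((pse K)\<langle>h\<rangle>) A)) =
           ar (cover_S K (src C i)) (coh (pse K) i h A))"
    using K unfolding perfect_cover_def is_cover_def by blast
  from this[rule_format, OF r, of ?A] A'
  show "\<phi> i h A *[pcat T (src C i)] (ar (T\<langle>i\<rangle>) (mar (muB (identified C T K)) h A) *[pcat T (src C i)]
        mar (muT (identified C T K)) i (ob ((pse (identified C T K))\<langle>h\<rangle>) A)) =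
      coh (pse (identified C T K)) i h A"
    using A by (simp add: identified_simps transport_simps(2,5) t Q.SS' o fs)
qed

section \<open>Comparison of two perfect covers\<close>

lemma compatible_conjugate:
  assumes "transported C Oc Pc T B \<beta> \<phi> Fc Fl \<gamma>T \<gamma>B V \<mu>T \<mu>B"
    and "transported C Oc Pc T B \<beta> \<phi> Fc Fl \<gamma>T \<gamma>B V' \<mu>T' \<mu>B'"
    and e: "strict_iso C (generated_subcategory C (Oc \<union> Pc)) (pcat T) V' V e"
    and eT: "\<And>f A. f \<in> Pc \<Longrightarrow> A \<in> obj (pcat T (tgt C f)) \<Longrightarrow> \<mu>T f A *[pcat T (src C f)] e f A = \<mu>T' f A"
    and eB: "\<And>f A. f \<in> Oc \<Longrightarrow> A \<in> obj (pcat T (tgt C f)) \<Longrightarrow> \<mu>B f A *[pcat T (src C f)] e f A = \<mu>B' f A"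
    and \<gamma>: "transported.compatible C Oc Pc T Fc Fl \<gamma>T \<gamma>B V \<mu>T \<mu>B \<gamma>"
  shows "transported.compatible C Oc Pc T Fc Fl \<gamma>T \<gamma>B V' \<mu>T' \<mu>B' (conjugate C (pcat T) Fl e \<gamma>)"
    and "\<lbrakk>cartesian C f u f' u'; f \<in> generated_subcategory C (Oc \<union> Pc); u \<in> Fc; A \<in> obj (pcat T (tgt C f))\<rbrakk> \<Longrightarrow>
      e f' (ob (Fl\<langle>u\<rangle>) A) *[pcat T (src C f')] conjugate C (pcat T) Fl e \<gamma> f u f' u' A =
      \<gamma> f u f' u' A *[pcat T (src C f')] ar (Fl\<langle>u'\<rangle>) (e f A)"
proof -
  let ?Q = "generated_subcategory C (Oc \<union> Pc)" and ?D = "pcat T"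
  let ?d = "conjugate C (pcat T) Fl e \<gamma>"
  interpret V: transported C Oc Pc T B \<beta> \<phi> Fc Fl \<gamma>T \<gamma>B V \<mu>T \<mu>B by fact
  interpret W: transported C Oc Pc T B \<beta> \<phi> Fc Fl \<gamma>T \<gamma>B V' \<mu>T' \<mu>B' by fact
  note \<gamma>' = \<gamma>[unfolded V.compatible_def]
  \<comment> \<open>Conjugation is used again, now along the map \<open>e\<close> between the two
    covers and over all of \<open>Q\<close>. It produces a family for \<open>V'\<close> from the
    family \<gamma> of \<open>V\<close>.\<close>
  interpret E: conjugation C ?Q V' V Fc Fl ?D e \<gamma>
    by (rule conjugation.intro[OF W.V.flat_pseudo_axioms V.V.flat_pseudo_axioms
          conjugation_axioms.intro[OF e]]) (use \<gamma>' in blast)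
  \<comment> \<open>The computation common to \<open>P\<close> and \<open>O\<close>:
    \<open>m\<close> stands for the comparison map of \<open>V\<close>, \<open>m1\<close> for that
    of \<open>V'\<close>, which is \<open>m\<close> after \<open>e\<close>, and
    \<open>\<kappa>\<close> for \<open>\<gamma>T\<close> or \<open>\<gamma>B\<close>.\<close>
  have key: "m1' *[?D (src C f')] ?d f u f' u' A = \<kappa> A *[?D (src C f')] ar (Fl\<langle>u'\<rangle>) m1"
    if s: "cartesian C f u f' u'" "f \<in> ?Q" "u \<in> Fc" and A0: "A \<in> obj (?D (tgt C f))"
      and m0: "nat_iso (?D (tgt C f)) (?D (src C f)) (V\<langle>f\<rangle>) F m" "m A *[?D (src C f)] e f A = m1"
      and m0': "nat_iso (?D (tgt C f')) (?D (src C f')) (V\<langle>f'\<rangle>) F' m'"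
        "m' (ob (Fl\<langle>u\<rangle>) A) *[?D (src C f')] e f' (ob (Fl\<langle>u\<rangle>) A) = m1'"
      and g0: "nat_iso (?D (tgt C f)) (?D (src C f')) (Fl\<langle>u'\<rangle> \<circ>\<^sub>F F) (F' \<circ>\<^sub>F Fl\<langle>u\<rangle>) \<kappa>"
      and r0: "m' (ob (Fl\<langle>u\<rangle>) A) *[?D (src C f')] \<gamma> f u f' u' A =
        \<kappa> A *[?D (src C f')] ar (Fl\<langle>u'\<rangle>) (m A)"
    for f u f' u' A m m' m1 m1' F F' \<kappa>
  proof -
    obtain X Y X' Y' where t: "src C f = X" "tgt C f = Y" "src C f' = X'" "tgt C f' = Y'"
      "src C u = Y'" "tgt C u = Y" "src C u' = X'" "tgt C u' = X" "f' \<in> ?Q" "u' \<in> Fc"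
      by (rule V.V.square[OF s])
    note A = A0[unfolded t] and m = m0[unfolded t] and m' = m0'[unfolded t] and g = g0[unfolded t] and r = r0[unfolded t]
    note U = V.V.Fl.pull[OF s(3) t(5,6)] and U' = V.V.Fl.pull[OF t(10,7,8)]
    interpret X': category "?D X'" using functor_category[OF U'] by simp
    note es = strict_isoD(1)[OF e s(2) t(1,2)] strict_isoD(1)[OF e t(9,3,4)]
    note ns = m(1)[THEN nat_isoD(1)] m'(1)[THEN nat_isoD(1)] es[THEN nat_isoD(1)] g[THEN nat_isoD(1)]
      E.conjugate_square(1)[OF s, unfolded t, THEN nat_isoD(1)]
      V.V.base_changeD(1)[OF E.\<gamma> s, unfolded t, THEN nat_isoD(1)]
    note ty = A ns[THEN nat_trans_typing] comp_functor_simps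
      functor_simps[OF U] functor_simps[OF U']
    have 1: "e f' (ob (Fl\<langle>u\<rangle>) A) *[?D X'] ?d f u f' u' A = \<gamma> f u f' u' A *[?D X'] ar (Fl\<langle>u'\<rangle>) (e f A)"
      using E.conjugate_square(2)[OF s, of A] A by (simp add: t)
    have 2: "ar (Fl\<langle>u'\<rangle>) m1 = ar (Fl\<langle>u'\<rangle>) (m A) *[?D X'] ar (Fl\<langle>u'\<rangle>) (e f A)"
      unfolding m(2)[symmetric] by (rule functor_cmp[OF U']) (simp_all add: ty)
    show ?thesis unfolding t 2 m'(2)[symmetric]
      by (simp add: ty X'.cat_simps 1 X'.reassoc[OF r])
  qed
  show "W.compatible ?d"
    unfolding W.compatible_def
  proof (intro conjI allI impI ballI)
    show "base_change C ?Q Fc V' Fl ?d" by (rule E.conjugate_base_change)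
    fix f u f' u' A assume s: "cartesian C f u f' u'" "u \<in> Fc" and A: "A \<in> obj (?D (tgt C f))"
    have uA: "ob (Fl\<langle>u\<rangle>) A \<in> obj (?D (tgt C f'))"
      using functor_simps(1)[OF V.V.Fl.pull[OF s(2) refl V.cartesianD(5)[OF s(1)]] A] V.cartesianD(7)[OF s(1)] by simp
    { assume f: "f \<in> Pc"
      have f': "f' \<in> Pc" using V.OP_square(2)[OF s f] by simp
      have r: "\<mu>T f' (ob (Fl\<langle>u\<rangle>) A) *[?D (src C f')] \<gamma> f u f' u' A =
          \<gamma>T f u f' u' A *[?D (src C f')] ar (Fl\<langle>u'\<rangle>) (\<mu>T f A)"
        using \<gamma>' s f A by blast
      show "\<mu>T' f' (ob (Fl\<langle>u\<rangle>) A) *[?D (src C f')] ?d f u f' u' A =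
          \<gamma>T f u f' u' A *[?D (src C f')] ar (Fl\<langle>u'\<rangle>) (\<mu>T' f A)"
        by (rule key[OF s(1) V.OP_Q(2)[OF f] s(2) A strict_isoD(1)[OF V.\<mu>T f refl refl] eT[OF f A]
              strict_isoD(1)[OF V.\<mu>T f' refl refl] eT[OF f' uA] V.T.base_changeD(1)[OF V.\<gamma>T_base_change s(1) f s(2)] r]) }
    { assume f: "f \<in> Oc"
      have f': "f' \<in> Oc" using V.OP_square(1)[OF s f] by simp
      have r: "\<mu>B f' (ob (Fl\<langle>u\<rangle>) A) *[?D (src C f')] \<gamma> f u f' u' A =
          \<gamma>B f u f' u' A *[?D (src C f')] ar (Fl\<langle>u'\<rangle>) (\<mu>B f A)"
        using \<gamma>' s f A by blast
      show "\<mu>B' f' (ob (Fl\<langle>u\<rangle>) A) *[?D (src C f')] ?d f u f' u' A =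
          \<gamma>B f u f' u' A *[?D (src C f')] ar (Fl\<langle>u'\<rangle>) (\<mu>B' f A)"
        by (rule key[OF s(1) V.OP_Q(1)[OF f] s(2) A strict_isoD(1)[OF V.\<mu>B f refl refl] eB[OF f A]
              strict_isoD(1)[OF V.\<mu>B f' refl refl] eB[OF f' uA] V.B.base_changeD(1)[OF V.\<gamma>B_base_change s(1) f s(2)] r]) }
  qed
  show "e f' (ob (Fl\<langle>u\<rangle>) A) *[?D (src C f')] ?d f u f' u' A =
      \<gamma> f u f' u' A *[?D (src C f')] ar (Fl\<langle>u'\<rangle>) (e f A)"
    if "cartesian C f u f' u'" "f \<in> ?Q" "u \<in> Fc" "A \<in> obj (?D (tgt C f))"
    by (rule E.conjugate_square(2)[OF that])
qed

lemma (in flat_data) flat_base_change_iff: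
  assumes "perfect_cover C Oc Pc T B \<beta> \<phi> K"
  shows "flat_base_change C Oc Pc T Fc Fl \<gamma>T \<gamma>B K \<gamma> \<longleftrightarrow>
    transported.compatible C Oc Pc T Fc Fl \<gamma>T \<gamma>B (pse (identified C T K))
      (mar (muT (identified C T K))) (mar (muB (identified C T K))) \<gamma>"
  unfolding transported.compatible_def[OF perfect_transported[OF assms]] flat_base_change_def ..

text \<open>The equations defining a morphism of covers say that \<open>cover_S K X\<close> after
  the functor of \<epsilon> is \<open>cover_S K' X\<close>. Under the two identifications the
  functors of \<epsilon> thus become identities, and the other two claims are the same equations on
  components.\<close>

lemma (in flat_data) cover_iso_strict:
  assumes K: "perfect_cover C Oc Pc T B \<beta> \<phi> K" and K': "perfect_cover C Oc Pc T B \<beta> \<phi> K'"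
    and \<epsilon>: "cover_iso C Oc Pc T B K' K \<epsilon>"
  shows "strict_iso C (generated_subcategory C (Oc \<union> Pc)) (pcat T) (pse (identified C T K'))
      (pse (identified C T K)) (identified_map C K' K \<epsilon>)"
    and "f \<in> Pc \<Longrightarrow> A \<in> obj (pcat T (tgt C f)) \<Longrightarrow>
      mar (muT (identified C T K)) f A *[pcat T (src C f)] identified_map C K' K \<epsilon> f A =
      mar (muT (identified C T K')) f A"
    and "f \<in> Oc \<Longrightarrow> A \<in> obj (pcat T (tgt C f)) \<Longrightarrow>
      mar (muB (identified C T K)) f A *[pcat T (src C f)] identified_map C K' K \<epsilon> f A =
      mar (muB (identified C T K')) f A"
proof -
  let ?Q = "generated_subcategory C (Oc \<union> Pc)"
  interpret Q: transporting C ?Q "pse K" "pcat (pse K)" "pcat T" "cover_S K" "cover_Sinv K"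
    by (rule perfect_transporting(1)[OF K])
  interpret Q': transporting C ?Q "pse K'" "pcat (pse K')" "pcat T" "cover_S K'" "cover_Sinv K'"
    by (rule perfect_transporting(1)[OF K'])
  interpret V: transported C Oc Pc T B \<beta> \<phi> Fc Fl \<gamma>T \<gamma>B "pse (identified C T K)"
    "mar (muT (identified C T K))" "mar (muB (identified C T K))"
    by (rule perfect_transported[OF K])
  have pi: "pseudo_iso (subcat C ?Q) (pse K') (pse K) \<epsilon>"
    using \<epsilon> by (auto simp: cover_iso_def cover_morphism_def pseudo_iso_def Let_def)
  have mT: "pmor_eq (subcat C Pc) (pse K') (pmor_comp (subcat C Pc) T (muT K) \<epsilon>) (muT K')"
    and mB: "pmor_eq (subcat C Oc) (pse K') (pmor_comp (subcat C Oc) B (muB K) \<epsilon>) (muB K')"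
    using \<epsilon> by (auto simp: cover_iso_def cover_morphism_def)
  have Z: "functor_eq (pcat (pse K') X) (cover_S K X \<circ>\<^sub>F mob \<epsilon> X) (cover_S K' X)" if "X \<in> obj C" for X
    using mT that V.T.obj_sub by (simp add: pmor_eq_def pmor_comp_def)
  show st: "strict_iso C ?Q (pcat T) (pse (identified C T K')) (pse (identified C T K)) (identified_map C K' K \<epsilon>)"
    using strict_iso_transport[OF Q'.transporting_axioms Q.transporting_axioms pi Z]
    unfolding identified_simps identified_map_def .
  have \<epsilon>f: "is_functor (pcat (pse K') X) (pcat (pse K) X) (mob \<epsilon> X)" if "X \<in> obj C" for X
    using pi that Q.obj_sub by (simp add: pseudo_iso_def pseudo_morphism_def)
  \<comment> \<open>Both sides have image \<open>y\<close> under \<open>cover_S K X\<close>, which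
    is injective on the carrier.\<close>
  have \<epsilon>S: "ob (mob \<epsilon> X) (ob (cover_Sinv K' X) y) = ob (cover_Sinv K X) y"
    if "X \<in> obj C" "y \<in> obj (pcat T X)" for X y
  proof -
    note x = functor_simps(1)[OF Q'.S'_fun[OF that(1)] that(2)]
    have "ob (cover_S K X) (ob (mob \<epsilon> X) (ob (cover_Sinv K' X) y)) = y"
      using Z[OF that(1)] x Q'.SS'(3)[OF that] by (simp add: functor_eq_def comp_functor_simps)
    then show ?thesis using Q.SS'(1)[OF that(1) functor_simps(1)[OF \<epsilon>f[OF that(1)] x]] by simp
  qed
  have muB: "functor_eq (pcat (pse K) X) (cover_S K X) (mob (muB K) X)" if "X \<in> obj C" for X
    using K that by (simp add: perfect_cover_def is_cover_def)
  have nE: "nat_trans (pcat (pse K') (tgt C f)) (pcat (pse K) (src C f)) (mob \<epsilon> (src C f) \<circ>\<^sub>F (pse K')\<langle>f\<rangle>)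
      ((pse K)\<langle>f\<rangle> \<circ>\<^sub>F mob \<epsilon> (tgt C f)) (mar \<epsilon> f)" if "f \<in> ?Q" for f
    using pi Q.R_hom[OF that refl refl] by (simp add: pseudo_iso_def pseudo_morphism_def)
  fix f A assume A: "A \<in> obj (pcat T (tgt C f))"
  let ?A = "ob (cover_Sinv K' (tgt C f)) A"
  { assume f: "f \<in> Pc"
    note fa = V.T.R_arr[OF f]
    have o: "src C f \<in> obj C" "tgt C f \<in> obj C" using fa by (simp_all add: cat_simps)
    have eq: "\<forall>f\<in>Pc. \<forall>A\<in>obj (pcat (pse K') (tgt C f)). mar (muT K) f (ob (mob \<epsilon> (tgt C f)) A) *[pcat T (src C f)]
        ar (cover_S K (src C f)) (mar \<epsilon> f A) = mar (muT K') f A"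
      using mT by (simp add: pmor_eq_def pmor_comp_def subcat_simps)
    then show "mar (muT (identified C T K)) f A *[pcat T (src C f)] identified_map C K' K \<epsilon> f A =
      mar (muT (identified C T K')) f A"
      using eq[rule_format, OF f functor_simps(1)[OF Q'.S'_fun[OF o(2)] A]] \<epsilon>S[OF o(2) A]
      by (simp add: identified_simps identified_map_def) }
  { assume f: "f \<in> Oc"
    note fa = V.B.R_arr[OF f]
    have o: "src C f \<in> obj C" "tgt C f \<in> obj C" using fa by (simp_all add: cat_simps)
    have eq: "\<forall>f\<in>Oc. \<forall>A\<in>obj (pcat (pse K') (tgt C f)). mar (muB K) f (ob (mob \<epsilon> (tgt C f)) A) *[pcat B (src C f)]
        ar (mob (muB K) (src C f)) (mar \<epsilon> f A) = mar (muB K') f A"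
      using mB by (simp add: pmor_eq_def pmor_comp_def subcat_simps)
    have A': "?A \<in> obj (pcat (pse K') (tgt C f))" using functor_simps(1)[OF Q'.S'_fun[OF o(2)] A] .
    \<comment> \<open>Membership in the carrier matters: the functors of \<open>muB K\<close> and
      \<open>muT K\<close> are known to agree only there.\<close>
    have "mar \<epsilon> f ?A \<in> arr (pcat (pse K) (src C f))"
      using nat_transD(3)[OF nE A'] V.OP_Q(1)[OF f] by simp
    then have "ar (mob (muB K) (src C f)) (mar \<epsilon> f ?A) = ar (cover_S K (src C f)) (mar \<epsilon> f ?A)"
      using muB[OF o(1)] by (simp add: functor_eq_def)
    then show "mar (muB (identified C T K)) f A *[pcat T (src C f)] identified_map C K' K \<epsilon> f A =
      mar (muB (identified C T K')) f A"
      using eq[rule_format, OF f A'] \<epsilon>S[OF o(2) A] same_cat[OF o(1)]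
      by (simp add: identified_simps identified_map_def) }
qed

theorem theorem2p3p2:
  fixes C :: "('o, 'a) cat"
    and Oc Pc Fc :: "'a set"
    and T B Fl :: "('o, 'a, 'p, 'q) pseudo"
    and \<beta> \<gamma>T \<gamma>B :: "'a \<Rightarrow> 'a \<Rightarrow> 'a \<Rightarrow> 'a \<Rightarrow> 'p \<Rightarrow> 'q"
    and \<phi> :: "'a \<Rightarrow> 'a \<Rightarrow> 'p \<Rightarrow> 'q"
    and K :: "('o, 'a, 'r, 's, 'p, 'q) cover"
  assumes "flat_data C Oc Pc T B \<beta> \<phi> Fc Fl \<gamma>T \<gamma>B"
    and "perfect_cover C Oc Pc T B \<beta> \<phi> K"
  shows "(\<exists>\<gamma>. flat_base_change C Oc Pc T Fc Fl \<gamma>T \<gamma>B K \<gamma> \<and>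
           (\<forall>\<gamma>'. flat_base_change C Oc Pc T Fc Fl \<gamma>T \<gamma>B K \<gamma>' \<longrightarrow>
             (\<forall>f u f' u'. cartesian C f u f' u' \<longrightarrow>
                f \<in> generated_subcategory C (Oc \<union> Pc) \<longrightarrow> u \<in> Fc \<longrightarrow>
                (\<forall>A\<in>obj (pcat T (tgt C f)). \<gamma>' f u f' u' A = \<gamma> f u f' u' A)))) \<and>
         (\<forall>(K' :: ('o, 'a, 't, 'u, 'p, 'q) cover) \<gamma> \<gamma>' \<epsilon>.
           perfect_cover C Oc Pc T B \<beta> \<phi> K' \<longrightarrow>
           flat_base_change C Oc Pc T Fc Fl \<gamma>T \<gamma>B K \<gamma> \<longrightarrow>
           flat_base_change C Oc Pc T Fc Fl \<gamma>T \<gamma>B K' \<gamma>' \<longrightarrow>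
           cover_iso C Oc Pc T B K' K \<epsilon> \<longrightarrow>
           (\<forall>f u f' u'. cartesian C f u f' u' \<longrightarrow>
              f \<in> generated_subcategory C (Oc \<union> Pc) \<longrightarrow> u \<in> Fc \<longrightarrow>
              (\<forall>A\<in>obj (pcat T (tgt C f)).
                 \<gamma> f u f' u' A \<cdot>\<^bsub>pcat T (src C f')\<^esub> ar (Fl\<langle>u'\<rangle>) (identified_map C K' K \<epsilon> f A) =
                 identified_map C K' K \<epsilon> f' (ob (Fl\<langle>u\<rangle>) A) \<cdot>\<^bsub>pcat T (src C f')\<^esub> \<gamma>' f u f' u' A)))"
proof (intro conjI allI impI ballI)
  interpret flat_data C Oc Pc T B \<beta> \<phi> Fc Fl \<gamma>T \<gamma>B by fact
  note K = assms(2)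
  note tK = perfect_transported[OF K]
  obtain \<gamma> where \<gamma>: "flat_base_change C Oc Pc T Fc Fl \<gamma>T \<gamma>B K \<gamma>"
    using transported.compatible_exists[OF tK] flat_base_change_iff[OF K] by blast
  have unique: "\<gamma>' f u f' u' A = \<gamma> f u f' u' A"
    if "flat_base_change C Oc Pc T Fc Fl \<gamma>T \<gamma>B K \<gamma>'" "cartesian C f u f' u'"
      "f \<in> generated_subcategory C (Oc \<union> Pc)" "u \<in> Fc" "A \<in> obj (pcat T (tgt C f))" for \<gamma>' f u f' u' A
    using transported.compatible_unique[OF tK, of \<gamma>' \<gamma>] that \<gamma> flat_base_change_iff[OF K] by blast
  show "\<exists>\<gamma>. flat_base_change C Oc Pc T Fc Fl \<gamma>T \<gamma>B K \<gamma> \<and>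
           (\<forall>\<gamma>'. flat_base_change C Oc Pc T Fc Fl \<gamma>T \<gamma>B K \<gamma>' \<longrightarrow>
             (\<forall>f u f' u'. cartesian C f u f' u' \<longrightarrow>
                f \<in> generated_subcategory C (Oc \<union> Pc) \<longrightarrow> u \<in> Fc \<longrightarrow>
                (\<forall>A\<in>obj (pcat T (tgt C f)). \<gamma>' f u f' u' A = \<gamma> f u f' u' A)))"
    using \<gamma> unique by blast
next
  interpret flat_data C Oc Pc T B \<beta> \<phi> Fc Fl \<gamma>T \<gamma>B by fact
  note K = assms(2)
  fix K' :: "('o, 'a, 't, 'u, 'p, 'q) cover" and \<gamma> \<gamma>' \<epsilon> f u f' u' A
  assume K': "perfect_cover C Oc Pc T B \<beta> \<phi> K'"
    and \<gamma>: "flat_base_change C Oc Pc T Fc Fl \<gamma>T \<gamma>B K \<gamma>" and \<gamma>': "flat_base_change C Oc Pc T Fc Fl \<gamma>T \<gamma>B K' \<gamma>'"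
    and \<epsilon>: "cover_iso C Oc Pc T B K' K \<epsilon>"
    and s: "cartesian C f u f' u'" "f \<in> generated_subcategory C (Oc \<union> Pc)" "u \<in> Fc"
      "A \<in> obj (pcat T (tgt C f))"
  note tK = perfect_transported[OF K] and tK' = perfect_transported[OF K']
  note conj = compatible_conjugate[OF tK tK' cover_iso_strict(1)[OF K K' \<epsilon>] _ _ \<gamma>[unfolded flat_base_change_iff[OF K]]]
  \<comment> \<open>The family of \<open>K\<close>, conjugated by \<epsilon>, is compatible for
    \<open>K'\<close> and hence equals \<open>\<gamma>'\<close> by uniqueness; its defining relation
    \<open>rel\<close> is then the asserted equation.\<close>
  have compat: "transported.compatible C Oc Pc T Fc Fl \<gamma>T \<gamma>B (pse (identified C T K')) (mar (muT (identified C T K')))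
      (mar (muB (identified C T K'))) (conjugate C (pcat T) Fl (identified_map C K' K \<epsilon>) \<gamma>)"
    by (rule conj(1)) (rule cover_iso_strict(2,3)[OF K K' \<epsilon>]; assumption)+
  have rel: "identified_map C K' K \<epsilon> f' (ob (Fl\<langle>u\<rangle>) A) *[pcat T (src C f')]
        conjugate C (pcat T) Fl (identified_map C K' K \<epsilon>) \<gamma> f u f' u' A =
      \<gamma> f u f' u' A *[pcat T (src C f')] ar (Fl\<langle>u'\<rangle>) (identified_map C K' K \<epsilon> f A)"
    by (rule conj(2)[OF _ _ s]) (rule cover_iso_strict(2,3)[OF K K' \<epsilon>]; assumption)+
  have "conjugate C (pcat T) Fl (identified_map C K' K \<epsilon>) \<gamma> f u f' u' A = \<gamma>' f u f' u' A"
    by (rule transported.compatible_unique[OF tK' compat \<gamma>'[unfolded flat_base_change_iff[OF K']] s(2,1,3,4)])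
  then show "\<gamma> f u f' u' A *[pcat T (src C f')] ar (Fl\<langle>u'\<rangle>) (identified_map C K' K \<epsilon> f A) =
      identified_map C K' K \<epsilon> f' (ob (Fl\<langle>u\<rangle>) A) *[pcat T (src C f')] \<gamma>' f u f' u' A"
    using rel by simp
qed

end
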